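(* Let $f\colon S^2\to S^2$ be an expanding Thurston map, let $\mathcal C\subseteq S^2$ be a Jordan curve containing $\operatorname{post} f$ with $f^{n_{\mathcal C}}(\mathcal C)\subseteq\mathcal C$ for some $n_{\mathcal C}\in\mathbb N$, and let $d$ be a visual metric on $S^2$ for $f$. Then $(S^2,f)$ has the Bressaud–Quas shadowing property. More precisely, for every nonempty compact set $\mathcal K\subseteq S^2$ with $f(\mathcal K)\subseteq\mathcal K$ and every $\kappa>0$, there exists a number $\epsilon_0>0$ such that for each $\epsilon\in(0,\epsilon_0)$, there is a periodic orbit $\mathcal O$ of $f$ of period $p<(1/\epsilon)^\kappa$ contained entirely in the $\epsilon$-neighborhood $N_d^\epsilon(\mathcal K)=\{y\in S^2:d(y,\mathcal K)<\epsilon\}$ of $\mathcal K$.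
   Context: A map $T\colon X\to X$ on a metric space $(X,d)$ has the Bressaud–Quas shadowing property if for every nonempty compact set $\mathcal K$ with $T(\mathcal K)\subseteq\mathcal K$ and every $\kappa>0$ there exists $\epsilon_0>0$ such that for each $\epsilon\in(0,\epsilon_0)$ there is a periodic orbit of $T$ of period $p<(1/\epsilon)^\kappa$ contained in the $\epsilon$-neighborhood of $\mathcal K$. $\mathbb N=\{1,2,\dots\}$, $\mathbb N_0=\mathbb N\cup\{0\}$. $S^2$ is an oriented topological $2$-sphere. A continuous map $f\colon S^2\to S^2$ is a branched covering map if near each $x\in S^2$, in suitable orientation-preserving local homeomorphic coordinates sending $x$ and $f(x)$ to $0\in\mathbb C$, it has the form $z\mapsto z^k$ with $k=\deg_f(x)\in\mathbb N$. Put $\operatorname{crit} f=\{x:\deg_f(x)\ge 2\}$ and $\operatorname{post} f=\{f^n(x): x\in\operatorname{crit} f,\ n\in\mathbb N\}$. A Thurston map is a branched covering map of topological degree $\ge 2$ with $\operatorname{post} f$ finite. For a Jordan curve $\mathcal C\subseteq S^2$ with $\operatorname{post} f\subseteq\mathcal C$ and $n\in\mathbb N_0$: the $n$-tiles are the closures of the connected components of $S^2\setminus f^{-n}(\mathcal C)$; the $n$-edges are the closures of the connected components of $f^{-n}(\mathcal C)\setminus f^{-n}(\operatorname{post} f)$; the $n$-vertices are the points of $f^{-n}(\operatorname{post} f)$; the $n$-cells are the $n$-tiles, the $n$-edges, and the singletons $\{v\}$ with $v$ an $n$-vertex. A Thurston map $f$ is expanding if for some (equivalently, every) metric inducing the topology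 of $S^2$ and some (equivalently, every) Jordan curve $\mathcal C\supseteq\operatorname{post} f$, the maximal diameter of $n$-tiles tends to $0$ as $n\to+\infty$. A metric $d$ on $S^2$ is a visual metric for an expanding Thurston map $f$ with expansion factor $\Lambda>1$ if for some (equivalently, every) Jordan curve $\mathcal C\supseteq\operatorname{post} f$ there is $C\ge1$ such that for all $n\in\mathbb N_0$: $d(\sigma,\tau)\ge C^{-1}\Lambda^{-n}$ for all disjoint $n$-cells $\sigma,\tau$, and $C^{-1}\Lambda^{-n}\le\operatorname{diam}_d(\tau)\le C\Lambda^{-n}$ for all $n$-edges and $n$-tiles $\tau$. *)

theory Defs
  imports "HOL-Complex_Analysis.Complex_Analysis" "HOL-Homology.Homology"
begin

text \<open>A homeomorphism between open subsets of the plane preserves orientation iff it maps small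
  positively oriented circles to loops winding once, positively, around the image of the centre.\<close>

definition orientation_preserving_on :: "complex set \<Rightarrow> (complex \<Rightarrow> complex) \<Rightarrow> bool" where
  "orientation_preserving_on V h \<longleftrightarrow>
     (\<forall>p r. 0 < r \<and> cball p r \<subseteq> V \<longrightarrow> winding_number (h \<circ> circlepath p r) (h p) = 1)"

definition planar_chart :: "'a topology \<Rightarrow> 'a set \<times> ('a \<Rightarrow> complex) \<Rightarrow> bool" where
  "planar_chart X = (\<lambda>(U, \<phi>). openin X U \<and> open (\<phi> ` U) \<and>
     homeomorphic_map (subtopology X U) (top_of_set (\<phi> ` U)) \<phi>)"

definition oriented_transition ::
  "'a set \<times> ('a \<Rightarrow> complex) \<Rightarrow> 'a set \<times> ('a \<Rightarrow> complex) \<Rightarrow> bool" where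
  "oriented_transition = (\<lambda>(U, \<phi>) (V, \<psi>).
     orientation_preserving_on (\<phi> ` (U \<inter> V)) (\<psi> \<circ> inv_into U \<phi>))"

definition oriented_atlas :: "'a topology \<Rightarrow> ('a set \<times> ('a \<Rightarrow> complex)) set \<Rightarrow> bool" where
  "oriented_atlas X A \<longleftrightarrow>
     (\<forall>a\<in>A. planar_chart X a) \<and> (\<Union>a\<in>A. fst a) = topspace X \<and>
     (\<forall>a\<in>A. \<forall>b\<in>A. oriented_transition a b)"

definition oriented_sphere :: "'a topology \<Rightarrow> ('a set \<times> ('a \<Rightarrow> complex)) set \<Rightarrow> bool" where
  "oriented_sphere X A \<longleftrightarrow>
     X homeomorphic_space top_of_set (sphere (0 :: real ^ 3) 1) \<and> oriented_atlas X A"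

text \<open>The charts of \<open>A\<close> only generate the orientation; the orientation-preserving local
  coordinates are all charts compatible with them.\<close>

definition oriented_chart ::
  "'a topology \<Rightarrow> ('a set \<times> ('a \<Rightarrow> complex)) set \<Rightarrow> 'a set \<times> ('a \<Rightarrow> complex) \<Rightarrow> bool" where
  "oriented_chart X A c \<longleftrightarrow> planar_chart X c \<and> (\<forall>a\<in>A. oriented_transition a c)"

definition has_local_degree ::
  "'a topology \<Rightarrow> ('a set \<times> ('a \<Rightarrow> complex)) set \<Rightarrow> ('a \<Rightarrow> 'a) \<Rightarrow> 'a \<Rightarrow> nat \<Rightarrow> bool" where
  "has_local_degree X A f x k \<longleftrightarrow> k \<ge> 1 \<and>
     (\<exists>U \<phi> V \<psi>. oriented_chart X A (U, \<phi>) \<and> oriented_chart X A (V, \<psi>) \<and>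
        x \<in> U \<and> f ` U \<subseteq> V \<and> \<phi> x = 0 \<and> \<psi> (f x) = 0 \<and>
        (\<forall>y\<in>U. \<psi> (f y) = \<phi> y ^ k))"

definition local_degree ::
  "'a topology \<Rightarrow> ('a set \<times> ('a \<Rightarrow> complex)) set \<Rightarrow> ('a \<Rightarrow> 'a) \<Rightarrow> 'a \<Rightarrow> nat" where
  "local_degree X A f x = (THE k. has_local_degree X A f x k)"

definition branched_covering ::
  "'a topology \<Rightarrow> ('a set \<times> ('a \<Rightarrow> complex)) set \<Rightarrow> ('a \<Rightarrow> 'a) \<Rightarrow> bool" where
  "branched_covering X A f \<longleftrightarrow>
     continuous_map X X f \<and> (\<forall>x\<in>topspace X. \<exists>k. has_local_degree X A f x k)"

definition crit ::
  "'a topology \<Rightarrow> ('a set \<times> ('a \<Rightarrow> complex)) set \<Rightarrow> ('a \<Rightarrow> 'a) \<Rightarrow> 'a set" where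
  "crit X A f = {x \<in> topspace X. local_degree X A f x \<ge> 2}"

definition post ::
  "'a topology \<Rightarrow> ('a set \<times> ('a \<Rightarrow> complex)) set \<Rightarrow> ('a \<Rightarrow> 'a) \<Rightarrow> 'a set" where
  "post X A f = {(f ^^ n) x | x n. x \<in> crit X A f \<and> n \<ge> 1}"

text \<open>The analogue of \<open>Brouwer_degree2\<close> for a space that is merely homeomorphic to the
  2-sphere: the integer by which a self-map acts on the infinite cyclic second homology group,
  which the library writes multiplicatively.\<close>

definition topological_degree :: "'a topology \<Rightarrow> ('a \<Rightarrow> 'a) \<Rightarrow> int" where
  "topological_degree X f =
     (THE m::int. \<forall>c \<in> carrier (homology_group 2 X).
        hom_induced 2 X {} X {} f c = c [^]\<^bsub>homology_group 2 X\<^esub> m)"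

definition thurston_map ::
  "'a topology \<Rightarrow> ('a set \<times> ('a \<Rightarrow> complex)) set \<Rightarrow> ('a \<Rightarrow> 'a) \<Rightarrow> bool" where
  "thurston_map X A f \<longleftrightarrow>
     branched_covering X A f \<and> topological_degree X f \<ge> 2 \<and> finite (post X A f)"

definition jordan_curve :: "'a topology \<Rightarrow> 'a set \<Rightarrow> bool" where
  "jordan_curve X C \<longleftrightarrow>
     C \<subseteq> topspace X \<and> subtopology X C homeomorphic_space top_of_set (sphere (0::complex) 1)"

definition iter_preimage :: "'a topology \<Rightarrow> ('a \<Rightarrow> 'a) \<Rightarrow> nat \<Rightarrow> 'a set \<Rightarrow> 'a set" where
  "iter_preimage X f n B = {x \<in> topspace X. (f ^^ n) x \<in> B}"

definition tiles :: "'a topology \<Rightarrow> ('a \<Rightarrow> 'a) \<Rightarrow> 'a set \<Rightarrow> nat \<Rightarrow> 'a set set" where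
  "tiles X f C n =
     (\<lambda>U. X closure_of U) `
       connected_components_of (subtopology X (topspace X - iter_preimage X f n C))"

definition edges ::
  "'a topology \<Rightarrow> ('a set \<times> ('a \<Rightarrow> complex)) set \<Rightarrow> ('a \<Rightarrow> 'a) \<Rightarrow> 'a set \<Rightarrow> nat \<Rightarrow> 'a set set" where
  "edges X A f C n =
     (\<lambda>U. X closure_of U) `
       connected_components_of
         (subtopology X (iter_preimage X f n C - iter_preimage X f n (post X A f)))"

definition cells ::
  "'a topology \<Rightarrow> ('a set \<times> ('a \<Rightarrow> complex)) set \<Rightarrow> ('a \<Rightarrow> 'a) \<Rightarrow> 'a set \<Rightarrow> nat \<Rightarrow> 'a set set" where
  "cells X A f C n =
     tiles X f C n \<union> edges X A f C n \<union> {{v} | v. v \<in> iter_preimage X f n (post X A f)}"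

text \<open>Diameters and distances take values in \<^typ>\<open>ennreal\<close>, so that no boundedness of the metric
  is presupposed.\<close>

definition ediam :: "('a \<Rightarrow> 'a \<Rightarrow> real) \<Rightarrow> 'a set \<Rightarrow> ennreal" where
  "ediam d B = (SUP x\<in>B. SUP y\<in>B. ennreal (d x y))"

definition esetdist :: "('a \<Rightarrow> 'a \<Rightarrow> real) \<Rightarrow> 'a set \<Rightarrow> 'a set \<Rightarrow> ennreal" where
  "esetdist d B D = (INF x\<in>B. INF y\<in>D. ennreal (d x y))"

definition expanding ::
  "'a topology \<Rightarrow> ('a set \<times> ('a \<Rightarrow> complex)) set \<Rightarrow> ('a \<Rightarrow> 'a) \<Rightarrow> bool" where
  "expanding X A f \<longleftrightarrow>
     (\<exists>\<rho> C. Metric_space (topspace X) \<rho> \<and> Metric_space.mtopology (topspace X) \<rho> = X \<and>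
        jordan_curve X C \<and> post X A f \<subseteq> C \<and>
        (\<lambda>n. SUP \<tau>\<in>tiles X f C n. ediam \<rho> \<tau>) \<longlonglongrightarrow> 0)"

definition visual_metric ::
  "'a topology \<Rightarrow> ('a set \<times> ('a \<Rightarrow> complex)) set \<Rightarrow> ('a \<Rightarrow> 'a) \<Rightarrow> ('a \<Rightarrow> 'a \<Rightarrow> real) \<Rightarrow> real \<Rightarrow> bool"
  where
  "visual_metric X A f d \<Lambda> \<longleftrightarrow>
     Metric_space (topspace X) d \<and> \<Lambda> > 1 \<and>
     (\<exists>C K. jordan_curve X C \<and> post X A f \<subseteq> C \<and> K \<ge> 1 \<and>
        (\<forall>n. (\<forall>\<sigma>\<in>cells X A f C n. \<forall>\<tau>\<in>cells X A f C n. \<sigma> \<inter> \<tau> = {} \<longrightarrow>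
                 esetdist d \<sigma> \<tau> \<ge> ennreal (1 / (K * \<Lambda> ^ n))) \<and>
             (\<forall>\<tau>\<in>edges X A f C n \<union> tiles X f C n.
                 ennreal (1 / (K * \<Lambda> ^ n)) \<le> ediam d \<tau> \<and> ediam d \<tau> \<le> ennreal (K / \<Lambda> ^ n))))"

text \<open>The period of a periodic orbit is its least period, that is, the number of its points.\<close>

definition periodic_orbit :: "'a set \<Rightarrow> ('a \<Rightarrow> 'a) \<Rightarrow> 'a set \<Rightarrow> nat \<Rightarrow> bool" where
  "periodic_orbit M T Orb p \<longleftrightarrow>
     (\<exists>x\<in>M. 0 < p \<and> (T ^^ p) x = x \<and> (\<forall>q. 0 < q \<and> q < p \<longrightarrow> (T ^^ q) x \<noteq> x) \<and>
        Orb = {(T ^^ i) x | i. i < p})"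

definition metric_nbhd :: "'a set \<Rightarrow> ('a \<Rightarrow> 'a \<Rightarrow> real) \<Rightarrow> real \<Rightarrow> 'a set \<Rightarrow> 'a set" where
  "metric_nbhd M d \<epsilon> K = {y \<in> M. esetdist d {y} K < ennreal \<epsilon>}"

definition bressaud_quas_shadowing :: "'a set \<Rightarrow> ('a \<Rightarrow> 'a \<Rightarrow> real) \<Rightarrow> ('a \<Rightarrow> 'a) \<Rightarrow> bool" where
  "bressaud_quas_shadowing M d T \<longleftrightarrow>
     Metric_space M d \<and> T \<in> M \<rightarrow> M \<and>
     (\<forall>K \<kappa>. compactin (Metric_space.mtopology M d) K \<and> K \<noteq> {} \<and> T ` K \<subseteq> K \<and> \<kappa> > 0 \<longrightarrow>
        (\<exists>\<epsilon>0>0. \<forall>\<epsilon>. 0 < \<epsilon> \<and> \<epsilon> < \<epsilon>0 \<longrightarrow>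
           (\<exists>Orb p. periodic_orbit M T Orb p \<and> real p < (1 / \<epsilon>) powr \<kappa> \<and>
              Orb \<subseteq> metric_nbhd M d \<epsilon> K)))"

end

theory Submission
  imports Defs "HOL-Real_Asymp.Real_Asymp"
begin

text \<open>
The proof follows Bressaud and Quas, with tiles in the place of words. Put \<open>F = f ^^ nC\<close>. Since
\<open>F\<close> maps \<open>C\<close> into itself, its tiles have the Markov property: a tile of level \<open>n + k\<close> lies in one
tile of level \<open>n\<close>, is mapped by \<open>F^n\<close> onto a tile of level \<open>k\<close>, and is determined by these two
tiles, because \<open>F^n\<close> is injective on each tile of level \<open>n\<close>. Let \<open>N n\<close> be the number of tiles of
level \<open>n\<close> whose closure meets the invariant compact set. Then \<open>N\<close> is submultiplicative, and a tile
of level \<open>s * n\<close> amounts to a walk with \<open>s\<close> vertices in a digraph on the tiles of level \<open>n\<close>.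

If this digraph had no closed walk of length at most \<open>s\<close>, every walk with \<open>s\<close> vertices would
be the only Hamiltonian path of an acyclic digraph, so that it would be determined by its set of
vertices (\<open>card_walks_le\<close>). Hence \<open>N (s * n) \<le> N n choose s \<le> N n ^ s / s!\<close>. By Fekete's argument
there is an \<open>h\<close> with \<open>exp (h * n) \<le> N n\<close> for all \<open>n\<close> and \<open>N n \<le> exp ((h + \<delta>) * n)\<close> for large \<open>n\<close>, and
therefore \<open>s \<le> exp (1 + \<delta> * n)\<close> (\<open>binomial_growth_bound\<close>). So there is a closed walk whose length is
at most about \<open>exp (\<delta> * n)\<close>. Pulling tiles back along it again and again gives a nested sequence of
tiles that shrinks to a periodic point, whose orbit follows tiles of level \<open>2 * n\<close> that touch the
invariant set (\<open>periodic_point_of_closed_walk\<close>). The orbit stays within \<open>B / \<Lambda> ^ (nC * n)\<close> of that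
set, and \<open>\<delta>\<close> may be chosen as small as \<open>\<kappa>\<close> demands.

What remains is that tiles of level \<open>n\<close> for \<open>f\<close> have diameter at most \<open>B / \<Lambda> ^ n\<close>. The visual metric
promises this for one Jordan curve only, which need not be \<open>C\<close>. To pass between curves one needs
connected sets with small image under \<open>f ^^ n\<close> to have diameter of order \<open>1 / \<Lambda> ^ n\<close>. The key is
\<open>preimage_of_disc_centre_unique\<close>: a component of the preimage of a disc that contains no critical
value except possibly its centre contains only one preimage of the centre. It follows that such a
set lies in the star of tiles around a single point (\<open>star_nbhd\<close>); the same lemma, applied to
the complementary components of a Jordan curve, which are discs by the Riemann mapping theorem,
makes iterates injective on tiles. Both are elementary topology of open maps with finite fibres that
are locally injective off the critical points.
\<close>

section \<open>Digraphs without short closed walks\<close>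

definition no_closed_walk :: "('v \<times> 'v) set \<Rightarrow> nat \<Rightarrow> bool" where
  "no_closed_walk E s \<longleftrightarrow>
     \<not> (\<exists>l c. 1 \<le> l \<and> l \<le> s \<and> (\<forall>i<l. (c i, c (Suc i)) \<in> E) \<and> c l = c 0)"

definition walk :: "('v \<times> 'v) set \<Rightarrow> nat \<Rightarrow> (nat \<Rightarrow> 'v) \<Rightarrow> bool" where
  "walk E s a \<longleftrightarrow> (\<forall>i. Suc i < s \<longrightarrow> (a i, a (Suc i)) \<in> E)"

lemma no_closed_walkD:
  assumes "no_closed_walk E s" "1 \<le> l" "l \<le> s" "\<forall>i<l. (c i, c (Suc i)) \<in> E"
  shows "c l \<noteq> c 0"
proof
  assume "c l = c 0"
  then have "\<exists>l c. 1 \<le> l \<and> l \<le> s \<and> (\<forall>i<l. (c i, c (Suc i)) \<in> E) \<and> c l = c 0"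
    using assms by (intro exI[of _ l] exI[of _ c]) simp
  then show False using assms(1) by (simp add: no_closed_walk_def)
qed

text \<open>Along the two walks, the position in \<open>a\<close> of the current vertex of \<open>b\<close> must increase: if it fell
from \<open>p i\<close> to \<open>p (Suc i)\<close>, the stretch of \<open>a\<close> between these positions and the edge
of \<open>b\<close> leading back would form a closed walk.\<close>

lemma walk_position_le:
  assumes nocyc: "no_closed_walk E s" and a: "walk E s a" and b: "walk E s b"
    and p: "\<forall>i<s. p i < s \<and> a (p i) = b i"
    and "i < s"
  shows "i \<le> p i"
  using \<open>i < s\<close>
proof (induction i)
  case (Suc i)
  have "p i < p (Suc i)"
  proof (rule ccontr)
    assume "\<not> p i < p (Suc i)"
    define m where "m = p i - p (Suc i)"
    have m: "p (Suc i) + m = p i" using \<open>\<not> p i < p (Suc i)\<close> by (simp add: m_def)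
    define c where "c t = (if t \<le> m then a (p (Suc i) + t) else b (Suc i))" for t
    have pi: "p i < s" using p Suc.prems by simp
    have "\<forall>t<Suc m. (c t, c (Suc t)) \<in> E"
    proof (intro allI impI)
      fix t assume "t < Suc m"
      then consider "t < m" | "t = m" by linarith
      then show "(c t, c (Suc t)) \<in> E"
      proof cases
        case 1
        then have "Suc (p (Suc i) + t) < s" using m pi by linarith
        then show ?thesis using a 1 by (simp add: c_def walk_def)
      next
        case 2
        then show ?thesis using b p Suc.prems m by (simp add: c_def walk_def)
      qed
    qed
    moreover have "c (Suc m) = c 0" using p Suc.prems by (simp add: c_def)
    moreover have "1 \<le> Suc m" "Suc m \<le> s" using m pi by linarith+
    ultimately show False using no_closed_walkD[OF nocyc, of "Suc m" c] by simp
  qed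
  then show ?case using Suc by simp
qed simp

lemma walk_inj_on:
  assumes nocyc: "no_closed_walk E s" and a: "walk E s a"
  shows "inj_on a {..<s}"
proof (rule linorder_inj_onI')
  fix i j assume ij: "i \<in> {..<s}" "j \<in> {..<s}" "i < j"
  show "a i \<noteq> a j"
  proof
    assume "a i = a j"
    define c where "c t = a (i + t)" for t
    have "\<forall>t<j - i. (c t, c (Suc t)) \<in> E" using ij a by (auto simp: c_def walk_def)
    moreover have "c (j - i) = c 0" using ij \<open>a i = a j\<close> by (simp add: c_def)
    moreover have "1 \<le> j - i" "j - i \<le> s" using ij by auto
    ultimately show False using no_closed_walkD[OF nocyc, of "j - i" c] by simp
  qed
qed

text \<open>An acyclic digraph has at most one Hamiltonian path.\<close>

lemma walk_eq_if_same_vertices: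
  assumes nocyc: "no_closed_walk E s" and a: "walk E s a" and b: "walk E s b"
    and img: "a ` {..<s} = b ` {..<s}" and "i < s"
  shows "a i = b i"
proof -
  have "\<exists>k<s. a k = b i" "\<exists>k<s. b k = a i" if "i < s" for i
  proof -
    have "b i \<in> a ` {..<s}" "a i \<in> b ` {..<s}" using img that by auto
    then show "\<exists>k<s. a k = b i" "\<exists>k<s. b k = a i" by auto
  qed
  note ex = this
  define p q where "p i = (SOME k. k < s \<and> a k = b i)" and "q i = (SOME k. k < s \<and> b k = a i)" for i
  have p: "\<forall>i<s. p i < s \<and> a (p i) = b i" unfolding p_def using someI_ex[OF ex(1)] by blast
  have q: "\<forall>i<s. q i < s \<and> b (q i) = a i" unfolding q_def using someI_ex[OF ex(2)] by blast
  have "i \<le> p i" by (rule walk_position_le[OF nocyc a b p \<open>i < s\<close>])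
  moreover have "p i \<le> q (p i)"
    using walk_position_le[OF nocyc b a q] p \<open>i < s\<close> by blast
  moreover have "q (p i) = i"
  proof (rule inj_onD[OF walk_inj_on[OF nocyc b]])
    show "b (q (p i)) = b i" "q (p i) \<in> {..<s}" "i \<in> {..<s}" using p q \<open>i < s\<close> by auto
  qed
  ultimately have "p i = i" by simp
  then show ?thesis using p \<open>i < s\<close> by metis
qed

lemma card_walks_le:
  assumes nocyc: "no_closed_walk E s" and "finite V"
    and walk: "\<And>x. x \<in> S \<Longrightarrow> walk E s (w x)"
    and V: "\<And>x i. \<lbrakk>x \<in> S; i < s\<rbrakk> \<Longrightarrow> w x i \<in> V"
    and inj: "\<And>x y. \<lbrakk>x \<in> S; y \<in> S; \<forall>i<s. w x i = w y i\<rbrakk> \<Longrightarrow> x = y"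
  shows "card S \<le> card V choose s"
proof -
  have "inj_on (\<lambda>x. w x ` {..<s}) S"
  proof (rule inj_onI)
    fix x y assume xy: "x \<in> S" "y \<in> S" "w x ` {..<s} = w y ` {..<s}"
    have "w x i = w y i" if "i < s" for i
      by (rule walk_eq_if_same_vertices[OF nocyc walk[OF xy(1)] walk[OF xy(2)] xy(3) that])
    then show "x = y" using inj xy by blast
  qed
  moreover have "(\<lambda>x. w x ` {..<s}) ` S \<subseteq> {B. B \<subseteq> V \<and> card B = s}"
    using V walk_inj_on[OF nocyc walk] by (auto simp: card_image)
  moreover have "finite {B. B \<subseteq> V \<and> card B = s}"
    using \<open>finite V\<close> by (auto intro: finite_subset[of _ "Pow V"])
  ultimately have "card S \<le> card {B. B \<subseteq> V \<and> card B = s}"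
    by (rule card_inj_on_le)
  then show ?thesis using n_subsets[OF \<open>finite V\<close>] by simp
qed

text \<open>The left-hand side divided by \<open>fact s\<close> is one term of the exponential series of \<open>s\<close>.\<close>

lemma power_le_exp_fact: "real s ^ s \<le> exp (real s) * fact s"
proof -
  have sums: "(\<lambda>n. real s ^ n /\<^sub>R fact n) sums exp (real s)" by (rule exp_converges)
  have "sum (\<lambda>n. real s ^ n /\<^sub>R fact n) {s} \<le> suminf (\<lambda>n. real s ^ n /\<^sub>R fact n)"
    by (rule sum_le_suminf[OF sums_summable[OF sums]]) auto
  also have "\<dots> = exp (real s)" using sums_unique[OF sums] by simp
  finally have "real s ^ s /\<^sub>R fact s \<le> exp (real s)" by simp
  then show ?thesis by (simp add: field_simps)
qed

text \<open>Fekete's lemma: \<open>h\<close> is the infimum of \<open>ln (N n) / n\<close>, and dividing with remainder by an \<open>m\<close> that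
almost attains it gives the upper bound.\<close>

lemma submultiplicative_growth:
  fixes N :: "nat \<Rightarrow> nat"
  assumes pos: "\<And>n. N n \<ge> 1" and sub: "\<And>m n. N (m + n) \<le> N m * N n" and "\<delta> > 0"
  obtains h n0 where "\<And>n. exp (h * real n) \<le> real (N n)"
    "\<And>n. n \<ge> n0 \<Longrightarrow> real (N n) \<le> exp ((h + \<delta>) * real n)"
proof -
  define L where "L n = ln (real (N n))" for n
  have L0: "L n \<ge> 0" for n using pos[of n] by (simp add: L_def)
  have Lsub: "L (m + n) \<le> L m + L n" for m n
  proof -
    have "real (N (m + n)) \<le> real (N m) * real (N n)"
      using sub[of m n] by (metis of_nat_le_iff of_nat_mult)
    then have "ln (real (N (m + n))) \<le> ln (real (N m) * real (N n))"
      using pos[of "m + n"] by (simp add: )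
    then show ?thesis unfolding L_def using pos[of m] pos[of n] by (simp add: ln_mult)
  qed
  have Lmult: "L (k * m) \<le> real k * L m" if "k \<ge> 1" for k m
    using that
  proof (induction k rule: dec_induct)
    case (step k)
    have "L (Suc k * m) \<le> L m + L (k * m)" using Lsub[of m "k * m"] by simp
    also have "\<dots> \<le> real (Suc k) * L m" using step by (simp add: algebra_simps)
    finally show ?case .
  qed simp
  define h where "h = (INF n\<in>{1..}. L n / real n)"
  have bdd: "bdd_below ((\<lambda>n. L n / real n) ` {1..})"
    by (rule bdd_belowI[of _ 0]) (auto simp: L0)
  have hle: "h \<le> L n / real n" if "n \<ge> 1" for n
    unfolding h_def by (rule cINF_lower[OF bdd]) (use that in auto)
  have low: "h * real n \<le> L n" for n
    using hle[of n] L0[of n] by (cases "n = 0") (auto simp: field_simps)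
  have "\<exists>n\<in>{1..}. L n / real n < h + \<delta> / 2"
    using cINF_less_iff[OF _ bdd, of "h + \<delta>/2"] \<open>\<delta> > 0\<close> unfolding h_def[symmetric] by auto
  then obtain m where m: "m \<ge> 1" "L m / real m < h + \<delta> / 2" by auto
  then have Lm: "L m \<le> (h + \<delta> / 2) * real m" by (simp add: field_simps)
  \<comment> \<open>The remainders, and \<open>L 0\<close> when the quotient vanishes, are absorbed by a constant.\<close>
  define B where "B = 2 * (\<Sum>r<m. L r) + \<bar>h\<bar> * real m + \<delta> * real m"
  have B0: "B \<ge> 0" using L0 \<open>\<delta> > 0\<close> by (simp add: B_def sum_nonneg)
  have up: "L n \<le> (h + \<delta> / 2) * real n + B" for n
  proof -
    define q r where "q = n div m" and "r = n mod m"
    have n: "n = q * m + r" by (simp add: q_def r_def)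
    have rm: "r < m" using m by (simp add: r_def)
    have Lr: "L r \<le> (\<Sum>r<m. L r)" using rm L0 by (intro member_le_sum) auto
    have Lq: "L (q * m) \<le> (h + \<delta> / 2) * real (q * m) + L 0"
    proof (cases "q = 0")
      case False
      then have "L (q * m) \<le> real q * L m" using Lmult by simp
      also have "\<dots> \<le> real q * ((h + \<delta> / 2) * real m)" using Lm by (simp add: mult_left_mono)
      finally show ?thesis using L0[of 0] by (simp add: algebra_simps)
    qed (use L0 in simp)
    have L00: "L 0 \<le> (\<Sum>r<m. L r)" using m L0 by (intro member_le_sum) auto
    have "\<bar>h + \<delta>/2\<bar> * real r \<le> \<bar>h\<bar> * real m + \<delta> * real m"
    proof -
      have "\<bar>h + \<delta>/2\<bar> * real r \<le> (\<bar>h\<bar> + \<delta>) * real m"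
        using rm \<open>\<delta> > 0\<close> by (intro mult_mono) auto
      then show ?thesis by (simp add: algebra_simps)
    qed
    moreover have "- ((h + \<delta>/2) * real r) \<le> \<bar>h + \<delta>/2\<bar> * real r"
      by (metis abs_ge_minus_self abs_mult abs_of_nat)
    ultimately have "0 \<le> (h + \<delta>/2) * real r + \<bar>h\<bar> * real m + \<delta> * real m" by linarith
    moreover have "L n \<le> L (q * m) + L r" using Lsub[of "q * m" r] n by simp
    moreover have "(h + \<delta>/2) * real n = (h + \<delta>/2) * real (q * m) + (h + \<delta>/2) * real r"
      using n by (metis distrib_left of_nat_add)
    ultimately show ?thesis using Lq Lr L00 unfolding B_def by linarith
  qed
  obtain n0 where n0: "real n0 > 2 * B / \<delta>" using reals_Archimedean2 by blast
  show thesis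
  proof
    fix n
    show "exp (h * real n) \<le> real (N n)"
      using low[of n] pos[of n] unfolding L_def
      by (metis exp_le_cancel_iff exp_ln of_nat_0_less_iff less_le_trans zero_less_one)
    assume "n \<ge> n0"
    then have "2 * B / \<delta> \<le> real n" using n0 by linarith
    then have "B \<le> \<delta> / 2 * real n" using \<open>\<delta> > 0\<close> by (simp add: field_simps)
    then have "L n \<le> (h + \<delta>) * real n" using up[of n] by (simp add: algebra_simps)
    then show "real (N n) \<le> exp ((h + \<delta>) * real n)"
      using pos[of n] unfolding L_def
      by (metis exp_le_cancel_iff exp_ln of_nat_0_less_iff less_le_trans zero_less_one)
  qed
qed

text \<open>With the growth rate \<open>h\<close> of \<open>N\<close>, the hypothesis gives
\<open>exp (h * s * n) * fact s \<le> exp ((h + \<delta>) * n * s)\<close>: the exponential rates cancel and the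
factorial forces \<open>s\<close> to be small.\<close>

lemma binomial_growth_bound:
  fixes N :: "nat \<Rightarrow> nat"
  assumes pos: "\<And>n. N n \<ge> 1" and sub: "\<And>m n. N (m + n) \<le> N m * N n" and "\<delta> > 0"
  obtains n0 where
    "\<And>n s. \<lbrakk>n \<ge> n0; N (s * n) \<le> N n choose s\<rbrakk> \<Longrightarrow> real s \<le> exp (1 + \<delta> * real n)"
proof -
  obtain h n0 where low: "\<And>n. exp (h * real n) \<le> real (N n)"
    and up: "\<And>n. n \<ge> n0 \<Longrightarrow> real (N n) \<le> exp ((h + \<delta>) * real n)"
    using submultiplicative_growth[OF pos sub \<open>\<delta> > 0\<close>] by blast
  show thesis
  proof
    fix n s assume n: "n \<ge> n0" and le: "N (s * n) \<le> N n choose s"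
    have "N (s * n) * fact s \<le> N n ^ s"
      using le binomial_fact_pow[of "N n" s] by (meson le_trans mult_le_mono1)
    then have "real (N (s * n) * fact s) \<le> real (N n ^ s)" by (simp only: of_nat_le_iff)
    then have "real (N (s * n)) * fact s \<le> real (N n) ^ s" by simp
    have "exp (h * real (s * n)) * fact s \<le> real (N (s * n)) * fact s"
      by (intro mult_right_mono low) auto
    also have "\<dots> \<le> real (N n) ^ s" by fact
    also have "\<dots> \<le> exp ((h + \<delta>) * real n) ^ s" using up[OF n] by (intro power_mono) auto
    also have "\<dots> = exp (h * real (s * n)) * exp (\<delta> * real n * real s)"
      by (simp flip: exp_of_nat_mult exp_add) (simp add: algebra_simps)
    finally have "fact s \<le> exp (\<delta> * real n * real s)" by simp
    then have "real s ^ s \<le> exp (real s) * exp (\<delta> * real n * real s)"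
      using power_le_exp_fact[of s] by (meson mult_left_mono exp_ge_zero order_trans)
    also have "\<dots> = exp (1 + \<delta> * real n) ^ s"
      by (simp flip: exp_of_nat_mult exp_add) (simp add: algebra_simps)
    finally have *: "real s ^ s \<le> exp (1 + \<delta> * real n) ^ s" .
    show "real s \<le> exp (1 + \<delta> * real n)"
    proof (cases "s = 0")
      case False
      then show ?thesis using * by (simp add: power_mono_iff)
    qed simp
  qed
qed

section \<open>Components and finite open maps\<close>

text \<open>Components of a subset are written as subsets of the ambient space, since the proof compares
components of many different open sets.\<close>

definition component :: "'a topology \<Rightarrow> 'a set \<Rightarrow> 'a \<Rightarrow> 'a set" where
  "component X S x = connected_component_of_set (subtopology X S) x"

lemma component_subset: "component X S x \<subseteq> S" and component_subset_topspace: "component X S x \<subseteq> topspace X"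
  unfolding component_def using connected_component_of_subset_topspace[of "subtopology X S" x] by auto

lemma component_connected: "connectedin X (component X S x)"
  unfolding component_def by (meson connectedin_connected_component_of connectedin_subtopology)

lemma component_refl: "\<lbrakk>x \<in> S; x \<in> topspace X\<rbrakk> \<Longrightarrow> x \<in> component X S x"
  by (simp add: component_def connected_component_of_refl)

lemma component_nonempty: "y \<in> component X S x \<Longrightarrow> x \<in> component X S x"
  unfolding component_def mem_Collect_eq
  by (meson connected_component_of_sym connected_component_of_trans)

lemma component_maximal: "\<lbrakk>connectedin X T; T \<subseteq> S; x \<in> T\<rbrakk> \<Longrightarrow> T \<subseteq> component X S x"
  unfolding component_def by (simp add: connected_component_of_maximal connectedin_subtopology)

lemma component_eq: "y \<in> component X S x \<Longrightarrow> component X S y = component X S x"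
  unfolding component_def mem_Collect_eq using connected_component_of_equiv by metis

lemma component_eq_if_meet: "\<lbrakk>z \<in> component X S x; z \<in> component X S y\<rbrakk> \<Longrightarrow> component X S x = component X S y"
  using component_eq by metis

lemma component_eqI: "\<lbrakk>connectedin X T; T \<subseteq> S; x \<in> T; y \<in> T\<rbrakk> \<Longrightarrow> component X S x = component X S y"
  using component_maximal[of X T S x] component_eq[of y X S x] by (metis subsetD)

lemma component_mono: "S \<subseteq> T \<Longrightarrow> component X S x \<subseteq> component X T x"
  unfolding component_def using connected_component_of_mono by fastforce

lemma component_monoD: "\<lbrakk>y \<in> component X S x; S \<subseteq> T\<rbrakk> \<Longrightarrow> y \<in> component X T x"
  using component_mono[of S T X x] by blast

lemma component_memD: "y \<in> component X S x \<Longrightarrow> y \<in> S" and component_topspaceD: "y \<in> component X S x \<Longrightarrow> y \<in> topspace X"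
  using component_subset[of X S x] component_subset_topspace[of X S x] by blast+

lemma component_open: "\<lbrakk>locally_connected_space X; openin X S\<rbrakk> \<Longrightarrow> openin X (component X S x)"
  unfolding component_def
  by (metis connected_component_of_eq_empty locally_connected_B openin_empty openin_subset
      topspace_subtopology_subset)

lemma component_of_connected: "\<lbrakk>connectedin X S; x \<in> S\<rbrakk> \<Longrightarrow> component X S x = S"
  using component_maximal[of X S S x] component_subset[of X S x] by blast

lemma connected_components_of_eq_component:
  "connected_components_of (subtopology X S) = component X S ` (topspace X \<inter> S)"
  by (auto simp: connected_components_of_def component_def)

definition preimg :: "'a topology \<Rightarrow> ('a \<Rightarrow> 'b) \<Rightarrow> 'b set \<Rightarrow> 'a set" where
  "preimg X g B = {x \<in> topspace X. g x \<in> B}"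

lemma mem_preimg [simp]: "x \<in> preimg X g B \<longleftrightarrow> x \<in> topspace X \<and> g x \<in> B"
  by (simp add: preimg_def)

lemma preimg_mono: "B \<subseteq> B' \<Longrightarrow> preimg X g B \<subseteq> preimg X g B'"
  by (auto simp: preimg_def)

lemma iter_preimage_eq_preimg: "iter_preimage X f n B = preimg X (f ^^ n) B"
  by (simp add: iter_preimage_def preimg_def)

text \<open>A form of connectedness suited to components: closedness is only asked for relative to \<open>B\<close>.\<close>

lemma connected_subset_clopen:
  assumes "connectedin X B" "S \<subseteq> B" "S \<noteq> {}" "openin X S" "B \<inter> X closure_of S \<subseteq> S"
  shows "S = B"
proof (rule ccontr)
  assume "S \<noteq> B"
  let ?T = "topspace X - X closure_of S"
  have "openin X ?T" by (simp add: openin_diff)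
  moreover have "B \<subseteq> topspace X" using assms(1) connectedin_subset_topspace by blast
  moreover have "S \<inter> ?T = {}" using closure_of_subset[OF openin_subset[OF assms(4)]] by blast
  moreover have "B \<subseteq> S \<union> ?T" "S \<inter> ?T \<inter> B = {}" "S \<inter> B \<noteq> {}" "?T \<inter> B \<noteq> {}"
    using calculation assms(2,3,5) \<open>S \<noteq> B\<close> by blast+
  ultimately show False
    using assms(1,4) unfolding connectedin by blast
qed

text \<open>Iterates of branched coverings enter mostly through these properties.\<close>

locale finite_open_map =
  fixes X :: "'a topology" and g :: "'a \<Rightarrow> 'a"
  assumes compact_X: "compact_space X" and hausdorff: "Hausdorff_space X" and locally_connected_X: "locally_connected_space X"
    and cont: "continuous_map X X g" and is_open_map: "open_map X X g"
    and finite_fibre: "\<And>y. finite (preimg X g {y})"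
begin

lemma is_closed_map: "closed_map X X g"
  using continuous_imp_closed_map[OF cont compact_X hausdorff] .

lemma image_closed: "closedin X S \<Longrightarrow> closedin X (g ` S)"
  using is_closed_map by (simp add: closed_map_def)

lemma image_open: "openin X S \<Longrightarrow> openin X (g ` S)"
  using is_open_map by (simp add: open_map_def)

lemma g_in: "x \<in> topspace X \<Longrightarrow> g x \<in> topspace X"
  using cont by (meson continuous_map_image_subset_topspace image_subset_iff)

lemma preimg_open: "openin X U \<Longrightarrow> openin X (preimg X g U)"
  unfolding preimg_def using cont openin_continuous_map_preimage by blast

lemma preimg_closed: "closedin X U \<Longrightarrow> closedin X (preimg X g U)"
  unfolding preimg_def using cont closedin_continuous_map_preimage by blast

text \<open>Components of preimages map onto components: the image is open because \<open>g\<close> is an open map, and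
relatively closed because \<open>g\<close> is a closed map and components of \<open>preimg X g U\<close> are relatively closed.\<close>

lemma image_component:
  assumes U: "openin X U" and x: "x \<in> preimg X g U"
  shows "g ` component X (preimg X g U) x = component X U (g x)"
proof (rule connected_subset_clopen)
  let ?W = "component X (preimg X g U) x"
  have oW: "openin X ?W" by (rule component_open[OF locally_connected_X preimg_open[OF U]])
  have xW: "x \<in> ?W" using x by (intro component_refl) auto
  show "connectedin X (component X U (g x))" by (rule component_connected)
  show "g ` ?W \<subseteq> component X U (g x)"
  proof (rule component_maximal)
    show "connectedin X (g ` ?W)"
      using connectedin_continuous_map_image[OF cont component_connected] .
    show "g ` ?W \<subseteq> U" using component_subset[of X "preimg X g U" x] by auto
  qed (use xW in blast)
  show "g ` ?W \<noteq> {}" using xW by blast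
  show "openin X (g ` ?W)" using is_open_map oW unfolding open_map_def by blast
  show "component X U (g x) \<inter> X closure_of (g ` ?W) \<subseteq> g ` ?W"
  proof
    fix b assume b: "b \<in> component X U (g x) \<inter> X closure_of (g ` ?W)"
    have "X closure_of (g ` ?W) \<subseteq> g ` (X closure_of ?W)"
      using is_closed_map component_subset_topspace[of X "preimg X g U" x] by (simp add: closed_map_closure_of_image)
    then obtain w where w: "w \<in> X closure_of ?W" "b = g w" using b by blast
    have wX: "w \<in> topspace X" using w(1) in_closure_of by metis
    have wU: "w \<in> preimg X g U" using wX w(2) b component_subset[of X U] by auto
    have "openin X (component X (preimg X g U) w)" "w \<in> component X (preimg X g U) w"
      using component_open[OF locally_connected_X preimg_open[OF U]] component_refl[OF wU wX] by auto
    then obtain z where "z \<in> component X (preimg X g U) w" "z \<in> ?W"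
      using w(1) unfolding in_closure_of by blast
    then have "w \<in> ?W" using component_eq_if_meet \<open>w \<in> component X (preimg X g U) w\<close> by metis
    then show "b \<in> g ` ?W" using w(2) by blast
  qed
qed

text \<open>Each component maps onto \<open>B\<close>, hence contains a point of the finite fibre over any given point.\<close>

lemma finite_component_preimg:
  assumes B: "openin X B" "connectedin X B"
  shows "finite (component X (preimg X g B) ` preimg X g B)"
proof (cases "B = {}")
  case False
  then obtain b where b: "b \<in> B" by blast
  have "component X (preimg X g B) ` preimg X g B \<subseteq> component X (preimg X g B) ` preimg X g {b}"
  proof
    fix W assume "W \<in> component X (preimg X g B) ` preimg X g B"
    then obtain x where x: "x \<in> preimg X g B" "W = component X (preimg X g B) x" by blast
    have "g ` W = B" using image_component[OF B(1) x(1)] component_of_connected[OF B(2)] x by auto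
    then obtain v where v: "v \<in> W" "g v = b" using b by blast
    then have "W = component X (preimg X g B) v" using component_eq x(2) by metis
    moreover have "v \<in> preimg X g {b}" using v x(2) component_subset_topspace by fastforce
    ultimately show "W \<in> component X (preimg X g B) ` preimg X g {b}" by blast
  qed
  then show ?thesis using finite_fibre finite_surj by blast
qed (auto simp: preimg_def)

text \<open>This is where openness of \<open>g\<close> matters: preimages of closures are closures of preimages.\<close>

lemma preimg_closure:
  assumes "x \<in> topspace X" "g x \<in> X closure_of B"
  shows "x \<in> X closure_of (preimg X g B)"
  unfolding in_closure_of
proof (intro conjI allI impI)
  fix T assume T: "x \<in> T \<and> openin X T"
  then have "openin X (g ` T)" "g x \<in> g ` T" using is_open_map unfolding open_map_def by auto
  then obtain y where "y \<in> B" "y \<in> g ` T" using assms(2) unfolding in_closure_of by blast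
  then show "\<exists>y. y \<in> preimg X g B \<and> y \<in> T" using T openin_subset by fastforce
qed (fact assms(1))

lemma in_closure_component_preimg:
  assumes B: "openin X B" "connectedin X B" and x: "x \<in> topspace X" "g x \<in> X closure_of B"
  obtains u where "u \<in> preimg X g B" "x \<in> X closure_of (component X (preimg X g B) u)"
proof -
  let ?\<W> = "component X (preimg X g B) ` preimg X g B"
  have "preimg X g B \<subseteq> \<Union>?\<W>" using component_refl[of _ "preimg X g B" X] by auto
  then have "x \<in> X closure_of (\<Union>?\<W>)"
    using preimg_closure[OF x] closure_of_mono by blast
  also have "X closure_of (\<Union>?\<W>) = (\<Union>W\<in>?\<W>. X closure_of W)"
    using closure_of_Union[OF finite_component_preimg[OF B]] by simp
  finally show thesis using that by blast
qed

end

section \<open>Preimages of discs\<close>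

text \<open>An open set \<open>D\<close> that is homeomorphic to the whole plane. Discs are always taken in this form,
so that any of their points can serve as the centre.\<close>

locale plane_chart =
  fixes X :: "'a topology" and D :: "'a set" and P :: "'a \<Rightarrow> complex" and k :: "complex \<Rightarrow> 'a"
  assumes D_open: "openin X D"
    and maps: "homeomorphic_maps (subtopology X D) euclidean P k"
begin

lemma D_subset: "D \<subseteq> topspace X" by (rule openin_subset[OF D_open])

lemma P_continuous: "continuous_map (subtopology X D) euclidean P"
  using maps by (simp add: homeomorphic_maps_def)

lemma k_continuous: "continuous_map euclidean X k"
  using maps continuous_map_into_fulltopology by (auto simp: homeomorphic_maps_def)

lemma k_P: "x \<in> D \<Longrightarrow> k (P x) = x"
  using maps subsetD[OF D_subset] by (simp add: homeomorphic_maps_def)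

lemma P_k: "P (k z) = z"
  using maps by (simp add: homeomorphic_maps_def)

lemma k_in: "k z \<in> D"
proof -
  have "continuous_map euclidean (subtopology X D) k" using maps by (simp add: homeomorphic_maps_def)
  then have "k ` topspace euclidean \<subseteq> topspace (subtopology X D)"
    by (rule continuous_map_image_subset_topspace)
  then show ?thesis by auto
qed

lemma k_image: "k ` B = {x \<in> D. P x \<in> B}"
proof
  show "k ` B \<subseteq> {x \<in> D. P x \<in> B}" using k_in by (auto simp: P_k)
  show "{x \<in> D. P x \<in> B} \<subseteq> k ` B" by (auto intro!: image_eqI[of _ k "P _"] simp: k_P)
qed

lemma P_image: "W \<subseteq> D \<Longrightarrow> P ` W = {z. k z \<in> W}"
proof
  assume W: "W \<subseteq> D"
  show "P ` W \<subseteq> {z. k z \<in> W}" using W by (auto simp: k_P subsetD)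
  show "{z. k z \<in> W} \<subseteq> P ` W" by (auto intro!: image_eqI[of _ P "k _"] simp: P_k)
qed

lemma k_P_image: "W \<subseteq> D \<Longrightarrow> k ` P ` W = W"
proof -
  assume W: "W \<subseteq> D"
  have "k ` P ` W = (\<lambda>x. x) ` W" unfolding image_image
    by (rule image_cong[OF refl]) (use W k_P in blast)
  then show ?thesis by simp
qed

lemma inj_on_P: "inj_on P D"
  by (rule inj_on_inverseI[of _ k]) (rule k_P)

lemma k_open: "open B \<Longrightarrow> openin X (k ` B)"
proof -
  assume "open B"
  then have "openin (subtopology X D) {x \<in> topspace (subtopology X D). P x \<in> B}"
    using P_continuous by (intro openin_continuous_map_preimage[where Y=euclidean]) auto
  moreover have "{x \<in> topspace (subtopology X D). P x \<in> B} = k ` B"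
    using D_subset by (auto simp: k_image)
  ultimately show ?thesis using D_open by (simp add: openin_open_subtopology)
qed

lemma k_connected: "connected B \<Longrightarrow> connectedin X (k ` B)"
  using connectedin_continuous_map_image[OF k_continuous] by simp

lemma k_compact: "compact B \<Longrightarrow> compactin X (k ` B)"
  using image_compactin[OF _ k_continuous] by simp

lemma P_open: "\<lbrakk>openin X W; W \<subseteq> D\<rbrakk> \<Longrightarrow> open (P ` W)"
  using openin_continuous_map_preimage[OF k_continuous, of W] by (simp add: P_image)

lemma P_connected: "\<lbrakk>connectedin X W; W \<subseteq> D\<rbrakk> \<Longrightarrow> connected (P ` W)"
  using connectedin_continuous_map_image[OF P_continuous, of W] by (simp add: connectedin_subtopology)

lemma P_compact: "\<lbrakk>compactin X W; W \<subseteq> D\<rbrakk> \<Longrightarrow> compact (P ` W)"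
  using image_compactin[OF _ P_continuous, of W] by (simp add: compactin_subtopology)

end

text \<open>For a chain of open sets, points that are joined in the union are joined in one member.\<close>

lemma component_Union_chain:
  assumes locally_connected_X: "locally_connected_space X"
    and opS: "\<And>r. r \<in> I \<Longrightarrow> openin X (S r)"
    and chain: "\<And>r r'. \<lbrakk>r \<in> I; r' \<in> I\<rbrakk> \<Longrightarrow> S r \<subseteq> S r' \<or> S r' \<subseteq> S r"
    and w: "w \<in> component X (\<Union>r\<in>I. S r) v"
  obtains r where "r \<in> I" "w \<in> component X (S r) v"
proof -
  let ?U = "\<Union>r\<in>I. component X (S r) v"
  have "v \<in> component X (\<Union>r\<in>I. S r) v" using component_nonempty[OF w] .
  then have v: "v \<in> topspace X" "v \<in> (\<Union>r\<in>I. S r)"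
    using component_memD component_topspaceD by metis+
  have "?U = component X (\<Union>r\<in>I. S r) v"
  proof (rule connected_subset_clopen)
    show "?U \<subseteq> component X (\<Union>r\<in>I. S r) v" using component_mono[of _ "\<Union>r\<in>I. S r" X v] by blast
    show "?U \<noteq> {}" using v component_refl[of v _ X] by blast
    show "openin X ?U" using component_open[OF locally_connected_X opS] by blast
    show "component X (\<Union>r\<in>I. S r) v \<inter> X closure_of ?U \<subseteq> ?U"
    proof
      fix x assume x: "x \<in> component X (\<Union>r\<in>I. S r) v \<inter> X closure_of ?U"
      then have xS: "x \<in> component X (\<Union>r\<in>I. S r) v" and xcl: "x \<in> X closure_of ?U" by auto
      obtain r1 where r1: "r1 \<in> I" "x \<in> S r1" using component_memD[OF xS] by blast
      have "x \<in> topspace X" using component_topspaceD[OF xS] .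
      have "x \<in> component X (S r1) x" "openin X (component X (S r1) x)"
        using component_refl[OF r1(2) \<open>x \<in> topspace X\<close>] component_open[OF locally_connected_X opS[OF r1(1)]] by auto
      then obtain z where z: "z \<in> ?U" "z \<in> component X (S r1) x" using xcl unfolding in_closure_of by blast
      then obtain r2 where r2: "r2 \<in> I" "z \<in> component X (S r2) v" by blast
      obtain r where r: "r \<in> I" "S r1 \<subseteq> S r" "S r2 \<subseteq> S r" using chain[OF r1(1) r2(1)] r1(1) r2(1) by blast
      have "z \<in> component X (S r) x" "z \<in> component X (S r) v"
        using component_monoD[OF z(2) r(2)] component_monoD[OF r2(2) r(3)] by auto
      then have "component X (S r) x = component X (S r) v" by (rule component_eq_if_meet)
      moreover have "x \<in> component X (S r) x" using r r1 \<open>x \<in> topspace X\<close> by (intro component_refl) auto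
      ultimately show "x \<in> ?U" using r(1) by blast
    qed
  qed (rule component_connected)
  then show thesis using w that by blast
qed

context finite_open_map
begin

text \<open>On \<open>N\<close> the map is a homeomorphism onto its open image, so connected sets lift.\<close>

lemma connectedin_lift:
  assumes N: "openin X N" "inj_on g N" and Q: "connectedin X Q" "Q \<subseteq> g ` N"
  shows "connectedin X (N \<inter> preimg X g Q)"
  unfolding connectedin
proof (intro conjI notI)
  let ?S = "N \<inter> preimg X g Q"
  show "?S \<subseteq> topspace X" by auto
  assume "\<exists>E1 E2. openin X E1 \<and> openin X E2 \<and> ?S \<subseteq> E1 \<union> E2 \<and> E1 \<inter> E2 \<inter> ?S = {} \<and>
            E1 \<inter> ?S \<noteq> {} \<and> E2 \<inter> ?S \<noteq> {}"
  then obtain E1 E2 where E: "openin X E1" "openin X E2" "?S \<subseteq> E1 \<union> E2" "E1 \<inter> E2 \<inter> ?S = {}"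
    "E1 \<inter> ?S \<noteq> {}" "E2 \<inter> ?S \<noteq> {}" by blast
  have NX: "N \<subseteq> topspace X" by (rule openin_subset[OF N(1)])
  have lift: "\<exists>x\<in>?S. g x = q" if "q \<in> Q" for q
    using Q(2) that NX by fastforce
  have "openin X (g ` (E1 \<inter> N))" "openin X (g ` (E2 \<inter> N))"
    by (intro image_open openin_Int E N(1))+
  moreover have "Q \<subseteq> g ` (E1 \<inter> N) \<union> g ` (E2 \<inter> N)"
    using lift E(3) by blast
  moreover have "g ` (E1 \<inter> N) \<inter> g ` (E2 \<inter> N) \<inter> Q = {}"
  proof (rule ccontr)
    assume "g ` (E1 \<inter> N) \<inter> g ` (E2 \<inter> N) \<inter> Q \<noteq> {}"
    then obtain q where q: "q \<in> g ` (E1 \<inter> N)" "q \<in> g ` (E2 \<inter> N)" "q \<in> Q" by blast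
    obtain a where a: "a \<in> E1" "a \<in> N" "q = g a" using q(1) by blast
    obtain b where b: "b \<in> E2" "b \<in> N" "q = g b" using q(2) by blast
    have "a = b" using inj_onD[OF N(2), of a b] a b by simp
    then have "a \<in> E1 \<inter> E2 \<inter> ?S" using a b q(3) NX by auto
    then show False using E(4) by blast
  qed
  moreover have "g ` (E1 \<inter> N) \<inter> Q \<noteq> {}" "g ` (E2 \<inter> N) \<inter> Q \<noteq> {}"
    using E(5,6) by auto
  ultimately show False using Q(1) unfolding connectedin by blast
qed

text \<open>Let the disc grow from its centre. For small radii the preimages of the centre lie in different
components of the preimage, because fibres are finite. Suppose that two of them, \<open>v\<close> and \<open>w\<close>, lie in
the same component for some radius, and let \<open>r0\<close> be the infimum of such radii. They are separated
at \<open>r0\<close>, since components over an increasing union of discs are unions of components. But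
then they are separated slightly beyond \<open>r0\<close> as well: two components over the disc of radius \<open>r0\<close>
cannot touch over its boundary, where \<open>g\<close> is locally a homeomorphism and the disc meets a small disc in
a convex, hence connected, set.\<close>

lemma preimage_of_disc_centre_unique:
  fixes h :: "'a \<Rightarrow> complex"
  assumes D: "openin X D" and h: "homeomorphic_map (subtopology X D) euclidean h" and y: "y \<in> D"
    and linj: "\<And>x. \<lbrakk>x \<in> topspace X; g x \<in> D; g x \<noteq> y\<rbrakk> \<Longrightarrow> \<exists>N. openin X N \<and> x \<in> N \<and> inj_on g N"
    and v: "g v = y" and w: "g w = y" "w \<in> component X (preimg X g D) v"
  shows "w = v"
proof (rule ccontr)
  assume "w \<noteq> v"
  have vX: "v \<in> topspace X" "w \<in> topspace X"
    using component_topspaceD[OF w(2)] component_topspaceD[OF component_nonempty[OF w(2)]] by auto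
  obtain k where k: "homeomorphic_maps (subtopology X D) euclidean h k"
    using h homeomorphic_map_maps by blast
  interpret chart: plane_chart X D h k
    by (rule plane_chart.intro[OF D k])
  note ckX = chart.k_continuous and kh = chart.k_P and kim = chart.k_image
    and kopen = chart.k_open and kconn = chart.k_connected
  have kcl: "closedin X (k ` B)" if "compact B" for B
    using compactin_imp_closedin[OF hausdorff chart.k_compact[OF that]] .
  define P where "P r = preimg X g (k ` ball (h y) r)" for r
  have Popen: "openin X (P r)" for r
    unfolding P_def by (intro preimg_open kopen) auto
  have Pmono: "P r \<subseteq> P s" if "r \<le> s" for r s
    using that by (force simp: P_def)
  \<comment> \<open>The radii at which the two preimages of the centre have merged.\<close>
  define R where "R = {r. r > 0 \<and> w \<in> component X (P r) v}"
  have Rup: "s \<in> R" if "r \<in> R" "r \<le> s" for r s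
    using that component_monoD[OF _ Pmono[OF that(2)]] unfolding R_def by auto
  have R_union: "\<exists>r\<in>I. r \<in> R" if "w \<in> component X (\<Union>r\<in>I. P r) v" "\<And>r. r \<in> I \<Longrightarrow> r > 0" for I
  proof (rule component_Union_chain[OF locally_connected_X Popen _ that(1)])
    show "P r \<subseteq> P s \<or> P s \<subseteq> P r" for r s using Pmono[of r s] Pmono[of s r] by linarith
  qed (use that(2) in \<open>auto simp: R_def\<close>)
  have "\<exists>r. r \<in> R"
  proof -
    have "preimg X g D \<subseteq> (\<Union>r\<in>{0<..}. P r)"
    proof
      fix x assume x: "x \<in> preimg X g D"
      then have "g x \<in> k ` ball (h y) (dist (h y) (h (g x)) + 1)" by (simp add: kim)
      then have "x \<in> P (dist (h y) (h (g x)) + 1)" using x by (simp add: P_def)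
      moreover have "dist (h y) (h (g x)) + 1 > 0" by (smt (verit) zero_le_dist)
      ultimately show "x \<in> (\<Union>r\<in>{0<..}. P r)" by blast
    qed
    then have "w \<in> component X (\<Union>r\<in>{0<..}. P r) v" by (rule component_monoD[OF w(2)])
    then show ?thesis using R_union[of "{0<..}"] by auto
  qed
  \<comment> \<open>If the preimage of a closed disc splits into closed pieces separating \<open>v\<close> from \<open>w\<close>, so does that of a slightly larger disc.\<close>
  have tube: "\<exists>r1>r0. r1 \<notin> R"
    if AB: "closedin X A" "closedin X B" "A \<inter> B = {}" "v \<in> A" "w \<in> B"
      and cov: "preimg X g (k ` cball (h y) r0) \<subseteq> A \<union> B" for A B r0
  proof -
    have normal: "normal_space X"
      by (rule compact_Hausdorff_or_regular_imp_normal_space[OF compact_X]) (simp add: hausdorff)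
    have "disjnt A B" using AB(3) by (simp add: disjnt_def)
    then have "\<exists>U V. openin X U \<and> openin X V \<and> A \<subseteq> U \<and> B \<subseteq> V \<and> disjnt U V"
      using normal[unfolded normal_space_def, rule_format, of A B] AB(1,2) by simp
    then obtain O1 O2 where O: "openin X O1" "openin X O2" "A \<subseteq> O1" "B \<subseteq> O2" "disjnt O1 O2"
      by blast
    define Z where "Z = {z. k z \<in> g ` (topspace X - (O1 \<union> O2))}"
    have "closedin X (g ` (topspace X - (O1 \<union> O2)))"
      by (intro image_closed closedin_diff closedin_topspace openin_Un O(1,2))
    then have "closed Z"
      using closedin_continuous_map_preimage[OF ckX] unfolding Z_def by simp
    have far: "dist (h y) z > r0" if "z \<in> Z" for z
    proof (rule ccontr)
      assume "\<not> dist (h y) z > r0"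
      then have "k z \<in> k ` cball (h y) r0" by simp
      then show False using that cov O(3,4) unfolding Z_def by fastforce
    qed
    obtain r1 where r1: "r1 > r0" "\<And>z. z \<in> Z \<Longrightarrow> r1 \<le> dist (h y) z"
    proof (cases "Z = {}")
      case True
      then show thesis using that[of "r0 + 1"] by simp
    next
      case False
      then obtain z0 where "z0 \<in> Z" "\<And>z. z \<in> Z \<Longrightarrow> dist (h y) z0 \<le> dist (h y) z"
        using distance_attains_inf[OF \<open>closed Z\<close>, of "h y"] by blast
      then show thesis using that[of "dist (h y) z0"] far by blast
    qed
    have "P r1 \<subseteq> O1 \<union> O2"
    proof
      fix x assume "x \<in> P r1"
      then have x: "x \<in> topspace X" "g x \<in> D" "dist (h y) (h (g x)) < r1" by (auto simp: P_def kim)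
      show "x \<in> O1 \<union> O2"
      proof (rule ccontr)
        assume "x \<notin> O1 \<union> O2"
        then have "h (g x) \<in> Z" using x kh[OF x(2)] unfolding Z_def by auto
        then show False using r1(2) x(3) by fastforce
      qed
    qed
    then have sub: "component X (P r1) v \<subseteq> O1 \<union> O2" using component_subset[of X "P r1" v] by blast
    have "w \<notin> component X (P r1) v"
    proof
      assume w1: "w \<in> component X (P r1) v"
      have "v \<in> O1 \<inter> component X (P r1) v" "w \<in> O2 \<inter> component X (P r1) v" "O1 \<inter> O2 \<inter> component X (P r1) v = {}"
        using O AB w1 component_nonempty[OF w1] unfolding disjnt_def by blast+
      then show False using component_connected[of X "P r1" v] sub O(1,2) unfolding connectedin by blast
    qed
    then show ?thesis using r1(1) unfolding R_def by blast
  qed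
  have near_centre: "\<exists>r1>0. r1 \<notin> R"
  proof (rule tube)
    show "closedin X {v}" using vX hausdorff by (simp add: closedin_Hausdorff_sing_eq)
    show "closedin X (preimg X g {y} - {v})"
      using finite_fibre hausdorff by (auto intro!: closedin_Hausdorff_finite)
    show "preimg X g (k ` cball (h y) 0) \<subseteq> {v} \<union> (preimg X g {y} - {v})"
      using kh[OF y] by auto
  qed (use vX w \<open>w \<noteq> v\<close> in auto)
  have extend: "\<exists>r1>r0. r1 \<notin> R" if r0: "r0 > 0" "r0 \<notin> R" for r0
  proof -
    let ?B = "k ` ball (h y) r0"
    have B: "openin X ?B" "connectedin X ?B" by (auto intro: kopen kconn)
    have PB: "P r0 = preimg X g ?B" by (simp add: P_def)
    have vP: "v \<in> P r0" "w \<in> P r0" using vX v w(1) r0(1) y by (auto simp: P_def kim)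
    \<comment> \<open>Distinct components over the disc of radius \<open>r0\<close> have disjoint closures.\<close>
    have same: "component X (P r0) a = component X (P r0) b"
      if x: "x \<in> X closure_of (component X (P r0) a)" "x \<in> X closure_of (component X (P r0) b)" for x a b
    proof -
      have xX: "x \<in> topspace X" using x in_closure_of by fast
      have "X closure_of (component X (P r0) a) \<subseteq> preimg X g (k ` cball (h y) r0)"
      proof (rule closure_of_minimal)
        show "component X (P r0) a \<subseteq> preimg X g (k ` cball (h y) r0)"
          using component_subset[of X "P r0" a] by (force simp: P_def)
        show "closedin X (preimg X g (k ` cball (h y) r0))"
          by (intro preimg_closed kcl) auto
      qed
      then have gx: "g x \<in> D" "dist (h y) (h (g x)) \<le> r0" using x(1) by (auto simp: kim)
      obtain T S where TS: "openin X T" "x \<in> T" "connectedin X S" "S \<subseteq> P r0" "T \<inter> P r0 \<subseteq> S"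
      proof (cases "dist (h y) (h (g x)) < r0")
        case True
        then have "x \<in> P r0" using xX gx(1) by (simp add: P_def kim)
        then show thesis
          using that[of "component X (P r0) x" "P r0 \<inter> component X (P r0) x"] component_refl[OF _ xX, of "P r0"]
            component_open[OF locally_connected_X Popen, of r0 x] component_connected[of X "P r0" x] component_subset[of X "P r0" x]
          by (simp add: Int_absorb1 Int_commute)
      next
        case False
        then have "g x \<noteq> y" using r0(1) gx(2) by auto
        then obtain N where N: "openin X N" "x \<in> N" "inj_on g N" using linj[OF xX gx(1)] by blast
        let ?G = "g ` (N \<inter> preimg X g D)"
        have "openin X ?G" by (intro image_open openin_Int N(1) preimg_open D)
        then have "open {z. k z \<in> ?G}"
          using openin_continuous_map_preimage[OF ckX] by simp
        moreover have "h (g x) \<in> {z. k z \<in> ?G}" using N(2) xX gx(1) kh by auto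
        ultimately obtain \<rho> where \<rho>: "\<rho> > 0" "ball (h (g x)) \<rho> \<subseteq> {z. k z \<in> ?G}"
          using open_contains_ball_eq by blast
        let ?Q = "k ` (ball (h (g x)) \<rho> \<inter> ball (h y) r0)"
        have "connectedin X (N \<inter> preimg X g ?Q)"
        proof (rule connectedin_lift[OF N(1,3)])
          show "connectedin X ?Q" by (intro kconn convex_connected convex_Int) auto
          show "?Q \<subseteq> g ` N" using \<rho>(2) by blast
        qed
        moreover have "openin X (N \<inter> preimg X g (k ` ball (h (g x)) \<rho>))"
          by (intro openin_Int N(1) preimg_open kopen) auto
        moreover have "x \<in> N \<inter> preimg X g (k ` ball (h (g x)) \<rho>)"
          using N(2) xX gx(1) \<rho>(1) by (simp add: kim)
        moreover have "N \<inter> preimg X g ?Q \<subseteq> P r0" by (auto simp: P_def)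
        moreover have "N \<inter> preimg X g (k ` ball (h (g x)) \<rho>) \<inter> P r0 \<subseteq> N \<inter> preimg X g ?Q"
          by (auto simp: P_def kim)
        ultimately show thesis using that by blast
      qed
      obtain a' b' where a': "a' \<in> component X (P r0) a" "a' \<in> T" and b': "b' \<in> component X (P r0) b" "b' \<in> T"
        using x TS(1,2) unfolding in_closure_of by blast
      have "a' \<in> S" "b' \<in> S" using a' b' TS(5) component_memD[OF a'(1)] component_memD[OF b'(1)] by auto
      then have "component X (P r0) a' = component X (P r0) b'" using component_eqI[OF TS(3,4)] by blast
      then show ?thesis using component_eq[OF a'(1)] component_eq[OF b'(1)] by simp
    qed
    let ?A = "X closure_of (component X (P r0) v)"
    let ?Ws = "component X (P r0) ` P r0 - {component X (P r0) v}"
    let ?B = "\<Union>W\<in>?Ws. X closure_of W"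
    have fin: "finite ?Ws" using finite_component_preimg[OF B] PB by simp
    have cov: "preimg X g (k ` cball (h y) r0) \<subseteq> ?A \<union> ?B"
    proof
      fix x assume x: "x \<in> preimg X g (k ` cball (h y) r0)"
      have "cball (h y) r0 = closure (ball (h y) r0)" using r0(1) by simp
      then have "k ` cball (h y) r0 \<subseteq> X closure_of (k ` ball (h y) r0)"
        using continuous_map_image_closure_subset[OF ckX] by (metis euclidean_closure_of)
      then have "g x \<in> X closure_of (k ` ball (h y) r0)" using x by auto
      then obtain u where u: "u \<in> P r0" "x \<in> X closure_of (component X (P r0) u)"
        using in_closure_component_preimg[OF B, of x] x PB by auto
      then show "x \<in> ?A \<union> ?B" by (cases "component X (P r0) u = component X (P r0) v") auto
    qed
    show ?thesis
    proof (rule tube[OF _ _ _ _ _ cov])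
      show "closedin X ?B" using fin by (intro closedin_Union) auto
      show "?A \<inter> ?B = {}" using same by blast
      show "v \<in> ?A"
        using component_refl[OF vP(1) vX(1)] closure_of_subset[OF component_subset_topspace[of X "P r0" v]] by blast
      have "w \<notin> component X (P r0) v" using r0 by (simp add: R_def)
      then have "component X (P r0) w \<noteq> component X (P r0) v" using component_refl[OF vP(2) vX(2)] by auto
      moreover have "w \<in> X closure_of (component X (P r0) w)"
        using component_refl[OF vP(2) vX(2)] closure_of_subset[OF component_subset_topspace[of X "P r0" w]] by blast
      ultimately show "w \<in> ?B" using vP(2) by blast
    qed simp
  qed
  define r0 where "r0 = Inf R"
  have bdd: "bdd_below R" by (rule bdd_belowI[of _ 0]) (auto simp: R_def)
  obtain r1 where r1: "r1 > 0" "r1 \<notin> R" using near_centre by blast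
  have "r1 \<le> r0" unfolding r0_def
    by (rule cInf_greatest) (use \<open>\<exists>r. r \<in> R\<close> Rup r1(2) in \<open>auto, meson linear\<close>)
  then have "r0 > 0" using r1(1) by linarith
  have "r0 \<notin> R"
  proof
    assume "r0 \<in> R"
    have "P r0 \<subseteq> (\<Union>r\<in>{0<..<r0}. P r)"
    proof
      fix x assume x: "x \<in> P r0"
      then have "dist (h y) (h (g x)) < r0" by (auto simp: P_def kim)
      then obtain r where r: "dist (h y) (h (g x)) < r" "r < r0" using dense by blast
      then have "x \<in> P r" using x by (auto simp: P_def kim)
      moreover have "r > 0" using r(1) zero_le_dist[of "h y" "h (g x)"] by linarith
      ultimately show "x \<in> (\<Union>r\<in>{0<..<r0}. P r)" using r by auto
    qed
    moreover have "w \<in> component X (P r0) v" using \<open>r0 \<in> R\<close> by (simp add: R_def)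
    ultimately have "w \<in> component X (\<Union>r\<in>{0<..<r0}. P r) v" by (rule component_monoD[rotated])
    then obtain r where "r \<in> {0<..<r0}" "r \<in> R" using R_union[of "{0<..<r0}"] by auto
    then show False using cInf_lower[OF _ bdd] unfolding r0_def by fastforce
  qed
  then obtain r2 where r2: "r2 > r0" "r2 \<notin> R" using extend[OF \<open>r0 > 0\<close>] by blast
  then obtain r where "r \<in> R" "r < r2"
    using cInf_lessD[of R r2] \<open>\<exists>r. r \<in> R\<close> unfolding r0_def by blast
  then show False using Rup r2(2) by (meson less_imp_le)
qed

end

section \<open>Jordan curves in the plane and in the sphere\<close>

lemma homeomorphic_maps_top_of_set:
  fixes S :: "'a::topological_space set" and T :: "'b::topological_space set"
  shows "homeomorphic_maps (top_of_set S) (top_of_set T) f g \<longleftrightarrow> homeomorphism S T f g"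
  unfolding homeomorphic_maps_def homeomorphism_def
  by (force simp: Pi_iff image_subset_iff image_iff)

lemma homeomorphic_space_top_of_set:
  fixes S :: "'a::topological_space set" and T :: "'b::topological_space set"
  shows "top_of_set S homeomorphic_space top_of_set T \<longleftrightarrow> S homeomorphic T"
  by (simp add: homeomorphic_space_def homeomorphic_def homeomorphic_maps_top_of_set)

text \<open>Near a point of a simple loop, the two sides of the loop are locally connected. Cut out of the loop
a short arc around \<open>y\<close> that stays in \<open>E\<close>, and let \<open>K\<close> be the remaining arc. Two points of a small
disc around \<open>y\<close> are joined off \<open>- E \<union> K\<close>, inside the disc. If they are also joined off the loop,
Janiszewski's theorem joins them off both, since the loop meets \<open>- E \<union> K\<close> in the connected
set \<open>K\<close>.\<close>

lemma simple_loop_local_separation: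
  fixes c :: "real \<Rightarrow> complex"
  assumes c: "simple_path c" "pathfinish c = pathstart c" and y: "y \<in> path_image c"
    and E: "open E" "y \<in> E"
  obtains E' where "open E'" "y \<in> E'" "E' \<subseteq> E"
    "\<And>a b. \<lbrakk>a \<in> E'; b \<in> E'; connected_component (- path_image c) a b\<rbrakk>
        \<Longrightarrow> connected_component (E - path_image c) a b"
proof -
  obtain t where t: "t \<in> {0..1}" "y = c t" using y by (auto simp: path_image_def)
  \<comment> \<open>Reparametrise so that the loop starts and ends at \<open>y\<close>.\<close>
  define \<gamma> where "\<gamma> = shiftpath t c"
  have \<gamma>: "simple_path \<gamma>" "pathfinish \<gamma> = pathstart \<gamma>" "path_image \<gamma> = path_image c" "pathstart \<gamma> = y"
    using c t by (simp_all add: \<gamma>_def simple_path_shiftpath closed_shiftpath path_image_shiftpath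
        pathstart_shiftpath)
  have g01: "\<gamma> 0 = y" "\<gamma> 1 = y" using \<gamma>(2,4) by (simp_all add: pathstart_def pathfinish_def)
  have cont: "continuous_on {0..1} \<gamma>" using \<gamma>(1) simple_path_imp_path path_def by blast
  obtain e where e: "e > 0" "ball y e \<subseteq> E" using E open_contains_ball by blast
  obtain d0 where d0: "d0 > 0" "\<And>s. \<lbrakk>s \<in> {0..1}; dist s 0 < d0\<rbrakk> \<Longrightarrow> dist (\<gamma> s) (\<gamma> 0) < e"
    using cont e(1) unfolding continuous_on_iff by (metis atLeastAtMost_iff order_refl zero_le_one)
  obtain d1 where d1: "d1 > 0" "\<And>s. \<lbrakk>s \<in> {0..1}; dist s 1 < d1\<rbrakk> \<Longrightarrow> dist (\<gamma> s) (\<gamma> 1) < e"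
    using cont e(1) unfolding continuous_on_iff by (metis atLeastAtMost_iff order_refl zero_le_one)
  define \<delta> where "\<delta> = min (min (d0 / 2) (d1 / 2)) (1 / 4)"
  have \<delta>: "\<delta> > 0" "\<delta> < d0" "\<delta> < d1" "\<delta> \<le> 1 / 4" using d0(1) d1(1) by (auto simp: \<delta>_def)
  define K where "K = \<gamma> ` {\<delta>..1 - \<delta>}"
  have cK: "continuous_on {\<delta>..1 - \<delta>} \<gamma>" using cont continuous_on_subset \<delta>(1) by fastforce
  have K: "compact K" "connected K" unfolding K_def
    using compact_continuous_image[OF cK] connected_continuous_image[OF cK] by auto
  have yK: "y \<notin> K"
  proof
    assume "y \<in> K"
    then obtain s where s: "s \<in> {\<delta>..1 - \<delta>}" "\<gamma> s = \<gamma> 0" using g01 by (auto simp: K_def)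
    moreover have "s \<in> {0..1}" "(0::real) \<in> {0..1}" using s(1) \<delta> by auto
    ultimately have "s = 0 \<or> s = 1"
      using \<gamma>(1) unfolding simple_path_def loop_free_def by blast
    then show False using s \<delta> by auto
  qed
  have near: "path_image c - K \<subseteq> E"
  proof
    fix z assume z: "z \<in> path_image c - K"
    then have "z \<in> \<gamma> ` {0..1}" using \<gamma>(3) by (simp add: path_image_def)
    then obtain s where s: "s \<in> {0..1}" "z = \<gamma> s" by blast
    have "s \<notin> {\<delta>..1 - \<delta>}" using z s(2) by (auto simp: K_def)
    then have "\<bar>s\<bar> < d0 \<or> \<bar>s - 1\<bar> < d1" using \<delta> s(1) by auto
    then have "dist y z < e"
    proof
      assume "\<bar>s\<bar> < d0"
      then show ?thesis using d0(2)[OF s(1)] g01 s(2) by (simp add: dist_real_def dist_commute)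
    next
      assume "\<bar>s - 1\<bar> < d1"
      then show ?thesis using d1(2)[OF s(1)] g01 s(2) by (simp add: dist_real_def dist_commute)
    qed
    then show "z \<in> E" using e(2) by auto
  qed
  have "open (E - K)" "y \<in> E - K" using E K(1) yK by (auto intro: open_Diff compact_imp_closed)
  then obtain r where r: "r > 0" "ball y r \<subseteq> E - K" using open_contains_ball by blast
  show thesis
  proof
    show "open (ball y r)" "y \<in> ball y r" "ball y r \<subseteq> E" using r by auto
    fix a b assume ab: "a \<in> ball y r" "b \<in> ball y r" "connected_component (- path_image c) a b"
    have "connected_component (- (path_image c \<union> (- E \<union> K))) a b"
    proof (rule Janiszewski)
      show "compact (path_image c)" using c(1) by (simp add: compact_simple_path_image)
      show "closed (- E \<union> K)" using E K(1) by (auto intro: compact_imp_closed)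
      have "K \<subseteq> path_image c" using \<gamma>(3) \<delta> by (force simp: K_def path_image_def)
      then have "path_image c \<inter> (- E \<union> K) = K" using near by blast
      then show "connected (path_image c \<inter> (- E \<union> K))" using K(2) by simp
      have "ball y r \<subseteq> - (- E \<union> K)" using r(2) by blast
      then show "connected_component (- (- E \<union> K)) a b"
        using ab(1,2) connected_ball unfolding connected_component_def by blast
    qed (rule ab(3))
    moreover have "- (path_image c \<union> (- E \<union> K)) \<subseteq> E - path_image c" by blast
    ultimately show "connected_component (E - path_image c) a b"
      using connected_component_of_subset by blast
  qed
qed

lemma simply_connected_inside_simple_loop:
  fixes c :: "real \<Rightarrow> complex"
  assumes "simple_path c" "pathfinish c = pathstart c"
  shows "simply_connected (inside (path_image c))"
  using Jordan_inside_outside[OF assms] assms(1)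
  by (simp add: simply_connected_eq_frontier_properties connected_simple_path_image)

locale topological_sphere =
  fixes X :: "'a topology"
  assumes sph: "X homeomorphic_space top_of_set (sphere (0 :: real ^ 3) 1)"
begin

lemma locally_connected_X: "locally_connected_space X"
proof -
  have "locally connected (sphere (0 :: real ^ 3) 1)" by (simp add: locally_connected_sphere)
  then have "locally_connected_space (top_of_set (sphere (0 :: real ^ 3) 1))"
    unfolding locally_connected_space locally_connected
    by (simp add: connectedin_subtopology) (meson openin_imp_subset)
  then show ?thesis using sph homeomorphic_locally_connected_space by blast
qed

lemma compact_X: "compact_space X"
proof -
  have "compact_space (top_of_set (sphere (0 :: real ^ 3) 1))" by (simp add: compact_space_subtopology)
  then show ?thesis using sph homeomorphic_compact_space by blast
qed

lemma hausdorff: "Hausdorff_space X"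
  using sph homeomorphic_Hausdorff_space[of X] Hausdorff_space_subtopology Hausdorff_space_euclidean by blast

text \<open>Stereographic projection.\<close>

lemma puncture:
  assumes "p \<in> topspace X"
  obtains P k where "homeomorphic_maps (subtopology X (topspace X - {p})) (euclidean :: complex topology) P k"
proof -
  obtain F where F: "homeomorphic_map X (top_of_set (sphere (0 :: real ^ 3) 1)) F"
    using sph homeomorphic_space by blast
  have im: "F ` topspace X = sphere 0 1" and inj: "inj_on F (topspace X)"
    using F by (auto simp: homeomorphic_eq_everything_map)
  have Fp: "F p \<in> sphere 0 1" using im assms by blast
  have "F ` (topspace X - {p}) = sphere 0 1 - {F p}"
    using im inj assms by (auto simp: inj_on_def)
  then have "homeomorphic_map (subtopology X (topspace X - {p}))
      (subtopology (top_of_set (sphere (0 :: real ^ 3) 1)) (sphere 0 1 - {F p})) F"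
    by (intro homeomorphic_map_subtopologies[OF F]) (auto simp: Int_absorb1 Diff_subset)
  moreover have "subtopology (top_of_set (sphere (0 :: real ^ 3) 1)) (sphere 0 1 - {F p})
      = top_of_set (sphere 0 1 - {F p})"
    by (simp add: subtopology_subtopology Int_absorb1)
  ultimately have 1: "subtopology X (topspace X - {p}) homeomorphic_space top_of_set (sphere 0 1 - {F p})"
    using homeomorphic_map_imp_homeomorphic_space by metis
  have "(sphere 0 1 - {F p}) homeomorphic (UNIV :: complex set)"
    by (rule homeomorphic_punctured_sphere_affine) (use Fp in auto)
  then have "top_of_set (sphere 0 1 - {F p}) homeomorphic_space (euclidean :: complex topology)"
    using homeomorphic_space_top_of_set[of "sphere 0 1 - {F p}" "UNIV :: complex set"] by simp
  then have "subtopology X (topspace X - {p}) homeomorphic_space (euclidean :: complex topology)"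
    using 1 homeomorphic_space_trans by blast
  then show thesis using that unfolding homeomorphic_space_def by blast
qed

end

locale sphere_jordan = topological_sphere +
  fixes C :: "'a set"
  assumes jc: "jordan_curve X C"
begin

abbreviation side :: "'a \<Rightarrow> 'a set" where "side \<equiv> component X (topspace X - C)"

lemma CX: "C \<subseteq> topspace X" using jc by (simp add: jordan_curve_def)

lemma C_param: obtains k where "continuous_map (top_of_set (sphere (0::complex) 1)) X k"
    "inj_on k (sphere 0 1)" "k ` sphere 0 1 = C"
proof -
  have "top_of_set (sphere (0::complex) 1) homeomorphic_space subtopology X C"
    using jc homeomorphic_space_sym unfolding jordan_curve_def by blast
  then obtain k where "homeomorphic_map (top_of_set (sphere (0::complex) 1)) (subtopology X C) k"
    using homeomorphic_space by blast
  then show thesis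
    using that CX continuous_map_into_fulltopology homeomorphic_eq_everything_map[of _ _ k]
    by (metis topspace_euclidean_subtopology topspace_subtopology_subset)
qed

lemma C_compact: "compactin X C"
proof -
  obtain k where k: "continuous_map (top_of_set (sphere (0::complex) 1)) X k" "k ` sphere 0 1 = C"
    using C_param by blast
  have "compactin (top_of_set (sphere (0::complex) 1)) (sphere 0 1)"
    by (simp add: compactin_subtopology)
  then show ?thesis using image_compactin[OF _ k(1)] k(2) by blast
qed

lemma C_closed: "closedin X C" using compactin_imp_closedin[OF hausdorff C_compact] .

lemma compl_open: "openin X (topspace X - C)" using C_closed by blast

text \<open>Otherwise the circle would be homeomorphic to the 2-sphere, but it is not simply connected.\<close>

lemma compl_nonempty: "topspace X - C \<noteq> {}"
proof
  assume "topspace X - C = {}"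
  then have "subtopology X C = X" using CX by (metis Diff_eq_empty_iff subset_antisym subtopology_topspace)
  then have "X homeomorphic_space top_of_set (sphere (0::complex) 1)"
    using jc by (simp add: jordan_curve_def)
  then have "top_of_set (sphere (0 :: real ^ 3) 1) homeomorphic_space top_of_set (sphere (0::complex) 1)"
    using sph homeomorphic_space_trans homeomorphic_space_sym by blast
  then have "sphere (0 :: real ^ 3) 1 homeomorphic sphere (0::complex) 1"
    by (simp add: homeomorphic_space_top_of_set)
  then show False
    using homeomorphic_simply_connected_eq simply_connected_sphere_eq[of "0 :: real ^ 3" 1]
      simply_connected_sphere_eq[of "0 :: complex" 1] by auto
qed

end

context sphere_jordan
begin

text \<open>Projecting from a point off the curve turns it into a simple loop in the plane.\<close>

lemma planar_model:
  assumes p: "p \<in> topspace X - C"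
  obtains P k c where "plane_chart X (topspace X - {p}) P k"
    "simple_path c" "pathfinish c = pathstart c" "P ` C = path_image c"
proof -
  let ?D = "topspace X - {p}"
  obtain P k where Pk: "homeomorphic_maps (subtopology X ?D) (euclidean :: complex topology) P k"
    using puncture p by blast
  interpret plane_chart X ?D P k
  proof
    show "openin X ?D"
      using hausdorff p by (simp add: closedin_Hausdorff_sing_eq openin_diff)
  qed (rule Pk)
  obtain \<kappa> where \<kappa>: "continuous_map (top_of_set (sphere (0::complex) 1)) X \<kappa>"
    "inj_on \<kappa> (sphere 0 1)" "\<kappa> ` sphere 0 1 = C" using C_param by blast
  have CD: "C \<subseteq> ?D" using p CX by blast
  have "continuous_map (top_of_set (sphere (0::complex) 1)) (subtopology X ?D) \<kappa>"
    using \<kappa>(1,3) CD by (auto simp: continuous_map_in_subtopology)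
  then have "continuous_map (top_of_set (sphere (0::complex) 1)) euclidean (P \<circ> \<kappa>)"
    using P_continuous by (rule continuous_map_compose)
  then have 1: "continuous_on (sphere 0 1) (P \<circ> \<kappa>)" by simp
  have "inj_on P C" using inj_on_P CD inj_on_subset by blast
  then have 2: "inj_on (P \<circ> \<kappa>) (sphere 0 1)" using \<kappa>(2,3) by (simp add: comp_inj_on)
  define c where "c = (P \<circ> \<kappa>) \<circ> circlepath 0 1"
  have "simple_path c" unfolding c_def
    by (rule simple_path_continuous_image) (use 1 2 in \<open>auto simp: simple_path_circlepath\<close>)
  moreover have "pathfinish c = pathstart c"
    unfolding c_def by (simp add: pathfinish_compose pathstart_compose)
  moreover have "path_image c = P ` C"
    unfolding c_def path_image_compose by (simp add: image_image flip: \<kappa>(3))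
  ultimately show thesis using that[of P k c] plane_chart_axioms by metis
qed

lemma component_closure: 
  assumes "z \<in> topspace X - C"
  shows "X closure_of (side z) \<subseteq> side z \<union> C"
proof
  let ?U = "topspace X - C"
  fix x assume x: "x \<in> X closure_of (side z)"
  have xX: "x \<in> topspace X" using x in_closure_of by fast
  show "x \<in> side z \<union> C"
  proof (cases "x \<in> C")
    case False
    then have xU: "x \<in> ?U" using xX by blast
    have "openin X (side x)" "x \<in> side x" using component_open[OF locally_connected_X compl_open] component_refl[OF xU xX] by auto
    then obtain y where y: "y \<in> side x" "y \<in> side z" using x unfolding in_closure_of by blast
    then have "side x = side z" by (rule component_eq_if_meet)
    then show ?thesis using \<open>x \<in> side x\<close> by blast
  qed blast
qed

text \<open>The projected component is open and relatively closed in the complement of the loop, hence a union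
of the inside and the outside; it is bounded because it stays away from the point at infinity.\<close>

lemma far_component:
  assumes chart: "plane_chart X (topspace X - {p}) P k" and p: "p \<in> topspace X - C"
    and c: "simple_path c" "pathfinish c = pathstart c" "P ` C = path_image c"
    and z: "z \<in> topspace X - C" "p \<notin> side z"
  shows "P ` side z = inside (path_image c)"
proof -
  interpret plane_chart X "topspace X - {p}" P k by (rule chart)
  let ?U = "topspace X - C" let ?D = "topspace X - {p}"
  define O' where "O' = side z"
  note J = Jordan_inside_outside[OF c(1,2)]
  have zO: "z \<in> O'" unfolding O'_def using z by (intro component_refl) auto
  have oO: "openin X O'" unfolding O'_def by (rule component_open[OF locally_connected_X compl_open])
  have OD: "O' \<subseteq> ?D" using z(2) component_subset_topspace[of X ?U z] unfolding O'_def by blast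
  have OC: "O' \<inter> C = {}" using component_subset[of X ?U z] unfolding O'_def by blast
  have CD: "C \<subseteq> ?D" using CX p by blast
  have cl: "X closure_of O' \<subseteq> O' \<union> C" unfolding O'_def by (rule component_closure[OF z(1)])
  then have clD: "X closure_of O' \<subseteq> ?D" using OD CD by blast
  have "compactin X (X closure_of O')" by (simp add: closedin_compact_space compact_X)
  then have cpt: "compact (P ` (X closure_of O'))" by (rule P_compact[OF _ clD])
  have sub: "P ` O' \<subseteq> P ` (X closure_of O')"
    by (intro image_mono closure_of_subset openin_subset oO)
  have bnd: "bounded (P ` O')" using cpt sub compact_imp_bounded bounded_subset by blast
  have "closure (P ` O') \<subseteq> P ` (X closure_of O')"
    using sub cpt by (simp add: closure_minimal compact_imp_closed)
  then have clP: "closure (P ` O') \<subseteq> P ` O' \<union> path_image c" using cl c(3) by blast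
  have opP: "open (P ` O')" by (rule P_open[OF oO OD])
  have con: "connected (P ` O')"
    by (rule P_connected[OF _ OD]) (simp add: O'_def component_connected)
  have dis: "P ` O' \<inter> path_image c = {}"
  proof -
    have "P ` O' \<inter> P ` C = P ` (O' \<inter> C)" using inj_on_image_Int[OF inj_on_P OD CD] by simp
    then show ?thesis using OC c(3) by simp
  qed
  have all_or_none: "V \<subseteq> P ` O'" if V: "connected V" "V \<inter> path_image c = {}" "V \<inter> P ` O' \<noteq> {}" for V
  proof (rule ccontr)
    assume "\<not> V \<subseteq> P ` O'"
    then have "- closure (P ` O') \<inter> V \<noteq> {}" using clP V(2) by blast
    moreover have "V \<subseteq> P ` O' \<union> - closure (P ` O')" using clP V(2) by blast
    moreover have "P ` O' \<inter> - closure (P ` O') \<inter> V = {}" using closure_subset[of "P ` O'"] by blast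
    moreover have "open (- closure (P ` O'))" by (rule open_Compl[OF closed_closure])
    moreover have "P ` O' \<inter> V \<noteq> {}" using V(3) by blast
    ultimately show False using connectedD[OF V(1) opP, of "- closure (P ` O')"] by simp
  qed
  have "outside (path_image c) \<inter> P ` O' = {}"
  proof (rule ccontr)
    assume "outside (path_image c) \<inter> P ` O' \<noteq> {}"
    moreover have "connected (outside (path_image c))" using J by simp
    ultimately have "outside (path_image c) \<subseteq> P ` O'"
      by (intro all_or_none outside_no_overlap) (simp_all add: Int_commute)
    then have "bounded (outside (path_image c))" by (rule bounded_subset[OF bnd])
    then show False using J by simp
  qed
  moreover have "P ` O' \<subseteq> inside (path_image c) \<union> outside (path_image c)"
    using dis J by blast
  ultimately have "P ` O' \<subseteq> inside (path_image c)" by blast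
  moreover have "inside (path_image c) \<subseteq> P ` O'"
  proof (rule all_or_none)
    show "connected (inside (path_image c))" using J by simp
    show "inside (path_image c) \<inter> path_image c = {}" by (rule inside_no_overlap)
    show "inside (path_image c) \<inter> P ` O' \<noteq> {}" using calculation zO by blast
  qed
  ultimately show ?thesis unfolding O'_def by blast
qed

text \<open>There are at least two components: if the complement were connected, it could not be split into the
inside of the loop, seen from \<open>z\<close>, and the rest.\<close>

lemma avoid_component:
  assumes z: "z \<in> topspace X - C"
  obtains q where "q \<in> topspace X - C" "q \<notin> side z"
proof (rule ccontr)
  let ?U = "topspace X - C"
  assume "\<not> thesis"
  then have all: "?U \<subseteq> side z" using that by blast
  obtain P k c where chart: "plane_chart X (topspace X - {z}) P k"
    and c: "simple_path c" "pathfinish c = pathstart c" "P ` C = path_image c"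
    using planar_model[OF z] by blast
  interpret plane_chart X "topspace X - {z}" P k by (rule chart)
  note J = Jordan_inside_outside[OF c(1,2)]
  let ?I = "inside (path_image c)"
  have op: "openin X (k ` ?I)" using J by (intro k_open) blast
  have CD: "C \<subseteq> topspace X - {z}" using CX z by blast
  have "closure ?I = ?I \<union> path_image c"
    using J closure_Un_frontier[of ?I] by simp
  moreover have "k ` path_image c = C"
    unfolding c(3)[symmetric] by (rule k_P_image[OF CD])
  ultimately have "k ` closure ?I = k ` ?I \<union> C" by (simp add: image_Un)
  moreover have "compact (closure ?I)" using J by (simp add: compact_closure)
  ultimately have cl: "closedin X (k ` ?I \<union> C)"
    using compactin_imp_closedin[OF hausdorff k_compact, of "closure ?I"] by simp
  have "?U \<subseteq> k ` ?I \<union> (topspace X - (k ` ?I \<union> C))" by blast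
  moreover have "k ` ?I \<inter> (topspace X - (k ` ?I \<union> C)) \<inter> ?U = {}" by blast
  moreover have "k ` ?I \<inter> ?U \<noteq> {}"
  proof -
    obtain a where a: "a \<in> ?I" using J by blast
    have "k a \<notin> C"
    proof
      assume "k a \<in> C"
      then have "P (k a) \<in> path_image c" using c(3) by blast
      then have "a \<in> path_image c" by (simp add: P_k)
      then show False using a inside_no_overlap[of "path_image c"] by blast
    qed
    then show ?thesis using a k_in[of a] by blast
  qed
  moreover have "(topspace X - (k ` ?I \<union> C)) \<inter> ?U \<noteq> {}" using z k_in by blast
  moreover have "openin X (topspace X - (k ` ?I \<union> C))" using cl by blast
  moreover have "connectedin X ?U"
    using all component_subset[of X ?U z] component_connected[of X ?U z] by (metis subset_antisym)
  ultimately show False using op unfolding connectedin by blast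
qed

text \<open>Every component is the inside of a loop when it is viewed from a point of another component.\<close>

lemma planar_component:
  assumes z: "z \<in> topspace X - C"
  obtains p P k c where "plane_chart X (topspace X - {p}) P k"
    "p \<in> topspace X - C" "p \<notin> side z"
    "simple_path c" "pathfinish c = pathstart c" "P ` C = path_image c"
    "P ` side z = inside (path_image c)"
proof -
  obtain p where p: "p \<in> topspace X - C" "p \<notin> side z"
    using avoid_component[OF z] by blast
  obtain P k c where m: "plane_chart X (topspace X - {p}) P k"
    "simple_path c" "pathfinish c = pathstart c" "P ` C = path_image c"
    using planar_model[OF p(1)] by blast
  show thesis by (rule that[OF m(1) p m(2-4) far_component[OF m(1) p(1) m(2-4) z p(2)]])
qed

lemma finite_components: "finite (side ` (topspace X - C))"
proof -
  let ?U = "topspace X - C"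
  obtain p where p: "p \<in> ?U" using compl_nonempty by blast
  obtain P k c where chart: "plane_chart X (topspace X - {p}) P k"
    and c: "simple_path c" "pathfinish c = pathstart c" "P ` C = path_image c"
    using planar_model[OF p] by blast
  interpret plane_chart X "topspace X - {p}" P k by (rule chart)
  have "side ` ?U \<subseteq> {side p, k ` inside (path_image c)}"
  proof
    fix W assume "W \<in> side ` ?U"
    then obtain z where z: "z \<in> ?U" "W = side z" by blast
    show "W \<in> {side p, k ` inside (path_image c)}"
    proof (cases "p \<in> side z")
      case True
      then show ?thesis using component_eq[OF True] z(2) by simp
    next
      case False
      then have "W \<subseteq> topspace X - {p}" using z(2) component_subset_topspace[of X ?U z] by blast
      then have "k ` P ` W = W" by (rule k_P_image)
      then show ?thesis using far_component[OF chart p c z(1) False] z(2) by simp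
    qed
  qed
  then show ?thesis by (rule finite_subset) simp
qed

text \<open>The points of the curve are limits of any component, being frontier points of the inside of a loop.\<close>

lemma in_closure_component:
  assumes "x \<in> topspace X"
  obtains z where "z \<in> topspace X - C" "x \<in> X closure_of (side z)"
proof (cases "x \<in> C")
  case False
  then show thesis
    using that[of x] assms component_refl[of x "topspace X - C" X] closure_of_subset[OF component_subset_topspace[of X "topspace X - C" x]]
    by blast
next
  case True
  let ?U = "topspace X - C"
  obtain z where z: "z \<in> ?U" using compl_nonempty by blast
  obtain p P k c where chart: "plane_chart X (topspace X - {p}) P k"
    and p: "p \<in> ?U" "p \<notin> side z"
    and c: "simple_path c" "pathfinish c = pathstart c" "P ` C = path_image c"
    and O': "P ` side z = inside (path_image c)"
    using planar_component[OF z] by metis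
  interpret plane_chart X "topspace X - {p}" P k by (rule chart)
  have "P x \<in> frontier (inside (path_image c))"
    using Jordan_inside_outside[OF c(1,2)] imageI[OF True, of P] c(3) by simp
  then have "P x \<in> closure (P ` side z)" by (simp add: O' frontier_def)
  then have "k (P x) \<in> X closure_of (k ` P ` side z)"
    using continuous_map_image_closure_subset[OF k_continuous, of "P ` side z"] by auto
  moreover have "k (P x) = x" using True CX p by (intro k_P) blast
  moreover have "k ` P ` side z = side z"
  proof -
    have "side z \<subseteq> topspace X - {p}" using p component_subset_topspace[of X ?U z] by blast
    then show ?thesis by (rule k_P_image)
  qed
  ultimately show thesis using that[OF z] by simp
qed

text \<open>The inside of a simple loop is simply connected, so the Riemann mapping theorem applies.\<close>

lemma component_planar:
  assumes z: "z \<in> topspace X - C"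
  obtains h where "homeomorphic_map (subtopology X (side z)) (euclidean :: complex topology) h"
proof -
  let ?O = "side z"
  obtain p P k c where chart: "plane_chart X (topspace X - {p}) P k"
    and p: "p \<in> topspace X - C" "p \<notin> ?O"
    and c: "simple_path c" "pathfinish c = pathstart c" "P ` C = path_image c"
    and O': "P ` ?O = inside (path_image c)"
    using planar_component[OF z] by metis
  interpret plane_chart X "topspace X - {p}" P k by (rule chart)
  have OD: "?O \<subseteq> topspace X - {p}" using p component_subset_topspace[of X _ z] by blast
  let ?I = "inside (path_image c)"
  have "?I homeomorphic ball (0::complex) 1"
    using simply_connected_eq_homeomorphic_to_disc[of ?I] simply_connected_inside_simple_loop[OF c(1,2)]
      Jordan_inside_outside[OF c(1,2)] by blast
  then have "?I homeomorphic (UNIV :: complex set)"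
    using homeomorphic_ball01_UNIV homeomorphic_trans by blast
  then have 1: "top_of_set ?I homeomorphic_space (euclidean :: complex topology)"
    using homeomorphic_space_top_of_set[of ?I "UNIV :: complex set"] by simp
  have "homeomorphic_map (subtopology (subtopology X (topspace X - {p})) ?O) (subtopology euclidean ?I) P"
  proof (rule homeomorphic_map_subtopologies)
    show "homeomorphic_map (subtopology X (topspace X - {p})) euclidean P"
      using maps homeomorphic_map_maps by blast
    have "topspace (subtopology X (topspace X - {p})) \<inter> ?O = ?O" using OD by auto
    then show "P ` (topspace (subtopology X (topspace X - {p})) \<inter> ?O) = topspace euclidean \<inter> ?I"
      using O' by simp
  qed
  moreover have "subtopology (subtopology X (topspace X - {p})) ?O = subtopology X ?O"
    using OD by (simp add: subtopology_subtopology Int_absorb1)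
  ultimately have "subtopology X ?O homeomorphic_space top_of_set ?I"
    using homeomorphic_map_imp_homeomorphic_space by metis
  then have "subtopology X ?O homeomorphic_space (euclidean :: complex topology)"
    using 1 homeomorphic_space_trans by blast
  then show thesis using that homeomorphic_space by blast
qed

text \<open>The last conclusion keeps \<open>D'\<close> away from the component unless \<open>y\<close> is one of its limits, so that \<open>y\<close> can
be reached from every point of the component in \<open>D'\<close>.\<close>

lemma uniform_local_connectedness_component:
  assumes y: "y \<in> D" "openin X D" and z: "z \<in> topspace X - C"
  obtains D' where "openin X D'" "y \<in> D'" "D' \<subseteq> D"
    "\<And>a b. \<lbrakk>a \<in> D' \<inter> side z; b \<in> D' \<inter> side z\<rbrakk>
       \<Longrightarrow> \<exists>S. connectedin X S \<and> S \<subseteq> D \<inter> side z \<and> a \<in> S \<and> b \<in> S"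
    "D' \<inter> side z \<noteq> {} \<Longrightarrow> y \<in> X closure_of (side z)"
proof -
  let ?O = "side z"
  have oO: "openin X ?O" by (rule component_open[OF locally_connected_X compl_open])
  have yX: "y \<in> topspace X" using y openin_subset by blast
  consider "y \<notin> X closure_of ?O" | "y \<in> ?O" | "y \<in> X closure_of ?O" "y \<notin> ?O" by blast
  then show thesis
  proof cases
    case 1
    have "openin X (D - X closure_of ?O)" using y(2) by (simp add: openin_diff)
    moreover have "?O \<subseteq> X closure_of ?O" by (rule closure_of_subset[OF openin_subset[OF oO]])
    ultimately have empty: "(D - X closure_of ?O) \<inter> ?O = {}" by blast
    show thesis
    proof (rule that)
      show "openin X (D - X closure_of ?O)" by fact
      show "y \<in> D - X closure_of ?O" using 1 y(1) by blast
    qed (use empty in \<open>simp_all add: disjoint_iff\<close>)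
  next
    case 2
    have "openin X (component X (D \<inter> ?O) y)" by (intro component_open locally_connected_X openin_Int y(2) oO)
    moreover have "y \<in> component X (D \<inter> ?O) y" using 2 y(1) yX by (intro component_refl) auto
    moreover have "y \<in> X closure_of ?O" using 2 closure_of_subset[OF openin_subset[OF oO]] by blast
    moreover have "component X (D \<inter> ?O) y \<subseteq> D \<inter> ?O" by (rule component_subset)
    ultimately show thesis
    proof (intro that)
      fix a b assume "a \<in> component X (D \<inter> ?O) y \<inter> ?O" "b \<in> component X (D \<inter> ?O) y \<inter> ?O"
      then show "\<exists>S. connectedin X S \<and> S \<subseteq> D \<inter> ?O \<and> a \<in> S \<and> b \<in> S"
        using component_subset[of X "D \<inter> ?O" y] component_connected[of X "D \<inter> ?O" y] by blast
    qed simp_all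
  next
    case 3
    then have yC: "y \<in> C" using component_closure[OF z] by blast
    obtain p P k c where chart: "plane_chart X (topspace X - {p}) P k"
      and p: "p \<in> topspace X - C" "p \<notin> ?O"
      and c: "simple_path c" "pathfinish c = pathstart c" "P ` C = path_image c"
      and O': "P ` ?O = inside (path_image c)"
      using planar_component[OF z] by metis
    interpret plane_chart X "topspace X - {p}" P k by (rule chart)
    have OD: "?O \<subseteq> topspace X - {p}" using p component_subset_topspace[of X _ z] by blast
    have yp: "y \<in> topspace X - {p}" using yC p yX by blast
    let ?E = "P ` (D - {p})"
    have DE: "D - {p} \<subseteq> topspace X - {p}" using y(2) openin_subset by blast
    have "openin X (D - {p})"
      using y(2) hausdorff p by (auto simp: closedin_Hausdorff_sing_eq intro: openin_diff)
    then have "open ?E" by (rule P_open[OF _ DE])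
    moreover have "P y \<in> ?E" using y(1) yp by blast
    moreover have "P y \<in> path_image c" using yC c(3) by blast
    ultimately obtain E' where E': "open E'" "P y \<in> E'" "E' \<subseteq> ?E"
      and sep: "\<And>a b. \<lbrakk>a \<in> E'; b \<in> E'; connected_component (- path_image c) a b\<rbrakk>
          \<Longrightarrow> connected_component (?E - path_image c) a b"
      using simple_loop_local_separation[OF c(1,2), of "P y" ?E] by blast
    show thesis
    proof
      show "openin X (k ` E')" by (rule k_open[OF E'(1)])
      show "y \<in> k ` E'" using E'(2) k_P[OF yp] by (metis imageI)
      have kE: "k ` ?E = D - {p}" by (rule k_P_image[OF DE])
      then show "k ` E' \<subseteq> D" using E'(3) by blast
      show "y \<in> X closure_of ?O" by (rule 3(1))
      fix a b assume ab: "a \<in> k ` E' \<inter> ?O" "b \<in> k ` E' \<inter> ?O"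
      have Pab: "P a \<in> E'" "P b \<in> E'" "P a \<in> inside (path_image c)" "P b \<in> inside (path_image c)"
        using ab P_k O' by auto
      have "connected (inside (path_image c))" "inside (path_image c) \<subseteq> - path_image c"
        using Jordan_inside_outside[OF c(1,2)] inside_no_overlap by blast+
      then have "connected_component (- path_image c) (P a) (P b)"
        using Pab(3,4) unfolding connected_component_def by blast
      then have "connected_component (?E - path_image c) (P a) (P b)" using sep Pab(1,2) by blast
      then obtain S where S: "connected S" "S \<subseteq> ?E - path_image c" "P a \<in> S" "P b \<in> S"
        unfolding connected_component_def by blast
      have "k ` S \<subseteq> D - {p}" using S(2) kE by blast
      have conn: "connectedin X (k ` S)" by (rule k_connected[OF S(1)])
      have kab: "a \<in> k ` S" "b \<in> k ` S" using S(3,4) k_P OD ab by (metis IntD2 imageI subsetD)+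
      have "k ` S \<subseteq> topspace X - C"
      proof
        fix x assume x: "x \<in> k ` S"
        then have "P x \<in> S" "x \<in> topspace X" using P_k k_in by auto
        then show "x \<in> topspace X - C" using S(2) c(3) by blast
      qed
      then have "k ` S \<subseteq> side a" using conn kab(1) by (intro component_maximal)
      also have "\<dots> = ?O" using ab(1) component_eq[of a X "topspace X - C" z] by blast
      finally show "\<exists>S. connectedin X S \<and> S \<subseteq> D \<inter> ?O \<and> a \<in> S \<and> b \<in> S"
        using conn kab \<open>k ` S \<subseteq> D - {p}\<close> by blast
    qed
  qed
qed

end

section \<open>Thurston maps as finite open maps\<close>

lemma planar_chart_open_image:
  assumes "planar_chart X (U, \<phi>)" "openin X W" "W \<subseteq> U"
  shows "open (\<phi> ` W)"
proof -
  have h: "homeomorphic_map (subtopology X U) (top_of_set (\<phi> ` U)) \<phi>" and U: "openin X U" "open (\<phi> ` U)"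
    using assms(1) by (auto simp: planar_chart_def)
  have "openin (subtopology X U) W" using assms U by (simp add: openin_open_subtopology)
  then have "openin (top_of_set (\<phi> ` U)) (\<phi> ` W)"
    using homeomorphic_imp_open_map[OF h] by (simp add: open_map_def)
  then show ?thesis using U(2) by (simp add: openin_open_eq)
qed

lemma planar_chart_open_preimage:
  assumes "planar_chart X (U, \<phi>)" "open B"
  shows "openin X {u \<in> U. \<phi> u \<in> B}"
proof -
  have h: "homeomorphic_map (subtopology X U) (top_of_set (\<phi> ` U)) \<phi>" and U: "openin X U"
    using assms(1) by (auto simp: planar_chart_def)
  have "continuous_map (subtopology X U) euclidean \<phi>"
    using homeomorphic_imp_continuous_map[OF h] continuous_map_into_fulltopology by blast
  then have "openin (subtopology X U) {u \<in> topspace (subtopology X U). \<phi> u \<in> B}"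
    using assms(2) by (intro openin_continuous_map_preimage[where Y=euclidean]) auto
  moreover have "{u \<in> topspace (subtopology X U). \<phi> u \<in> B} = {u \<in> U. \<phi> u \<in> B}"
    using openin_subset[OF U] by auto
  ultimately show ?thesis using U by (simp add: openin_open_subtopology)
qed

lemma planar_chart_inj:
  assumes "planar_chart X (U, \<phi>)"
  shows "inj_on \<phi> U"
proof -
  have h: "homeomorphic_map (subtopology X U) (top_of_set (\<phi> ` U)) \<phi>" and U: "openin X U"
    using assms(1) by (auto simp: planar_chart_def)
  show ?thesis
    using homeomorphic_imp_injective_map[OF h] openin_subset[OF U] by (simp add: Int_absorb1)
qed

lemma planar_chart_disc:
  assumes chart: "planar_chart X (U, \<phi>)" and E: "openin X E" and y: "y \<in> U" "y \<in> E"
  obtains D h where "openin X D" "y \<in> D" "D \<subseteq> E"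
    "homeomorphic_map (subtopology X D) (euclidean :: complex topology) h"
proof -
  have h: "homeomorphic_map (subtopology X U) (top_of_set (\<phi> ` U)) \<phi>" and U: "openin X U"
    using chart by (auto simp: planar_chart_def)
  have "open (\<phi> ` (U \<inter> E))" using planar_chart_open_image[OF chart] U E by (simp add: openin_Int)
  then obtain r where r: "r > 0" "ball (\<phi> y) r \<subseteq> \<phi> ` (U \<inter> E)"
    using y open_contains_ball by (metis IntI imageI)
  define D where "D = {u \<in> U. \<phi> u \<in> ball (\<phi> y) r}"
  have im: "\<phi> ` D = ball (\<phi> y) r" using r(2) by (auto simp: D_def)
  have DU: "D \<subseteq> U" by (auto simp: D_def)
  have "topspace (subtopology X U) \<inter> D = D" using openin_subset[OF U] DU by auto
  then have "homeomorphic_map (subtopology (subtopology X U) D)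
      (subtopology (top_of_set (\<phi> ` U)) (ball (\<phi> y) r)) \<phi>"
    using r(2) im by (intro homeomorphic_map_subtopologies[OF h]) auto
  moreover have "subtopology (subtopology X U) D = subtopology X D"
    using DU by (simp add: subtopology_subtopology Int_absorb1)
  moreover have "subtopology (top_of_set (\<phi> ` U)) (ball (\<phi> y) r) = top_of_set (ball (\<phi> y) r)"
    using r(2) by (simp add: subtopology_subtopology Int_absorb1 subset_trans image_mono)
  ultimately have "subtopology X D homeomorphic_space top_of_set (ball (\<phi> y) r)"
    using homeomorphic_map_imp_homeomorphic_space by metis
  moreover have "ball (\<phi> y) r homeomorphic (UNIV :: complex set)"
    using r(1) by (rule homeomorphic_ball_UNIV)
  then have "top_of_set (ball (\<phi> y) r) homeomorphic_space (euclidean :: complex topology)"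
    using homeomorphic_space_top_of_set[of "ball (\<phi> y) r" "UNIV :: complex set"] by simp
  ultimately have "subtopology X D homeomorphic_space (euclidean :: complex topology)"
    using homeomorphic_space_trans by blast
  then obtain h where "homeomorphic_map (subtopology X D) (euclidean :: complex topology) h"
    using homeomorphic_space by blast
  moreover have "openin X D" unfolding D_def by (rule planar_chart_open_preimage[OF chart]) simp
  moreover have "y \<in> D" using y r(1) by (simp add: D_def)
  moreover have "D \<subseteq> E"
  proof
    fix u assume "u \<in> D"
    then have "u \<in> U" "\<phi> u \<in> \<phi> ` (U \<inter> E)" using r(2) by (auto simp: D_def)
    then show "u \<in> E" using inj_onD[OF planar_chart_inj[OF chart]] by blast
  qed
  ultimately show thesis using that by blast
qed

lemma has_local_degreeE:
  assumes "has_local_degree X A f x k"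
  obtains U \<phi> V \<psi> where "k \<ge> 1" "planar_chart X (U, \<phi>)" "planar_chart X (V, \<psi>)" "x \<in> U"
    "openin X U" "openin X V" "\<And>u. u \<in> U \<Longrightarrow> f u \<in> V" "\<phi> x = 0" "\<psi> (f x) = 0"
    "\<And>u. u \<in> U \<Longrightarrow> \<psi> (f u) = \<phi> u ^ k"
  using assms that unfolding has_local_degree_def oriented_chart_def
  by (smt (verit) image_subset_iff planar_chart_def case_prod_conv)

lemma has_local_degree_charts:
  assumes "has_local_degree X A f x k"
  shows "k \<ge> 1" "\<exists>U \<phi>. planar_chart X (U, \<phi>) \<and> openin X U \<and> x \<in> U"
    "\<exists>V \<psi>. planar_chart X (V, \<psi>) \<and> openin X V \<and> f x \<in> V"
proof -
  show "k \<ge> 1" using assms by (simp add: has_local_degree_def)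
  obtain U \<phi> V \<psi> where *: "planar_chart X (U, \<phi>)" "planar_chart X (V, \<psi>)" "x \<in> U" "f ` U \<subseteq> V"
    using assms unfolding has_local_degree_def oriented_chart_def by blast
  then have "openin X U" "openin X V" "f x \<in> V" by (auto simp: planar_chart_def)
  then show "\<exists>U \<phi>. planar_chart X (U, \<phi>) \<and> openin X U \<and> x \<in> U"
    "\<exists>V \<psi>. planar_chart X (V, \<psi>) \<and> openin X V \<and> f x \<in> V" using * by blast+
qed

text \<open>In the coordinates of the definition \<open>f\<close> is the map \<open>z \<mapsto> z ^ k\<close> on a disc of radius \<open>r\<close>, and \<open>G\<close> is the
disc of radius \<open>r ^ k\<close>.\<close>

lemma local_preimages:
  assumes deg: "has_local_degree X A f x k" and N: "openin X N" "x \<in> N"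
  obtains N' G where "openin X N'" "x \<in> N'" "N' \<subseteq> N" "openin X G" "f x \<in> G"
    "G \<subseteq> f ` N'" "\<And>q. \<lbrakk>q \<in> G; q \<noteq> f x\<rbrakk> \<Longrightarrow> card {u \<in> N'. f u = q} = k"
    "\<And>u. \<lbrakk>u \<in> N'; f u = f x\<rbrakk> \<Longrightarrow> u = x" "k = 1 \<Longrightarrow> inj_on f N'"
proof -
  obtain U \<phi> V \<psi> where k: "k \<ge> 1" and \<phi>: "planar_chart X (U, \<phi>)" and \<psi>: "planar_chart X (V, \<psi>)"
    and xU: "x \<in> U" and U: "openin X U" and V: "openin X V" and fV: "\<And>u. u \<in> U \<Longrightarrow> f u \<in> V"
    and 0: "\<phi> x = 0" "\<psi> (f x) = 0" and pow: "\<And>u. u \<in> U \<Longrightarrow> \<psi> (f u) = \<phi> u ^ k"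
    using has_local_degreeE[OF deg] by blast
  note inj\<phi> = inj_onD[OF planar_chart_inj[OF \<phi>]]
  note inj\<psi> = inj_onD[OF planar_chart_inj[OF \<psi>]]
  have "open (\<phi> ` (U \<inter> N))" using planar_chart_open_image[OF \<phi>] U N by (simp add: openin_Int)
  moreover have "0 \<in> \<phi> ` (U \<inter> N)" using xU N(2) 0(1) by (metis IntI imageI)
  ultimately obtain r where r: "r > 0" "ball 0 r \<subseteq> \<phi> ` (U \<inter> N)"
    using open_contains_ball by metis
  define N' where "N' = N \<inter> {u \<in> U. \<phi> u \<in> ball 0 r}"
  define G where "G = {q \<in> V. \<psi> q \<in> ball 0 (r ^ k)}"
  have lift: "\<exists>u\<in>N'. \<phi> u = z" if "norm z < r" for z
  proof -
    have "z \<in> \<phi> ` (U \<inter> N)" using that r(2) by auto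
    then obtain u where "u \<in> U \<inter> N" "\<phi> u = z" by blast
    then show ?thesis using that by (auto simp: N'_def)
  qed
  have small: "norm z < r" if "z ^ k = \<psi> q" "q \<in> G" for z q
  proof -
    have "norm z ^ k < r ^ k" using that by (simp add: G_def flip: norm_power)
    then show ?thesis using r(1) power_less_imp_less_base less_imp_le by blast
  qed
  have fibre: "f u = q \<longleftrightarrow> \<phi> u ^ k = \<psi> q" if "u \<in> N'" "q \<in> V" for u q
    using pow[of u] fV[of u] inj\<psi>[of "f u" q] that by (auto simp: N'_def)
  show thesis
  proof
    show "openin X N'" unfolding N'_def
      by (intro openin_Int N(1) planar_chart_open_preimage[OF \<phi>]) simp
    show "x \<in> N'" using xU N(2) 0(1) r(1) by (simp add: N'_def)
    show "N' \<subseteq> N" by (simp add: N'_def)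
    show "openin X G" unfolding G_def by (intro planar_chart_open_preimage[OF \<psi>]) simp
    show "f x \<in> G" using fV[OF xU] 0(2) r(1) by (simp add: G_def)
    show "G \<subseteq> f ` N'"
    proof
      fix q assume q: "q \<in> G"
      have "\<exists>z. z ^ k = \<psi> q" 
        using k by (metis exists_complex_root Suc_le_eq One_nat_def not_gr_zero less_numeral_extra(3))
      then obtain z where z: "z ^ k = \<psi> q" by blast
      obtain u where u: "u \<in> N'" "\<phi> u = z" using lift[OF small[OF z q]] by blast
      then have "f u = q" using fibre[OF u(1), of q] z q by (simp add: G_def)
      then show "q \<in> f ` N'" using u(1) by blast
    qed
    show "u = x" if "u \<in> N'" "f u = f x" for u
    proof -
      have uU: "u \<in> U" using that by (simp add: N'_def)
      then have "\<phi> u ^ k = 0" using pow[OF uU] that(2) 0(2) by simp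
      then show ?thesis using inj\<phi>[of u x] uU xU 0(1) k by simp
    qed
    show "inj_on f N'" if "k = 1"
    proof (rule inj_onI)
      fix u v assume uv: "u \<in> N'" "v \<in> N'" "f u = f v"
      then have "u \<in> U" "v \<in> U" by (auto simp: N'_def)
      then show "u = v" using pow[of u] pow[of v] inj\<phi>[of u v] uv(3) that by simp
    qed
    fix q assume q: "q \<in> G" "q \<noteq> f x"
    have qV: "q \<in> V" using q(1) by (simp add: G_def)
    have nz: "\<psi> q \<noteq> 0" using inj\<psi>[of q "f x"] qV fV[OF xU] 0(2) q(2) by auto
    have "\<phi> ` {u \<in> N'. f u = q} = {z. z ^ k = \<psi> q}"
    proof
      show "\<phi> ` {u \<in> N'. f u = q} \<subseteq> {z. z ^ k = \<psi> q}" using fibre qV by auto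
      show "{z. z ^ k = \<psi> q} \<subseteq> \<phi> ` {u \<in> N'. f u = q}"
      proof
        fix z assume "z \<in> {z. z ^ k = \<psi> q}"
        then have z: "z ^ k = \<psi> q" by simp
        obtain u where u: "u \<in> N'" "\<phi> u = z" using lift[OF small[OF z q(1)]] by blast
        then show "z \<in> \<phi> ` {u \<in> N'. f u = q}" using fibre[OF u(1) qV] z by blast
      qed
    qed
    moreover have "inj_on \<phi> {u \<in> N'. f u = q}"
      by (rule inj_on_subset[OF planar_chart_inj[OF \<phi>]]) (auto simp: N'_def)
    moreover have "card {z. z ^ k = \<psi> q} = k" using nz k by (intro card_nth_roots) auto
    ultimately show "card {u \<in> N'. f u = q} = k"
      using card_image[of \<phi> "{u \<in> N'. f u = q}"] by simp
  qed
qed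

text \<open>The degree is determined by \<open>f\<close>, since it counts the preimages near \<open>x\<close> of points near \<open>f x\<close>. This
justifies the definite description in the definition of the local degree.\<close>

lemma has_local_degree_le:
  assumes k: "has_local_degree X A f x k" and l: "has_local_degree X A f x l"
    and x: "x \<in> topspace X"
  shows "l \<le> k"
proof (rule local_preimages[OF k openin_topspace x])
  fix N1 G1 assume 1: "openin X N1" "x \<in> N1" "openin X G1" "f x \<in> G1"
    "\<And>q. \<lbrakk>q \<in> G1; q \<noteq> f x\<rbrakk> \<Longrightarrow> card {u \<in> N1. f u = q} = k"
  show "l \<le> k"
  proof (rule local_preimages[OF l 1(1,2)])
    fix N2 G2 assume 2: "N2 \<subseteq> N1" "openin X G2" "f x \<in> G2"
      "\<And>q. \<lbrakk>q \<in> G2; q \<noteq> f x\<rbrakk> \<Longrightarrow> card {u \<in> N2. f u = q} = l"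
    obtain V \<psi> where \<psi>: "planar_chart X (V, \<psi>)" "openin X V" "f x \<in> V" and k1: "k \<ge> 1"
      using has_local_degree_charts[OF k] by blast
    let ?G = "V \<inter> (G1 \<inter> G2)"
    have "open (\<psi> ` ?G)" using planar_chart_open_image[OF \<psi>(1)] \<psi>(2) 1(3) 2(2) by (simp add: openin_Int)
    moreover have "\<psi> (f x) \<in> \<psi> ` ?G" using \<psi>(3) 1(4) 2(3) by blast
    moreover have "\<psi> ` ?G \<noteq> {\<psi> (f x)}" using calculation(1) not_open_singleton[of "\<psi> (f x)"] by auto
    ultimately obtain z where "z \<in> \<psi> ` ?G" "z \<noteq> \<psi> (f x)" by blast
    then obtain q where q: "q \<in> G1" "q \<in> G2" "q \<noteq> f x" by blast
    have "card {u \<in> N1. f u = q} = k" using 1(5) q by blast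
    moreover have "finite {u \<in> N1. f u = q}" using calculation k1 card_ge_0_finite[of "{u \<in> N1. f u = q}"] by simp
    moreover have "{u \<in> N2. f u = q} \<subseteq> {u \<in> N1. f u = q}" using 2(1) by blast
    ultimately have "card {u \<in> N2. f u = q} \<le> k" using card_mono by metis
    then show "l \<le> k" using 2(4)[OF q(2,3)] by simp
  qed
qed

lemma local_degree_eq:
  assumes "has_local_degree X A f x k" "x \<in> topspace X"
  shows "local_degree X A f x = k"
  unfolding local_degree_def
proof (rule the_equality)
  show "has_local_degree X A f x k" by (rule assms(1))
  fix l assume l: "has_local_degree X A f x l"
  show "l = k"
    using has_local_degree_le[OF assms(1) l assms(2)] has_local_degree_le[OF l assms(1) assms(2)] by simp
qed

lemma finite_open_map_compose:
  assumes "finite_open_map X g" "finite_open_map X f"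
  shows "finite_open_map X (g \<circ> f)"
proof -
  interpret g: finite_open_map X g by fact
  interpret f: finite_open_map X f by fact
  show ?thesis
  proof
    show "continuous_map X X (g \<circ> f)" by (rule continuous_map_compose[OF f.cont g.cont])
    show "open_map X X (g \<circ> f)" by (rule open_map_compose[OF f.is_open_map g.is_open_map])
    fix y
    have "preimg X (g \<circ> f) {y} \<subseteq> (\<Union>z\<in>preimg X g {y}. preimg X f {z})"
      using f.g_in by auto
    then show "finite (preimg X (g \<circ> f) {y})"
      by (rule finite_subset) (intro finite_UN_I g.finite_fibre f.finite_fibre)
  qed (rule f.compact_X f.hausdorff f.locally_connected_X)+
qed

locale thurston_sphere = topological_sphere X for X :: "'a topology" +
  fixes A :: "('a set \<times> ('a \<Rightarrow> complex)) set" and f :: "'a \<Rightarrow> 'a"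
  assumes thurston: "thurston_map X A f"
begin

lemma f_cont: "continuous_map X X f"
  using thurston by (simp add: thurston_map_def branched_covering_def)

lemma f_deg: "x \<in> topspace X \<Longrightarrow> \<exists>k. has_local_degree X A f x k"
  using thurston by (simp add: thurston_map_def branched_covering_def)

lemma finite_post: "finite (post X A f)"
  using thurston by (simp add: thurston_map_def)

lemma f_finite_open_map: "finite_open_map X f"
proof
  show "open_map X X f"
    unfolding open_map_def
  proof (intro allI impI)
    fix N assume N: "openin X N"
    show "openin X (f ` N)"
    proof (subst openin_subopen, intro ballI)
      fix y assume "y \<in> f ` N"
      then obtain x where x: "x \<in> N" "y = f x" by blast
      then obtain k where k: "has_local_degree X A f x k" using f_deg openin_subset[OF N] by blast
      show "\<exists>T. openin X T \<and> y \<in> T \<and> T \<subseteq> f ` N"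
      proof (rule local_preimages[OF k N x(1)])
        fix N' G assume "N' \<subseteq> N" "openin X G" "f x \<in> G" "G \<subseteq> f ` N'"
        then have "openin X G \<and> y \<in> G \<and> G \<subseteq> f ` N" using x(2) by blast
        then show ?thesis by blast
      qed
    qed
  qed
  fix y
  show "finite (preimg X f {y})"
  proof (cases "y \<in> topspace X")
    case False
    then have "preimg X f {y} = {}"
      using continuous_map_image_subset_topspace[OF f_cont] by (auto simp: image_subset_iff)
    then show ?thesis by simp
  next
    case True
    have "\<exists>N. openin X N \<and> x \<in> N \<and> N \<inter> preimg X f {y} \<subseteq> {x}" if "x \<in> preimg X f {y}" for x
    proof -
      have x: "x \<in> topspace X" "f x = y" using that by auto
      then obtain k where k: "has_local_degree X A f x k" using f_deg by blast
      show ?thesis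
      proof (rule local_preimages[OF k openin_topspace x(1)])
        fix N assume N: "openin X N" "x \<in> N" "\<And>u. \<lbrakk>u \<in> N; f u = f x\<rbrakk> \<Longrightarrow> u = x"
        have "N \<inter> preimg X f {y} \<subseteq> {x}" using N(3) x(2) by auto
        then show ?thesis using N(1,2) by blast
      qed
    qed
    then have "\<forall>x\<in>preimg X f {y}. \<exists>N. openin X N \<and> x \<in> N \<and> N \<inter> preimg X f {y} \<subseteq> {x}" by (rule ballI)
    from bchoice[OF this] obtain N where
      N: "\<forall>x\<in>preimg X f {y}. openin X (N x) \<and> x \<in> N x \<and> N x \<inter> preimg X f {y} \<subseteq> {x}"
      by (rule exE)
    have "closedin X {y}" using True hausdorff by (simp add: closedin_Hausdorff_sing_eq)
    then have "closedin X (preimg X f {y})"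
      unfolding preimg_def by (rule closedin_continuous_map_preimage[OF f_cont])
    then have cpt: "compactin X (preimg X f {y})" by (rule closedin_compact_space[OF compact_X])
    have "\<And>U. U \<in> N ` preimg X f {y} \<Longrightarrow> openin X U" using N by blast
    moreover have "preimg X f {y} \<subseteq> \<Union>(N ` preimg X f {y})" using N by blast
    ultimately have "\<exists>\<F>. finite \<F> \<and> \<F> \<subseteq> N ` preimg X f {y} \<and> preimg X f {y} \<subseteq> \<Union>\<F>"
      by (rule compactinD[OF cpt])
    then obtain \<F> where F: "finite \<F>" "\<F> \<subseteq> N ` preimg X f {y}" "preimg X f {y} \<subseteq> \<Union>\<F>"
      by blast
    obtain I where I: "finite I" "I \<subseteq> preimg X f {y}" "\<F> = N ` I"
      using finite_subset_image[OF F(1,2)] by blast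
    have "preimg X f {y} \<subseteq> I"
    proof
      fix x assume x: "x \<in> preimg X f {y}"
      then obtain i where i: "i \<in> I" "x \<in> N i" using F(3) I(3) by blast
      then have "x \<in> {i}" using N I(2) x by blast
      then show "x \<in> I" using i(1) by simp
    qed
    then show ?thesis using I(1) finite_subset by blast
  qed
qed (rule f_cont compact_X hausdorff locally_connected_X)+

lemma iterate_finite_open_map: "finite_open_map X (f ^^ n)"
proof (induction n)
  case 0
  show ?case
  proof
    show "continuous_map X X (f ^^ 0)" by simp
    show "open_map X X (f ^^ 0)" by (simp add: open_map_def)
    show "finite (preimg X (f ^^ 0) {y})" for y
      by (rule finite_subset[of _ "{y}"]) auto
  qed (rule compact_X hausdorff locally_connected_X)+
next
  case (Suc n)
  show ?case
    using finite_open_map_compose[OF Suc f_finite_open_map] by (simp only: funpow_Suc_right)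
qed

text \<open>If \<open>(f ^^ n) x\<close> is not postcritical then none of \<open>x, \<dots>, (f ^^ (n - 1)) x\<close> is critical.\<close>

lemma iterate_locally_injective:
  assumes "x \<in> topspace X" "(f ^^ n) x \<notin> post X A f"
  shows "\<exists>N. openin X N \<and> x \<in> N \<and> inj_on (f ^^ n) N"
  using assms
proof (induction n arbitrary: x)
  case 0
  then show ?case by (intro exI[of _ "topspace X"]) simp
next
  case (Suc n)
  interpret f: finite_open_map X f by (rule f_finite_open_map)
  have "x \<notin> crit X A f"
  proof
    assume "x \<in> crit X A f"
    moreover have "(1::nat) \<le> Suc n" by simp
    ultimately have "(f ^^ Suc n) x \<in> post X A f" unfolding post_def by blast
    then show False using Suc.prems(2) by blast
  qed
  then have less: "local_degree X A f x < 2" using Suc.prems(1) by (simp add: crit_def)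
  obtain k where k: "has_local_degree X A f x k" using f_deg[OF Suc.prems(1)] by blast
  have "k < 2" using less local_degree_eq[OF k Suc.prems(1)] by simp
  moreover have "k \<ge> 1" using k by (simp add: has_local_degree_def)
  ultimately have "k = 1" by simp
  have "\<exists>N. openin X N \<and> x \<in> N \<and> inj_on f N"
  proof (rule local_preimages[OF k openin_topspace Suc.prems(1)])
    fix N assume "openin X N" "x \<in> N" "k = 1 \<Longrightarrow> inj_on f N"
    then show ?thesis using \<open>k = 1\<close> by blast
  qed
  then obtain N1 where N1: "openin X N1" "x \<in> N1" "inj_on f N1" by blast
  have "(f ^^ n) (f x) \<notin> post X A f" using Suc.prems(2) by (simp add: funpow_swap1)
  then obtain N2 where N2: "openin X N2" "f x \<in> N2" "inj_on (f ^^ n) N2"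
    using Suc.IH[OF f.g_in[OF Suc.prems(1)]] by blast
  let ?N = "N1 \<inter> preimg X f N2"
  have "openin X ?N" by (intro openin_Int N1 f.preimg_open N2)
  moreover have "x \<in> ?N" using N1 N2 Suc.prems(1) by simp
  moreover have "inj_on (f ^^ Suc n) ?N"
  proof (rule inj_onI)
    fix u v assume uv: "u \<in> ?N" "v \<in> ?N" "(f ^^ Suc n) u = (f ^^ Suc n) v"
    have "(f ^^ n) (f u) = (f ^^ n) (f v)" using uv(3) by (simp add: funpow_swap1)
    then have "f u = f v" using inj_onD[OF N2(3), of "f u" "f v"] uv(1,2) by simp
    then show "u = v" using inj_onD[OF N1(3), of u v] uv(1,2) by simp
  qed
  ultimately show ?case by blast
qed

lemma disc_nbhd:
  assumes y: "y \<in> topspace X"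
  obtains D h where "openin X D" "y \<in> D" "D \<inter> post X A f \<subseteq> {y}"
    "homeomorphic_map (subtopology X D) (euclidean :: complex topology) h"
proof -
  obtain k where k: "has_local_degree X A f y k" using f_deg[OF y] by blast
  obtain U \<phi> where U: "planar_chart X (U, \<phi>)" "y \<in> U"
    using has_local_degree_charts[OF k] by blast
  have "finite (topspace X \<inter> (post X A f - {y}))" using finite_post by simp
  then have "closedin X (topspace X \<inter> (post X A f - {y}))"
    using hausdorff by (intro closedin_Hausdorff_finite) auto
  then have "openin X (topspace X - topspace X \<inter> (post X A f - {y}))" by blast
  moreover have "y \<in> topspace X - topspace X \<inter> (post X A f - {y})" using y by blast
  ultimately obtain D h where D: "openin X D" "y \<in> D"
    "D \<subseteq> topspace X - topspace X \<inter> (post X A f - {y})"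
    "homeomorphic_map (subtopology X D) (euclidean :: complex topology) h"
    using planar_chart_disc[OF U(1)] U(2) by metis
  have "D \<inter> post X A f \<subseteq> {y}" using D(3) by blast
  then show thesis using that D by blast
qed

end

section \<open>Tiles and stars\<close>

context sphere_jordan
begin

lemma finite_component_representatives:
  obtains I where "finite I" "I \<subseteq> topspace X - C"
    "\<forall>z\<in>topspace X - C. \<exists>i\<in>I. side z = side i"
proof -
  obtain I where I: "finite I" "I \<subseteq> topspace X - C"
    "side ` (topspace X - C) = side ` I"
    using finite_subset_image[OF finite_components order_refl] by blast
  have "\<exists>i\<in>I. side z = side i" if "z \<in> topspace X - C" for z
  proof -
    have "side z \<in> side ` I" using I(3) that by blast
    then show ?thesis by blast
  qed
  then show thesis by (intro that[OF I(1,2)] ballI)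
qed

text \<open>The finitely many components are treated one by one and the neighbourhoods intersected.\<close>

lemma uniform_local_connectedness:
  assumes y: "y \<in> D" "openin X D"
  obtains D' where "openin X D'" "y \<in> D'" "D' \<subseteq> D"
    "\<And>z a b. \<lbrakk>z \<in> topspace X - C; a \<in> D' \<inter> side z; b \<in> D' \<inter> side z\<rbrakk>
       \<Longrightarrow> \<exists>S. connectedin X S \<and> S \<subseteq> D \<inter> side z \<and> a \<in> S \<and> b \<in> S"
    "\<And>z. \<lbrakk>z \<in> topspace X - C; D' \<inter> side z \<noteq> {}\<rbrakk>
       \<Longrightarrow> y \<in> X closure_of (side z)"
proof -
  define good where "good E z \<longleftrightarrow>
     (\<forall>a b. a \<in> E \<inter> side z \<and> b \<in> E \<inter> side z \<longrightarrow>
        (\<exists>S. connectedin X S \<and> S \<subseteq> D \<inter> side z \<and> a \<in> S \<and> b \<in> S)) \<and>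
     (E \<inter> side z \<noteq> {} \<longrightarrow> y \<in> X closure_of (side z))" for E z
  have good_mono: "good E z" if "good E' z" "E \<subseteq> E'" for E E' z
    using that unfolding good_def by blast
  have ex: "\<exists>E. openin X E \<and> y \<in> E \<and> E \<subseteq> D \<and> good E z" if z: "z \<in> topspace X - C" for z
  proof (rule uniform_local_connectedness_component[OF y z])
    fix E assume E: "openin X E" "y \<in> E" "E \<subseteq> D"
      "\<And>a b. \<lbrakk>a \<in> E \<inter> side z; b \<in> E \<inter> side z\<rbrakk>
         \<Longrightarrow> \<exists>S. connectedin X S \<and> S \<subseteq> D \<inter> side z \<and> a \<in> S \<and> b \<in> S"
      "E \<inter> side z \<noteq> {} \<Longrightarrow> y \<in> X closure_of (side z)"
    have "good E z" unfolding good_def using E(4,5) by simp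
    then show ?thesis using E(1-3) by blast
  qed
  obtain I where I: "finite I" "I \<subseteq> topspace X - C"
    "\<forall>z\<in>topspace X - C. \<exists>i\<in>I. side z = side i"
    by (rule finite_component_representatives)
  have "\<forall>i\<in>I. \<exists>E. openin X E \<and> y \<in> E \<and> E \<subseteq> D \<and> good E i"
    by (intro ballI ex) (rule subsetD[OF I(2)])
  from bchoice[OF this] obtain E where E: "\<forall>i\<in>I. openin X (E i) \<and> y \<in> E i \<and> E i \<subseteq> D \<and> good (E i) i"
    by (rule exE)
  define D' where "D' = D \<inter> ((\<Inter>i\<in>I. E i) \<inter> topspace X)"
  have goodD: "good D' z" if z: "z \<in> topspace X - C" for z
  proof -
    obtain i where i: "i \<in> I" "side z = side i"
      using bspec[OF I(3) z] by (rule bexE)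
    have "good (E i) i" using E i(1) by blast
    then have "good D' i" by (rule good_mono) (use i(1) in \<open>auto simp: D'_def\<close>)
    then show ?thesis using i(2) unfolding good_def by simp
  qed
  show thesis
  proof
    have "openin X ((\<Inter>i\<in>I. E i) \<inter> topspace X)" using E I(1) by (intro openin_INT) auto
    then show "openin X D'" unfolding D'_def by (rule openin_Int[OF y(2)])
    show "y \<in> D'" unfolding D'_def using y E openin_subset[OF y(2)] by blast
    show "D' \<subseteq> D" unfolding D'_def by blast
  qed (use goodD in \<open>simp_all add: good_def\<close>)
qed

end

locale thurston_curve = thurston_sphere X A f + sphere_jordan X C
  for X :: "'a topology" and A :: "('a set \<times> ('a \<Rightarrow> complex)) set" and f :: "'a \<Rightarrow> 'a" and C :: "'a set" +
  assumes post_C: "post X A f \<subseteq> C"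
begin

definition complement :: "nat \<Rightarrow> 'a set" where
  "complement n = preimg X (f ^^ n) (topspace X - C)"

text \<open>The tiles of the definition are the closures of these open tiles. For \<open>x\<close> outside \<open>complement n\<close>
the open tile is empty.\<close>

definition tile :: "nat \<Rightarrow> 'a \<Rightarrow> 'a set" where
  "tile n x = component X (complement n) x"

lemma complement_eq: "complement n = topspace X - iter_preimage X f n C"
proof -
  interpret g: finite_open_map X "f ^^ n" by (rule iterate_finite_open_map)
  show ?thesis using g.g_in by (auto simp: complement_def iter_preimage_eq_preimg)
qed

lemma complement_open: "openin X (complement n)"
proof -
  interpret g: finite_open_map X "f ^^ n" by (rule iterate_finite_open_map)
  show ?thesis unfolding complement_def by (rule g.preimg_open[OF compl_open])
qed

lemma tiles_eq: "tiles X f C n = (\<lambda>x. X closure_of (tile n x)) ` complement n"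
proof -
  have "topspace X \<inter> complement n = complement n" by (auto simp: complement_def)
  then show ?thesis
    unfolding tiles_def complement_eq[symmetric] connected_components_of_eq_component tile_def image_image by simp
qed

lemma tile_open: "openin X (tile n x)"
  unfolding tile_def by (rule component_open[OF locally_connected_X complement_open])

lemma tile_refl: "x \<in> complement n \<Longrightarrow> x \<in> tile n x"
  unfolding tile_def by (rule component_refl) (simp_all add: complement_def)

lemma image_tile:
  assumes "x \<in> complement n"
  shows "(f ^^ n) ` tile n x = side ((f ^^ n) x)"
proof -
  interpret g: finite_open_map X "f ^^ n" by (rule iterate_finite_open_map)
  show ?thesis unfolding tile_def complement_def
    by (rule g.image_component[OF compl_open]) (use assms in \<open>simp add: complement_def\<close>)
qed

text \<open>The component of the complement of \<open>C\<close> onto which the tile is mapped is a disc without postcritical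
points, and every one of its points can be taken as the centre.\<close>

lemma inj_on_tile:
  assumes x: "x \<in> complement n"
  shows "inj_on (f ^^ n) (tile n x)"
proof (rule inj_onI)
  interpret g: finite_open_map X "f ^^ n" by (rule iterate_finite_open_map)
  fix u v assume uv: "u \<in> tile n x" "v \<in> tile n x" "(f ^^ n) u = (f ^^ n) v"
  let ?D = "side ((f ^^ n) x)"
  have z: "(f ^^ n) x \<in> topspace X - C" using x by (simp add: complement_def)
  obtain h where h: "homeomorphic_map (subtopology X ?D) (euclidean :: complex topology) h"
    by (rule component_planar[OF z])
  have "v = u"
  proof (rule g.preimage_of_disc_centre_unique[OF _ h _ _ refl])
    show "openin X ?D" by (rule component_open[OF locally_connected_X compl_open])
    show "(f ^^ n) u \<in> ?D" using image_tile[OF x] uv(1) by blast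
    show "(f ^^ n) v = (f ^^ n) u" using uv(3) by simp
    have "tile n x \<subseteq> preimg X (f ^^ n) ?D"
    proof
      fix t assume t: "t \<in> tile n x"
      have "(f ^^ n) t \<in> ?D" using image_tile[OF x] t by blast
      moreover have "t \<in> topspace X" using t unfolding tile_def by (rule component_topspaceD)
      ultimately show "t \<in> preimg X (f ^^ n) ?D" by simp
    qed
    moreover have "connectedin X (tile n x)" unfolding tile_def by (rule component_connected)
    ultimately show "v \<in> component X (preimg X (f ^^ n) ?D) u"
      using component_maximal[of X "tile n x" "preimg X (f ^^ n) ?D" u] uv(1,2) by blast
    fix w assume w: "w \<in> topspace X" "(f ^^ n) w \<in> ?D"
    have "(f ^^ n) w \<notin> post X A f" using component_memD[OF w(2)] post_C by blast
    then show "\<exists>N. openin X N \<and> w \<in> N \<and> inj_on (f ^^ n) N"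
      by (rule iterate_locally_injective[OF w(1)])
  qed
  then show "u = v" by simp
qed

text \<open>Let \<open>D\<close> be a disc around \<open>y\<close> that contains no postcritical point other than possibly \<open>y\<close>. A point \<open>w\<close> of
\<open>S\<close> maps into the closure of some component of the complement of \<open>C\<close>. Near \<open>y\<close> this component is
connected within \<open>D\<close> and accumulates at \<open>y\<close>; lifting that connected piece \<open>G\<close> to \<open>w\<close> produces
a subset \<open>H\<close> of a tile whose closure contains \<open>w\<close> and a preimage \<open>v\<close> of \<open>y\<close>. All these lifts lie in one
component of the preimage of \<open>D\<close>, so \<open>v\<close> is the same for all \<open>w\<close>.\<close>

lemma star_nbhd:
  assumes y: "y \<in> topspace X"
  obtains D' where "openin X D'" "y \<in> D'"
    "\<And>n S. \<lbrakk>connectedin X S; S \<subseteq> preimg X (f ^^ n) D'; S \<noteq> {}\<rbrakk> \<Longrightarrow>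
       \<exists>v. (\<forall>x\<in>S. (f ^^ n) x = y \<longrightarrow> x = v) \<and> (\<forall>w\<in>S. \<exists>\<tau>\<in>tiles X f C n. w \<in> \<tau> \<and> v \<in> \<tau>)"
proof -
  let ?U = "topspace X - C"
  obtain D h where D: "openin X D" "y \<in> D" and Dpost: "D \<inter> post X A f \<subseteq> {y}"
    and h: "homeomorphic_map (subtopology X D) (euclidean :: complex topology) h"
    by (rule disc_nbhd[OF y])
  show thesis
  proof (rule uniform_local_connectedness[OF D(2,1)])
    fix D' assume D': "openin X D'" "y \<in> D'" "D' \<subseteq> D"
      and ulc: "\<And>z a b. \<lbrakk>z \<in> ?U; a \<in> D' \<inter> side z; b \<in> D' \<inter> side z\<rbrakk>
         \<Longrightarrow> \<exists>S. connectedin X S \<and> S \<subseteq> D \<inter> side z \<and> a \<in> S \<and> b \<in> S"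
      and yO: "\<And>z. \<lbrakk>z \<in> ?U; D' \<inter> side z \<noteq> {}\<rbrakk> \<Longrightarrow> y \<in> X closure_of (side z)"
    show thesis
    proof (rule that[OF D'(1,2)])
      fix n S assume S: "connectedin X S" "S \<subseteq> preimg X (f ^^ n) D'" "S \<noteq> {}"
      interpret g: finite_open_map X "f ^^ n" by (rule iterate_finite_open_map)
      obtain s where s: "s \<in> S" using S(3) by blast
      define W where "W = component X (preimg X (f ^^ n) D) s"
      have SD: "S \<subseteq> preimg X (f ^^ n) D" by (rule order_trans[OF S(2) preimg_mono[OF D'(3)]])
      have SW: "S \<subseteq> W" unfolding W_def by (rule component_maximal[OF S(1) SD s])
      have unique: "v' = v" if "v \<in> W" "v' \<in> W" "(f ^^ n) v = y" "(f ^^ n) v' = y" for v v'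
      proof (rule g.preimage_of_disc_centre_unique[OF D(1) h D(2) _ that(3,4)])
        show "v' \<in> component X (preimg X (f ^^ n) D) v"
          using that(2) component_eq[OF that(1)[unfolded W_def]] by (simp add: W_def)
        fix x assume x: "x \<in> topspace X" "(f ^^ n) x \<in> D" "(f ^^ n) x \<noteq> y"
        then have "(f ^^ n) x \<notin> post X A f" using Dpost by blast
        then show "\<exists>N. openin X N \<and> x \<in> N \<and> inj_on (f ^^ n) N"
          by (rule iterate_locally_injective[OF x(1)])
      qed
      have star: "\<exists>v. v \<in> W \<and> (f ^^ n) v = y \<and> (\<exists>\<tau>\<in>tiles X f C n. w \<in> \<tau> \<and> v \<in> \<tau>)" if w: "w \<in> S" for w
      proof -
        have wX: "w \<in> topspace X" and q: "(f ^^ n) w \<in> D'" using subsetD[OF S(2) w] by auto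
        obtain z where z: "z \<in> ?U" "(f ^^ n) w \<in> X closure_of (side z)"
          by (rule in_closure_component[OF g.g_in[OF wX]])
        let ?O = "side z"
        have clD': "D' \<inter> X closure_of ?O \<subseteq> X closure_of (D' \<inter> ?O)"
          by (rule openin_Int_closure_of_subset[OF D'(1)])
        have qcl: "(f ^^ n) w \<in> X closure_of (D' \<inter> ?O)" using clD' q z(2) by blast
        then have "D' \<inter> ?O \<noteq> {}" by force
        then obtain a where a: "a \<in> D' \<inter> ?O" by blast
        have ycl: "y \<in> X closure_of (D' \<inter> ?O)" using clD' D'(2) yO[OF z(1) \<open>D' \<inter> ?O \<noteq> {}\<close>] by blast
        define G where "G = component X (D \<inter> ?O) a"
        have G: "openin X G" "connectedin X G"
          unfolding G_def by (intro component_open locally_connected_X openin_Int D(1) compl_open, rule component_connected)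
        have sub: "D' \<inter> ?O \<subseteq> G"
        proof
          fix b assume b: "b \<in> D' \<inter> ?O"
          obtain T where "connectedin X T" "T \<subseteq> D \<inter> ?O" "a \<in> T" "b \<in> T" using ulc[OF z(1) a b] by blast
          then show "b \<in> G" unfolding G_def using component_maximal[of X T "D \<inter> ?O" a] by blast
        qed
        have GO: "G \<subseteq> D \<inter> ?O" unfolding G_def by (rule component_subset)
        have qG: "(f ^^ n) w \<in> X closure_of G" and yG: "y \<in> X closure_of G"
          using closure_of_mono[OF sub] qcl ycl by blast+
        obtain u where u: "u \<in> preimg X (f ^^ n) G" "w \<in> X closure_of (component X (preimg X (f ^^ n) G) u)"
          by (rule g.in_closure_component_preimg[OF G wX qG])
        define H where "H = component X (preimg X (f ^^ n) G) u"
        have HX: "H \<subseteq> topspace X" unfolding H_def by (rule component_subset_topspace)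
        have Hsub: "H \<subseteq> preimg X (f ^^ n) G" unfolding H_def by (rule component_subset)
        have Hcon: "connectedin X H" unfolding H_def by (rule component_connected)
        have uG: "(f ^^ n) u \<in> G" and uX: "u \<in> topspace X" using u(1) by auto
        have uH: "u \<in> H" unfolding H_def by (rule component_refl[OF u(1) uX])
        have gH: "(f ^^ n) ` H = G"
          unfolding H_def using g.image_component[OF G(1) u(1)] component_of_connected[OF G(2) uG] by simp
        have "X closure_of ((f ^^ n) ` H) \<subseteq> (f ^^ n) ` (X closure_of H)"
          using g.is_closed_map HX by (simp add: closed_map_closure_of_image)
        then have "y \<in> (f ^^ n) ` (X closure_of H)" using yG gH by blast
        then obtain v where v: "v \<in> X closure_of H" "(f ^^ n) v = y" by blast
        have wH: "w \<in> X closure_of H" using u(2) by (simp add: H_def)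
        have Hcompl: "H \<subseteq> complement n"
        proof
          fix t assume "t \<in> H"
          then have "t \<in> topspace X" "(f ^^ n) t \<in> ?O" using subsetD[OF Hsub, of t] GO by auto
          then show "t \<in> complement n" using component_memD[of "(f ^^ n) t" X ?U z] by (simp add: complement_def)
        qed
        have "H \<subseteq> tile n u" unfolding tile_def by (rule component_maximal[OF Hcon Hcompl uH])
        then have "X closure_of H \<subseteq> X closure_of (tile n u)" by (rule closure_of_mono)
        then have "w \<in> X closure_of (tile n u)" "v \<in> X closure_of (tile n u)" using wH v(1) by auto
        moreover have "X closure_of (tile n u) \<in> tiles X f C n"
          unfolding tiles_eq using uH Hcompl by blast
        moreover have "v \<in> W"
        proof -
          have vX: "v \<in> topspace X" using v(1) in_closure_of by fast
          let ?T = "H \<union> {w, v}"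
          have "connectedin X ?T"
            using closure_of_subset[OF HX] v(1) wH
            by (intro connectedin_intermediate_closure_of[OF Hcon]) auto
          moreover have "H \<subseteq> preimg X (f ^^ n) D"
            by (rule order_trans[OF Hsub preimg_mono]) (use GO in blast)
          then have "?T \<subseteq> preimg X (f ^^ n) D"
            using subsetD[OF SD w] v(2) vX D(2) by auto
          ultimately have "?T \<subseteq> component X (preimg X (f ^^ n) D) w" by (intro component_maximal) auto
          moreover have "component X (preimg X (f ^^ n) D) w = W"
            unfolding W_def by (rule component_eq) (use SW w W_def in blast)
          ultimately show ?thesis by blast
        qed
        ultimately show ?thesis using v(2) by blast
      qed
      obtain v where v: "v \<in> W" "(f ^^ n) v = y" using star[OF s] by blast
      have "\<forall>x\<in>S. (f ^^ n) x = y \<longrightarrow> x = v" using unique[OF v(1) _ v(2)] SW by blast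
      moreover have "\<forall>w\<in>S. \<exists>\<tau>\<in>tiles X f C n. w \<in> \<tau> \<and> v \<in> \<tau>"
      proof
        fix w assume "w \<in> S"
        then obtain v' where v': "v' \<in> W" "(f ^^ n) v' = y" "\<exists>\<tau>\<in>tiles X f C n. w \<in> \<tau> \<and> v' \<in> \<tau>"
          using star by blast
        then show "\<exists>\<tau>\<in>tiles X f C n. w \<in> \<tau> \<and> v \<in> \<tau>" using unique[OF v(1) v'(1) v(2) v'(2)] by simp
      qed
      ultimately show "\<exists>v. (\<forall>x\<in>S. (f ^^ n) x = y \<longrightarrow> x = v) \<and>
          (\<forall>w\<in>S. \<exists>\<tau>\<in>tiles X f C n. w \<in> \<tau> \<and> v \<in> \<tau>)" by blast
    qed
  qed
qed

end

section \<open>Visual metrics\<close>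

text \<open>Any two members of the cover are linked by a chain of overlapping members, and a chain can be chosen
with at most as many links as there are pairs of members.\<close>

lemma dist_le_of_connected_cover:
  assumes "Metric_space M d" and V: "connectedin X V" "V \<subseteq> M"
    and Y: "finite Y" "V \<subseteq> (\<Union>y\<in>Y. E y)" "\<And>y. y \<in> Y \<Longrightarrow> openin X (E y)"
    and small: "\<And>y a b. \<lbrakk>y \<in> Y; a \<in> E y \<inter> V; b \<in> E y \<inter> V\<rbrakk> \<Longrightarrow> d a b \<le> \<epsilon>"
    and \<epsilon>: "\<epsilon> \<ge> 0" and ab: "a \<in> V" "b \<in> V"
  shows "d a b \<le> (real (card Y ^ 2) + 1) * \<epsilon>"
proof -
  interpret Metric_space M d by fact
  define r where "r = {(y, y') \<in> Y \<times> Y. E y \<inter> E y' \<inter> V \<noteq> {}}"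
  have rY: "r \<subseteq> Y \<times> Y" by (auto simp: r_def)
  then have fin: "finite r" using Y(1) finite_subset by blast
  have "card r \<le> card (Y \<times> Y)" using rY Y(1) by (intro card_mono) auto
  then have card: "card r \<le> card Y ^ 2" by (simp add: card_cartesian_product power2_eq_square)
  obtain y0 where y0: "y0 \<in> Y" "a \<in> E y0" using ab(1) Y(2) by blast
  obtain y1 where y1: "y1 \<in> Y" "b \<in> E y1" using ab(2) Y(2) by blast
  have chain: "\<forall>y c. (y0, y) \<in> r ^^ n \<and> y \<in> Y \<and> c \<in> E y \<inter> V \<longrightarrow> d a c \<le> (real n + 1) * \<epsilon>" for n
  proof (induction n)
    case 0
    show ?case using small[OF y0(1), of a] y0(2) ab(1) by auto
  next
    case (Suc n)
    show ?case
    proof (intro allI impI)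
      fix y c assume *: "(y0, y) \<in> r ^^ Suc n \<and> y \<in> Y \<and> c \<in> E y \<inter> V"
      then obtain y' where y': "(y0, y') \<in> r ^^ n" "(y', y) \<in> r" by auto
      then obtain e where e: "e \<in> E y' \<inter> E y \<inter> V" "y' \<in> Y" by (auto simp: r_def)
      have "d a e \<le> (real n + 1) * \<epsilon>" using Suc y'(1) e by blast
      moreover have "d e c \<le> \<epsilon>" using small[of y e c] * e by blast
      moreover have "d a c \<le> d a e + d e c" using triangle[of a e c] ab(1) e(1) * V(2) by blast
      ultimately show "d a c \<le> (real (Suc n) + 1) * \<epsilon>" by (simp add: algebra_simps)
    qed
  qed
  define Z where "Z = {y \<in> Y. (y0, y) \<in> r\<^sup>*}"
  have "y1 \<in> Z"
  proof (rule ccontr)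
    assume "y1 \<notin> Z"
    let ?E1 = "\<Union>y\<in>Z. E y" let ?E2 = "\<Union>y\<in>Y - Z. E y"
    have "openin X ?E1" "openin X ?E2" using Y(3) by (auto simp: Z_def)
    moreover have "V \<subseteq> ?E1 \<union> ?E2" using Y(2) by blast
    moreover have "?E1 \<inter> ?E2 \<inter> V = {}"
    proof (rule ccontr)
      assume "?E1 \<inter> ?E2 \<inter> V \<noteq> {}"
      then obtain y y' where "y \<in> Z" "y' \<in> Y - Z" "E y \<inter> E y' \<inter> V \<noteq> {}" by blast
      then have "(y, y') \<in> r" "(y0, y) \<in> r\<^sup>*" by (auto simp: r_def Z_def)
      then have "(y0, y') \<in> r\<^sup>*" by (meson rtrancl.rtrancl_into_rtrancl)
      then show False using \<open>y' \<in> Y - Z\<close> by (simp add: Z_def)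
    qed
    moreover have "?E1 \<inter> V \<noteq> {}" using y0 ab(1) by (auto simp: Z_def)
    moreover have "?E2 \<inter> V \<noteq> {}" using y1 ab(2) \<open>y1 \<notin> Z\<close> by blast
    ultimately show False using V(1) unfolding connectedin by blast
  qed
  then have "(y0, y1) \<in> (\<Union>n\<in>{n. n \<le> card r}. r ^^ n)"
    by (simp add: Z_def rtrancl_finite_eq_relpow[OF fin])
  then obtain n where n: "n \<le> card r" "(y0, y1) \<in> r ^^ n" by blast
  have "d a b \<le> (real n + 1) * \<epsilon>" using chain[of n] n(2) y1 ab(2) by blast
  also have "\<dots> \<le> (real (card Y ^ 2) + 1) * \<epsilon>"
    using n(1) card \<epsilon> by (intro mult_right_mono) auto
  finally show ?thesis .
qed

locale visual_sphere = thurston_curve X A f C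
  for X :: "'a topology" and A :: "('a set \<times> ('a \<Rightarrow> complex)) set" and f :: "'a \<Rightarrow> 'a" and C :: "'a set" +
  fixes d :: "'a \<Rightarrow> 'a \<Rightarrow> real" and \<Lambda> K :: real
  assumes metric: "Metric_space (topspace X) d" and \<Lambda>: "\<Lambda> > 1" and K: "K \<ge> 1"
    and ediam_tile: "\<And>n \<tau>. \<tau> \<in> tiles X f C n \<Longrightarrow> ediam d \<tau> \<le> ennreal (K / \<Lambda> ^ n)"
begin

sublocale Metric_space "topspace X" d by (rule metric)

lemma dist_in_tile:
  assumes "\<tau> \<in> tiles X f C n" "w \<in> \<tau>" "v \<in> \<tau>"
  shows "d w v \<le> K / \<Lambda> ^ n"
proof -
  have "ennreal (d w v) \<le> ediam d \<tau>"
    unfolding ediam_def using assms(2,3) by (meson SUP_upper2 order_refl)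
  also have "\<dots> \<le> ennreal (K / \<Lambda> ^ n)" by (rule ediam_tile[OF assms(1)])
  finally show ?thesis using K \<Lambda> by (simp add: ennreal_le_iff)
qed

lemma small_lifts:
  assumes y: "y \<in> topspace X"
  obtains D where "openin X D" "y \<in> D"
    "\<forall>n S a b. connectedin X S \<and> S \<subseteq> preimg X (f ^^ n) D \<and> a \<in> S \<and> b \<in> S \<longrightarrow> d a b \<le> 2 * K / \<Lambda> ^ n"
    "\<forall>n S a b. connectedin X S \<and> S \<subseteq> preimg X (f ^^ n) D \<and> a \<in> S \<and> b \<in> S \<and> (f ^^ n) a = y
        \<longrightarrow> d a b \<le> K / \<Lambda> ^ n"
proof (rule star_nbhd[OF y])
  fix D assume D: "openin X D" "y \<in> D"
    and star: "\<And>n S. \<lbrakk>connectedin X S; S \<subseteq> preimg X (f ^^ n) D; S \<noteq> {}\<rbrakk> \<Longrightarrow>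
       \<exists>v. (\<forall>x\<in>S. (f ^^ n) x = y \<longrightarrow> x = v) \<and> (\<forall>w\<in>S. \<exists>\<tau>\<in>tiles X f C n. w \<in> \<tau> \<and> v \<in> \<tau>)"
  have centre: "\<exists>v. ((f ^^ n) a = y \<longrightarrow> a = v) \<and> v \<in> topspace X \<and> d a v \<le> K / \<Lambda> ^ n \<and> d v b \<le> K / \<Lambda> ^ n"
    if S: "connectedin X S" "S \<subseteq> preimg X (f ^^ n) D" "a \<in> S" "b \<in> S" for n S a b
  proof -
    have "S \<noteq> {}" using S(3) by blast
    from star[OF S(1,2) this] obtain v where v: "\<forall>x\<in>S. (f ^^ n) x = y \<longrightarrow> x = v"
      "\<forall>w\<in>S. \<exists>\<tau>\<in>tiles X f C n. w \<in> \<tau> \<and> v \<in> \<tau>" by (elim exE conjE)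
    obtain \<tau> where \<tau>: "\<tau> \<in> tiles X f C n" "a \<in> \<tau>" "v \<in> \<tau>" using v(2) S(3) by blast
    obtain \<tau>' where \<tau>': "\<tau>' \<in> tiles X f C n" "b \<in> \<tau>'" "v \<in> \<tau>'" using v(2) S(4) by blast
    obtain x where "\<tau> = X closure_of (tile n x)" using \<tau>(1) unfolding tiles_eq by blast
    then have "\<tau> \<subseteq> topspace X" by (simp add: closure_of_subset_topspace)
    then show ?thesis
      using dist_in_tile[OF \<tau>] dist_in_tile[OF \<tau>'(1,3,2)] v(1) S(3) \<tau>(3) by blast
  qed
  show thesis
  proof (rule that[OF D])
    show "\<forall>n S a b. connectedin X S \<and> S \<subseteq> preimg X (f ^^ n) D \<and> a \<in> S \<and> b \<in> S \<longrightarrow> d a b \<le> 2 * K / \<Lambda> ^ n"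
    proof (intro allI impI)
      fix n S a b assume S: "connectedin X S \<and> S \<subseteq> preimg X (f ^^ n) D \<and> a \<in> S \<and> b \<in> S"
      then obtain v where v: "v \<in> topspace X" "d a v \<le> K / \<Lambda> ^ n" "d v b \<le> K / \<Lambda> ^ n"
        using centre[of S n a b] by blast
      have "a \<in> topspace X" "b \<in> topspace X" using S connectedin_subset_topspace[of X S] by blast+
      then have "d a b \<le> d a v + d v b" using v(1) triangle by blast
      then show "d a b \<le> 2 * K / \<Lambda> ^ n" using v(2,3) by simp
    qed
    show "\<forall>n S a b. connectedin X S \<and> S \<subseteq> preimg X (f ^^ n) D \<and> a \<in> S \<and> b \<in> S \<and> (f ^^ n) a = y
        \<longrightarrow> d a b \<le> K / \<Lambda> ^ n"
    proof (intro allI impI)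
      fix n S a b
      assume S: "connectedin X S \<and> S \<subseteq> preimg X (f ^^ n) D \<and> a \<in> S \<and> b \<in> S \<and> (f ^^ n) a = y"
      then obtain v where "(f ^^ n) a = y \<longrightarrow> a = v" "d v b \<le> K / \<Lambda> ^ n"
        using centre[of S n a b] by blast
      then show "d a b \<le> K / \<Lambda> ^ n" using S by simp
    qed
  qed
qed

lemma eventually_small:
  assumes "\<epsilon> > 0"
  obtains n0 where "\<And>n. n \<ge> n0 \<Longrightarrow> B / \<Lambda> ^ n < \<epsilon>"
proof -
  have "(\<lambda>n. B * inverse (\<Lambda> ^ n)) \<longlonglongrightarrow> B * 0"
    by (intro tendsto_mult tendsto_const LIMSEQ_inverse_realpow_zero \<Lambda>)
  then have "\<forall>\<^sub>F n in sequentially. B / \<Lambda> ^ n < \<epsilon>"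
    using order_tendstoD(2)[of "\<lambda>n. B * inverse (\<Lambda> ^ n)" "B * 0" sequentially \<epsilon>] assms
    by (simp add: divide_inverse)
  then show thesis using that unfolding eventually_sequentially by blast
qed

text \<open>Stars of tiles are neighbourhoods in \<open>X\<close> and small for \<open>d\<close>, so the topology of \<open>d\<close> is coarser than that
of the compact space \<open>X\<close>; as it is Hausdorff, the two agree.\<close>

lemma mtopology_eq: "mtopology = X"
proof -
  have "X = mtopology"
  proof (rule compact_Hausdorff_space_optimal)
    show "topspace X = topspace mtopology" by simp
    show "Hausdorff_space mtopology" by (rule Hausdorff_space_mtopology)
    show "compact_space X" by (rule compact_X)
    fix U assume U: "openin mtopology U"
    show "openin X U"
    proof (subst openin_subopen, intro ballI)
      fix x assume x: "x \<in> U"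
      then obtain r where r: "r > 0" "mball x r \<subseteq> U" using U unfolding openin_mtopology by blast
      have xX: "x \<in> topspace X" using x U unfolding openin_mtopology by blast
      obtain n where n: "K / \<Lambda> ^ n < r" using eventually_small[OF r(1), of K] by blast
      interpret g: finite_open_map X "f ^^ n" by (rule iterate_finite_open_map)
      show "\<exists>T. openin X T \<and> x \<in> T \<and> T \<subseteq> U"
      proof (rule small_lifts[OF g.g_in[OF xX]])
        fix D assume D: "openin X D" "(f ^^ n) x \<in> D"
          and small: "\<forall>m S a b. connectedin X S \<and> S \<subseteq> preimg X (f ^^ m) D \<and> a \<in> S \<and> b \<in> S
            \<and> (f ^^ m) a = (f ^^ n) x \<longrightarrow> d a b \<le> K / \<Lambda> ^ m"
        let ?S = "component X (preimg X (f ^^ n) D) x"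
        have xS: "x \<in> ?S" using D(2) xX by (intro component_refl) auto
        have "?S \<subseteq> mball x r"
        proof
          fix b assume b: "b \<in> ?S"
          have "d x b \<le> K / \<Lambda> ^ n"
            by (rule small[rule_format, of ?S n x b], intro conjI)
              (rule component_connected component_subset xS b refl)+
          then show "b \<in> mball x r" using n xX component_topspaceD[OF b] by simp
        qed
        then show ?thesis using r(2) xS component_open[OF locally_connected_X g.preimg_open[OF D(1)]] by blast
      qed
    qed
  qed
  then show ?thesis by simp
qed

lemma mball_open: "openin X (mball x r)"
  using openin_mball mtopology_eq by metis

text \<open>Cover the sphere by finitely many sets \<open>E\<close>, each inside a set \<open>D\<close> whose connected lifts are small, such
that any two points of \<open>E\<close> in one component of the complement of \<open>C'\<close> are joined by a connected subset of
\<open>D\<close> in that component. Since the iterate is injective on a tile of \<open>C'\<close>, this set lifts into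
the tile. So the part of the tile above each \<open>E\<close> is small, and the number of parts
does not depend on \<open>n\<close>.\<close>

lemma tile_diameter:
  assumes "thurston_curve X A f C'"
  obtains B where "B > 0"
    "\<And>n x a b. \<lbrakk>x \<in> thurston_curve.complement X f C' n; a \<in> X closure_of thurston_curve.tile X f C' n x;
        b \<in> X closure_of thurston_curve.tile X f C' n x\<rbrakk> \<Longrightarrow> d a b \<le> B / \<Lambda> ^ n"
proof -
  interpret C': thurston_curve X A f C' by fact
  let ?U = "topspace X - C'"
  define good where "good E \<longleftrightarrow> (\<exists>D. openin X E \<and> E \<subseteq> D \<and>
      (\<forall>n S a b. connectedin X S \<and> S \<subseteq> preimg X (f ^^ n) D \<and> a \<in> S \<and> b \<in> S \<longrightarrow> d a b \<le> 2 * K / \<Lambda> ^ n) \<and>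
      (\<forall>z a b. z \<in> ?U \<and> a \<in> E \<inter> component X ?U z \<and> b \<in> E \<inter> component X ?U z \<longrightarrow>
          (\<exists>S. connectedin X S \<and> S \<subseteq> D \<inter> component X ?U z \<and> a \<in> S \<and> b \<in> S)))" for E
  have ex: "\<exists>E. y \<in> E \<and> good E" if y: "y \<in> topspace X" for y
  proof (rule small_lifts[OF y])
    fix D assume D: "openin X D" "y \<in> D"
      "\<forall>n S a b. connectedin X S \<and> S \<subseteq> preimg X (f ^^ n) D \<and> a \<in> S \<and> b \<in> S \<longrightarrow> d a b \<le> 2 * K / \<Lambda> ^ n"
    show ?thesis
    proof (rule C'.uniform_local_connectedness[OF D(2,1)])
      fix E assume E: "openin X E" "y \<in> E" "E \<subseteq> D"
        and ulc: "\<And>z a b. \<lbrakk>z \<in> ?U; a \<in> E \<inter> component X ?U z; b \<in> E \<inter> component X ?U z\<rbrakk>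
           \<Longrightarrow> \<exists>S. connectedin X S \<and> S \<subseteq> D \<inter> component X ?U z \<and> a \<in> S \<and> b \<in> S"
      have "good E" unfolding good_def using E D(3) ulc by (intro exI[of _ D]) simp
      then show ?thesis using E(2) by blast
    qed
  qed
  have good_open: "openin X E" if "good E" for E using that by (auto simp: good_def)
  have cpt: "compactin X (topspace X)" using compact_X by (simp add: compact_space_def)
  have "\<exists>\<F>. finite \<F> \<and> \<F> \<subseteq> Collect good \<and> topspace X \<subseteq> \<Union>\<F>"
  proof (rule compactinD[OF cpt])
    show "openin X E" if "E \<in> Collect good" for E using good_open that by simp
    show "topspace X \<subseteq> \<Union>(Collect good)" using ex by blast
  qed
  then obtain \<F> where F: "finite \<F>" "\<F> \<subseteq> Collect good" "topspace X \<subseteq> \<Union>\<F>" by blast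
  define B where "B = (real (card \<F> ^ 2) + 1) * (2 * K)"
  have inner: "d a b \<le> B / \<Lambda> ^ n" if x: "x \<in> C'.complement n" and ab: "a \<in> C'.tile n x" "b \<in> C'.tile n x" for n x a b
  proof -
    interpret g: finite_open_map X "f ^^ n" by (rule iterate_finite_open_map)
    let ?V = "C'.tile n x"
    have VX: "?V \<subseteq> topspace X" by (rule openin_subset[OF C'.tile_open])
    let ?z = "(f ^^ n) x"
    have z: "?z \<in> ?U" using x by (simp add: C'.complement_def)
    have "d a b \<le> (real (card \<F> ^ 2) + 1) * (2 * K / \<Lambda> ^ n)"
    proof (rule dist_le_of_connected_cover[where M = "topspace X" and X = X and V = ?V and E = "preimg X (f ^^ n)"])
      show "connectedin X ?V" unfolding C'.tile_def by (rule component_connected)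
      show "?V \<subseteq> (\<Union>E\<in>\<F>. preimg X (f ^^ n) E)"
      proof
        fix v assume "v \<in> ?V"
        then have v: "v \<in> topspace X" using VX by blast
        obtain E where "E \<in> \<F>" "(f ^^ n) v \<in> E" using F(3) g.g_in[OF v] by blast
        then show "v \<in> (\<Union>E\<in>\<F>. preimg X (f ^^ n) E)" using v by auto
      qed
      show "openin X (preimg X (f ^^ n) E)" if "E \<in> \<F>" for E
        using g.preimg_open good_open F(2) that by blast
      show "2 * K / \<Lambda> ^ n \<ge> 0" using K \<Lambda> by simp
      fix E u v assume E: "E \<in> \<F>" and uv: "u \<in> preimg X (f ^^ n) E \<inter> ?V" "v \<in> preimg X (f ^^ n) E \<inter> ?V"
      have im: "(f ^^ n) ` ?V = component X ?U ?z" by (rule C'.image_tile[OF x])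
      have gE: "(f ^^ n) u \<in> E \<inter> component X ?U ?z" "(f ^^ n) v \<in> E \<inter> component X ?U ?z" using uv im by auto
      have "good E" using E F(2) by blast
      then obtain D where D:
        "\<forall>n S a b. connectedin X S \<and> S \<subseteq> preimg X (f ^^ n) D \<and> a \<in> S \<and> b \<in> S \<longrightarrow> d a b \<le> 2 * K / \<Lambda> ^ n"
        "\<forall>z a b. z \<in> ?U \<and> a \<in> E \<inter> component X ?U z \<and> b \<in> E \<inter> component X ?U z \<longrightarrow>
          (\<exists>S. connectedin X S \<and> S \<subseteq> D \<inter> component X ?U z \<and> a \<in> S \<and> b \<in> S)"
        unfolding good_def by (elim exE conjE)
      obtain S where S: "connectedin X S" "S \<subseteq> D \<inter> component X ?U ?z" "(f ^^ n) u \<in> S" "(f ^^ n) v \<in> S"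
        using D(2)[rule_format, of ?z "(f ^^ n) u" "(f ^^ n) v"] z gE by blast
      have SV: "S \<subseteq> (f ^^ n) ` ?V" using S(2) im by blast
      have con: "connectedin X (?V \<inter> preimg X (f ^^ n) S)"
        by (rule g.connectedin_lift[OF C'.tile_open C'.inj_on_tile[OF x] S(1) SV])
      have sub: "?V \<inter> preimg X (f ^^ n) S \<subseteq> preimg X (f ^^ n) D"
        using preimg_mono[of S D X "f ^^ n"] S(2) by blast
      have "u \<in> ?V \<inter> preimg X (f ^^ n) S" "v \<in> ?V \<inter> preimg X (f ^^ n) S" using uv S(3,4) by auto
      then show "d u v \<le> 2 * K / \<Lambda> ^ n" using D(1) con sub by blast
    qed (rule metric VX F(1) ab)+
    then show ?thesis by (simp add: B_def)
  qed
  have "d a b \<le> B / \<Lambda> ^ n"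
    if x: "x \<in> C'.complement n" and ab: "a \<in> X closure_of C'.tile n x" "b \<in> X closure_of C'.tile n x" for n x a b
  proof (rule field_le_epsilon)
    fix e :: real assume e: "e > 0"
    have approx: "\<exists>c\<in>C'.tile n x. d a c < e / 2" if a: "a \<in> X closure_of C'.tile n x" for a
    proof -
      have "a \<in> topspace X" using a in_closure_of by fast
      then have "a \<in> mball a (e / 2)" using e by simp
      then obtain c where "c \<in> C'.tile n x" "c \<in> mball a (e / 2)"
        using a mball_open[of a "e / 2"] unfolding in_closure_of by blast
      then show ?thesis by auto
    qed
    obtain a' where a': "a' \<in> C'.tile n x" "d a a' < e / 2" using approx[OF ab(1)] by blast
    obtain b' where b': "b' \<in> C'.tile n x" "d b b' < e / 2" using approx[OF ab(2)] by blast
    have X: "a \<in> topspace X" "b \<in> topspace X" "a' \<in> topspace X" "b' \<in> topspace X"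
      using subsetD[OF closure_of_subset_topspace ab(1)] subsetD[OF closure_of_subset_topspace ab(2)]
        subsetD[OF openin_subset[OF C'.tile_open] a'(1)] subsetD[OF openin_subset[OF C'.tile_open] b'(1)]
      by auto
    have "d a b \<le> d a a' + d a' b" by (rule triangle[OF X(1,3,2)])
    also have "d a' b \<le> d a' b' + d b' b" by (rule triangle[OF X(3,4,2)])
    also have "d b' b = d b b'" by (rule commute)
    also have "d a' b' \<le> B / \<Lambda> ^ n" by (rule inner[OF x a'(1) b'(1)])
    finally show "d a b \<le> B / \<Lambda> ^ n + e" using a'(2) b'(2) by simp
  qed
  moreover have "B > 0" unfolding B_def using K by (intro mult_pos_pos add_nonneg_pos) auto
  ultimately show thesis using that by blast
qed

end

section \<open>Markov structure over an invariant curve\<close>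

context thurston_curve
begin

lemma complement_add: "complement (a + b) = preimg X (f ^^ a) (complement b)"
proof -
  interpret g: finite_open_map X "f ^^ a" by (rule iterate_finite_open_map)
  have "(f ^^ (a + b)) x = (f ^^ b) ((f ^^ a) x)" for x
    by (simp add: funpow_add add.commute[of a b])
  then show ?thesis using g.g_in by (auto simp: complement_def)
qed

lemma image_tile_add:
  assumes "x \<in> complement (a + b)"
  shows "(f ^^ a) ` tile (a + b) x = tile b ((f ^^ a) x)"
proof -
  interpret g: finite_open_map X "f ^^ a" by (rule iterate_finite_open_map)
  show ?thesis unfolding tile_def complement_add
    by (rule g.image_component[OF complement_open]) (use assms in \<open>simp add: complement_add\<close>)
qed

lemma tile_eq: "y \<in> tile n x \<Longrightarrow> tile n y = tile n x"
  unfolding tile_def by (rule component_eq)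

lemma tile_subset: "tile n x \<subseteq> complement n"
  unfolding tile_def by (rule component_subset)

lemma tile_eq_lift:
  assumes x: "x \<in> complement n"
  shows "tile n x = component X (preimg X (f ^^ n) (side ((f ^^ n) x))) x"
    (is "_ = component X ?P x")
proof
  have xX: "x \<in> topspace X" using x by (simp add: complement_def)
  have sub: "tile n x \<subseteq> ?P"
  proof
    fix t assume t: "t \<in> tile n x"
    have "(f ^^ n) t \<in> side ((f ^^ n) x)" using image_tile[OF x] t by blast
    moreover have "t \<in> topspace X" using t unfolding tile_def by (rule component_topspaceD)
    ultimately show "t \<in> ?P" by simp
  qed
  show "tile n x \<subseteq> component X ?P x"
    by (rule component_maximal[OF _ sub tile_refl[OF x]]) (simp add: tile_def component_connected)
  have "?P \<subseteq> complement n"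
    unfolding complement_def by (rule preimg_mono[OF component_subset])
  then show "component X ?P x \<subseteq> tile n x" unfolding tile_def by (rule component_mono)
qed

lemma finite_tiles: "finite (tile n ` complement n)"
proof -
  interpret g: finite_open_map X "f ^^ n" by (rule iterate_finite_open_map)
  let ?U = "topspace X - C"
  obtain I where I: "finite I" "I \<subseteq> ?U" "\<forall>z\<in>?U. \<exists>i\<in>I. side z = side i"
    by (rule finite_component_representatives)
  have "tile n ` complement n \<subseteq> (\<Union>i\<in>I. component X (preimg X (f ^^ n) (side i)) ` preimg X (f ^^ n) (side i))"
  proof
    fix V assume "V \<in> tile n ` complement n"
    then obtain x where x: "x \<in> complement n" "V = tile n x" by blast
    have xX: "x \<in> topspace X" and zU: "(f ^^ n) x \<in> ?U" using x(1) by (simp_all add: complement_def)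
    obtain i where i: "i \<in> I" "side ((f ^^ n) x) = side i" using I(3) zU by metis
    have "V = component X (preimg X (f ^^ n) (side i)) x" using tile_eq_lift[OF x(1)] x(2) i(2) by simp
    moreover have "x \<in> preimg X (f ^^ n) (side i)"
      using component_refl[OF zU g.g_in[OF xX]] i(2) xX by simp
    ultimately show "V \<in> (\<Union>i\<in>I. component X (preimg X (f ^^ n) (side i)) ` preimg X (f ^^ n) (side i))"
      using i(1) by blast
  qed
  moreover have "finite (\<Union>i\<in>I. component X (preimg X (f ^^ n) (side i)) ` preimg X (f ^^ n) (side i))"
    by (intro finite_UN_I I(1) g.finite_component_preimg component_open locally_connected_X compl_open component_connected)
  ultimately show ?thesis by (rule finite_subset)
qed

lemma in_closure_tile:
  assumes w: "w \<in> topspace X"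
  obtains x where "x \<in> complement n" "w \<in> X closure_of (tile n x)"
proof -
  interpret g: finite_open_map X "f ^^ n" by (rule iterate_finite_open_map)
  let ?U = "topspace X - C"
  obtain z where z: "z \<in> ?U" "(f ^^ n) w \<in> X closure_of (side z)"
    by (rule in_closure_component[OF g.g_in[OF w]])
  have O': "openin X (side z)" "connectedin X (side z)"
    by (rule component_open[OF locally_connected_X compl_open], rule component_connected)
  obtain u where u: "u \<in> preimg X (f ^^ n) (side z)"
    "w \<in> X closure_of (component X (preimg X (f ^^ n) (side z)) u)"
    by (rule g.in_closure_component_preimg[OF O' w z(2)])
  have gu: "(f ^^ n) u \<in> side z" and uX: "u \<in> topspace X" using u(1) by auto
  have uc: "u \<in> complement n" using uX component_memD[OF gu] by (simp add: complement_def)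
  have "tile n u = component X (preimg X (f ^^ n) (side z)) u"
    using tile_eq_lift[OF uc] component_eq[OF gu] by simp
  then show thesis using that[OF uc] u(2) by simp
qed

lemma image_closure_tile:
  "(f ^^ a) ` (X closure_of S) \<subseteq> X closure_of ((f ^^ a) ` S)"
proof -
  interpret g: finite_open_map X "f ^^ a" by (rule iterate_finite_open_map)
  show ?thesis by (rule continuous_map_image_closure_subset[OF g.cont])
qed

end

locale invariant_curve = thurston_curve X A f C
  for X :: "'a topology" and A :: "('a set \<times> ('a \<Rightarrow> complex)) set" and f :: "'a \<Rightarrow> 'a" and C :: "'a set" +
  fixes m :: nat
  assumes m: "m \<ge> 1" and invariant: "(f ^^ m) ` C \<subseteq> C"
begin

abbreviation F :: "nat \<Rightarrow> 'a \<Rightarrow> 'a" where "F n \<equiv> f ^^ (m * n)"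

lemma F_add: "F (a + b) x = F b (F a x)"
proof -
  have "F (a + b) x = (f ^^ (m * b + m * a)) x" by (simp add: distrib_left add.commute)
  then show ?thesis by (simp only: funpow_add o_apply)
qed

lemma F_add_image: "F (a + b) ` S = F b ` F a ` S"
  unfolding image_image by (rule image_cong[OF refl F_add])

lemma F_invariant: "x \<in> C \<Longrightarrow> F k x \<in> C"
proof (induction k)
  case (Suc k)
  have "F (k + 1) x = (f ^^ m) (F k x)" using F_add[of k 1 x] by simp
  then show ?case using invariant Suc by auto
qed simp

definition iterate_tiles :: "nat \<Rightarrow> 'a set set" where
  "iterate_tiles n = tile (m * n) ` complement (m * n)"

lemma complement_antimono: "complement (m * (n + k)) \<subseteq> complement (m * n)"
proof
  fix x assume x: "x \<in> complement (m * (n + k))"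
  have "F n x \<notin> C"
  proof
    assume "F n x \<in> C"
    then have "F (n + k) x \<in> C" using F_invariant[of "F n x" k] by (simp only: F_add)
    then show False using x by (simp add: complement_def)
  qed
  moreover have "x \<in> topspace X" using x by (simp add: complement_def)
  ultimately show "x \<in> complement (m * n)"
    unfolding complement_eq iter_preimage_eq_preimg by simp
qed

lemma tile_antimono: "tile (m * (n + k)) x \<subseteq> tile (m * n) x"
  unfolding tile_def by (rule component_mono[OF complement_antimono])

lemma iterate_tiles_nonempty: "V \<in> iterate_tiles n \<Longrightarrow> V \<noteq> {}"
  unfolding iterate_tiles_def using tile_refl by blast

lemma iterate_tiles_tile: "\<lbrakk>V \<in> iterate_tiles n; x \<in> V\<rbrakk> \<Longrightarrow> V = tile (m * n) x \<and> x \<in> complement (m * n)"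
  unfolding iterate_tiles_def using tile_eq tile_subset by blast

lemma iterate_tiles_eqI: "\<lbrakk>V \<in> iterate_tiles n; W \<in> iterate_tiles n; x \<in> V; x \<in> W\<rbrakk> \<Longrightarrow> V = W"
  using iterate_tiles_tile by metis

definition ancestor :: "nat \<Rightarrow> 'a set \<Rightarrow> 'a set" where
  "ancestor n V = tile (m * n) (SOME x. x \<in> V)"

lemma ancestor:
  assumes V: "V \<in> iterate_tiles (n + k)"
  shows "V \<subseteq> ancestor n V" "ancestor n V \<in> iterate_tiles n"
proof -
  have x: "(SOME x. x \<in> V) \<in> V" using iterate_tiles_nonempty[OF V] by (simp add: some_in_eq)
  note t = iterate_tiles_tile[OF V x]
  show "V \<subseteq> ancestor n V"
    unfolding ancestor_def using t tile_antimono[of n k "SOME x. x \<in> V"] by simp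
  show "ancestor n V \<in> iterate_tiles n"
    unfolding ancestor_def iterate_tiles_def using t complement_antimono[of n k] by blast
qed

lemma ancestor_eqI:
  assumes V: "V \<in> iterate_tiles (n + k)" and T: "T \<in> iterate_tiles n" "V \<subseteq> T"
  shows "ancestor n V = T"
proof -
  obtain x where "x \<in> V" using iterate_tiles_nonempty[OF V] by blast
  then show ?thesis using iterate_tiles_eqI[OF ancestor(2)[OF V] T(1)] ancestor(1)[OF V] T(2) by blast
qed

lemma image_iterate_tile:
  assumes V: "V \<in> iterate_tiles (n + k)"
  shows "F n ` V \<in> iterate_tiles k"
proof -
  obtain x where x: "x \<in> complement (m * n + m * k)" "V = tile (m * n + m * k) x"
    using V unfolding iterate_tiles_def by (auto simp: distrib_left)
  have "F n ` V = tile (m * k) (F n x)" unfolding x(2) by (rule image_tile_add[OF x(1)])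
  moreover have "F n x \<in> complement (m * k)" using x(1) by (simp add: complement_add)
  ultimately show ?thesis unfolding iterate_tiles_def by blast
qed

text \<open>The iterate \<open>F n\<close> is injective on the common ancestor.\<close>

lemma iterate_tile_determined:
  assumes V: "V \<in> iterate_tiles (n + k)" and W: "W \<in> iterate_tiles (n + k)"
    and anc: "ancestor n V = ancestor n W" and im: "F n ` V = F n ` W"
  shows "V = W"
proof -
  have sub: "V \<subseteq> W" if V: "V \<in> iterate_tiles (n + k)" and W: "W \<in> iterate_tiles (n + k)"
    and anc: "ancestor n V = ancestor n W" and im: "F n ` V = F n ` W" for V W
  proof
    fix v assume v: "v \<in> V"
    then obtain w where w: "w \<in> W" "F n v = F n w" using im by blast
    have a: "v \<in> ancestor n V" "w \<in> ancestor n V" using ancestor(1)[OF V] ancestor(1)[OF W] v w(1) anc by auto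
    note t = iterate_tiles_tile[OF ancestor(2)[OF V] a(1)]
    have "inj_on (F n) (ancestor n V)" using inj_on_tile[of v "m * n"] t by metis
    then have "v = w" using inj_onD w(2) a by metis
    then show "v \<in> W" using w(1) by simp
  qed
  show ?thesis using sub[OF V W anc im] sub[OF W V anc[symmetric] im[symmetric]] by blast
qed

text \<open>Take the tile of level \<open>n + k + l\<close> around any preimage in \<open>Z\<close> of a point of \<open>Q\<close>.\<close>

lemma pullback_iterate_tile:
  assumes Z: "Z \<in> iterate_tiles (n + k)" and Q: "Q \<in> iterate_tiles (k + l)" "Q \<subseteq> F n ` Z"
  obtains Q' where "Q' \<in> iterate_tiles (n + k + l)" "Q' \<subseteq> Z" "F n ` Q' = Q"
proof -
  obtain q where q: "q \<in> Q" using iterate_tiles_nonempty[OF Q(1)] by blast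
  then obtain z where z: "z \<in> Z" "F n z = q" using Q(2) by blast
  note tq = iterate_tiles_tile[OF Q(1) q]
  note tz = iterate_tiles_tile[OF Z z(1)]
  have zX: "z \<in> topspace X" using tz by (simp add: complement_def)
  have lev: "m * (n + k + l) = m * n + m * (k + l)" by (simp add: algebra_simps)
  have zc: "z \<in> complement (m * n + m * (k + l))" using tq z(2) zX by (simp add: complement_add)
  let ?Q = "tile (m * (n + k + l)) z"
  have "?Q \<in> iterate_tiles (n + k + l)" unfolding iterate_tiles_def using zc lev by auto
  moreover have "?Q \<subseteq> Z" using tile_antimono[of "n + k" l z] tz by simp
  moreover have "F n ` ?Q = Q" using image_tile_add[OF zc] tq z(2) by (simp add: lev)
  ultimately show thesis by (rule that)
qed

end

locale invariant_compact = invariant_curve X A f C m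
  for X :: "'a topology" and A :: "('a set \<times> ('a \<Rightarrow> complex)) set" and f :: "'a \<Rightarrow> 'a" and C :: "'a set"
    and m :: nat +
  fixes Q :: "'a set"
  assumes Q: "Q \<subseteq> topspace X" "Q \<noteq> {}" and Q_invariant: "f ` Q \<subseteq> Q"
begin

lemma Q_iter: "x \<in> Q \<Longrightarrow> (f ^^ n) x \<in> Q"
  using Q_invariant by (induction n) auto

text \<open>Closures are needed here, since the invariant set may lie inside the preimages of \<open>C\<close>.\<close>

definition touching :: "nat \<Rightarrow> 'a set set" where
  "touching n = {V \<in> iterate_tiles n. X closure_of V \<inter> Q \<noteq> {}}"

lemma touching_tile: "V \<in> touching n \<Longrightarrow> V \<in> iterate_tiles n"
  by (simp add: touching_def)

lemma finite_touching: "finite (touching n)"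
  unfolding touching_def iterate_tiles_def using finite_tiles by simp

lemma touching_nonempty: "touching n \<noteq> {}"
proof -
  obtain w where w: "w \<in> Q" using Q(2) by blast
  then have "w \<in> topspace X" using Q(1) by blast
  then obtain x where "x \<in> complement (m * n)" "w \<in> X closure_of (tile (m * n) x)"
    by (rule in_closure_tile)
  then have "tile (m * n) x \<in> touching n" using w unfolding touching_def iterate_tiles_def by blast
  then show ?thesis by blast
qed

lemma touching_ancestor:
  assumes "V \<in> touching (n + k)"
  shows "ancestor n V \<in> touching n"
proof -
  note V = touching_tile[OF assms]
  have "X closure_of V \<subseteq> X closure_of (ancestor n V)" by (rule closure_of_mono[OF ancestor(1)[OF V]])
  then show ?thesis using assms ancestor(2)[OF V] unfolding touching_def by blast
qed

lemma touching_image: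
  assumes "V \<in> touching (n + k)"
  shows "F n ` V \<in> touching k"
proof -
  note V = touching_tile[OF assms]
  obtain x where x: "x \<in> X closure_of V" "x \<in> Q" using assms unfolding touching_def by blast
  have "F n x \<in> X closure_of (F n ` V)" using image_closure_tile[of "m * n" V] x(1) by blast
  then show ?thesis using image_iterate_tile[OF V] Q_iter[OF x(2)] unfolding touching_def by blast
qed

definition tile_count :: "nat \<Rightarrow> nat" where "tile_count n = card (touching n)"

lemma tile_count_pos: "tile_count n \<ge> 1"
  unfolding tile_count_def using finite_touching touching_nonempty
  by (simp add: Suc_le_eq card_gt_0_iff)

lemma tile_count_submultiplicative: "tile_count (n + k) \<le> tile_count n * tile_count k"
proof -
  have "inj_on (\<lambda>V. (ancestor n V, F n ` V)) (touching (n + k))"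
    by (rule inj_onI) (use iterate_tile_determined touching_tile in blast)
  moreover have "(\<lambda>V. (ancestor n V, F n ` V)) ` touching (n + k) \<subseteq> touching n \<times> touching k"
    using touching_ancestor touching_image by blast
  ultimately have "card (touching (n + k)) \<le> card (touching n \<times> touching k)"
    by (rule card_inj_on_le) (intro finite_cartesian_product finite_touching)
  then show ?thesis unfolding tile_count_def by (simp add: card_cartesian_product)
qed

text \<open>The tile \<open>Z\<close> of level \<open>2 * n\<close> plays the role of a word of length \<open>2 * n\<close> with first half \<open>T\<close> and second
half \<open>T'\<close>; it touches the invariant set.\<close>

definition successor :: "nat \<Rightarrow> ('a set \<times> 'a set) set" where
  "successor n = {(T, T'). T \<in> touching n \<and> T' \<in> touching n \<and>
      (\<exists>Z\<in>touching (n + n). Z \<subseteq> T \<and> F n ` Z = T')}"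

lemma itinerary_walk:
  assumes V: "V \<in> touching (s * n)"
  shows "walk (successor n) s (\<lambda>j. ancestor n (F (j * n) ` V))"
  unfolding walk_def
proof (intro allI impI)
  fix j assume j: "Suc j < s"
  define k where "k = s - Suc (Suc j)"
  have s: "s * n = j * n + (n + n + k * n)"
  proof -
    have "s = j + 2 + k" using j by (simp add: k_def)
    then show ?thesis by (simp add: algebra_simps)
  qed
  define W where "W = F (j * n) ` V"
  have W: "W \<in> touching (n + n + k * n)"
    unfolding W_def by (rule touching_image) (use V s in simp)
  then have W': "W \<in> touching (n + (n + k * n))" by (simp add: add.assoc)
  have next': "F (Suc j * n) ` V = F n ` W"
    unfolding W_def F_add_image[symmetric] by (simp add: add.commute)
  have FW: "F n ` W \<in> touching (n + k * n)" by (rule touching_image[OF W'])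
  define Z where "Z = ancestor (n + n) W"
  have Z: "Z \<in> touching (n + n)" "W \<subseteq> Z"
    unfolding Z_def by (rule touching_ancestor[OF W], rule ancestor(1)[OF touching_tile[OF W]])
  have "ancestor n W = ancestor n Z"
    by (rule ancestor_eqI[OF touching_tile[OF W'] ancestor(2)[OF touching_tile[OF Z(1)]]])
      (use Z(2) ancestor(1)[OF touching_tile[OF Z(1)]] in blast)
  then have "Z \<subseteq> ancestor n W" using ancestor(1)[OF touching_tile[OF Z(1)]] by simp
  moreover have "ancestor n (F n ` W) = F n ` Z"
    by (rule ancestor_eqI[OF touching_tile[OF FW] image_iterate_tile[OF touching_tile[OF Z(1)]]])
      (use Z(2) in blast)
  moreover have "ancestor n W \<in> touching n" "ancestor n (F n ` W) \<in> touching n"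
    by (rule touching_ancestor[OF W'], rule touching_ancestor[OF FW])
  ultimately show "(ancestor n (F (j * n) ` V), ancestor n (F (Suc j * n) ` V)) \<in> successor n"
    using Z(1) unfolding successor_def next' W_def[symmetric] by auto
qed

text \<open>The level is a positive multiple of \<open>n\<close>: a tile of level \<open>0\<close> is not determined by an empty itinerary.\<close>

lemma itinerary_determines_tile:
  assumes "V \<in> iterate_tiles (Suc s * n)" "W \<in> iterate_tiles (Suc s * n)"
    and "\<forall>j<Suc s. ancestor n (F (j * n) ` V) = ancestor n (F (j * n) ` W)"
  shows "V = W"
  using assms
proof (induction s arbitrary: V W)
  case 0
  have self: "ancestor n T = T" if "T \<in> iterate_tiles (Suc 0 * n)" for T
    using that by (intro ancestor_eqI[of T n 0 T]) simp_all
  have "ancestor n (F (0 * n) ` V) = ancestor n (F (0 * n) ` W)" using 0(3) by blast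
  then have "ancestor n V = ancestor n W" by simp
  then show ?case unfolding self[OF 0(1)] self[OF 0(2)] .
next
  case (Suc s)
  have V: "V \<in> iterate_tiles (n + Suc s * n)" "W \<in> iterate_tiles (n + Suc s * n)"
    using Suc.prems(1,2) by (simp_all only: mult_Suc)
  have "F n ` V = F n ` W"
  proof (rule Suc.IH)
    show "F n ` V \<in> iterate_tiles (Suc s * n)" "F n ` W \<in> iterate_tiles (Suc s * n)"
      using image_iterate_tile V by blast+
    show "\<forall>j<Suc s. ancestor n (F (j * n) ` F n ` V) = ancestor n (F (j * n) ` F n ` W)"
    proof (intro allI impI)
      fix j assume "j < Suc s"
      then have "ancestor n (F (Suc j * n) ` V) = ancestor n (F (Suc j * n) ` W)" using Suc.prems(3) by blast
      then show "ancestor n (F (j * n) ` F n ` V) = ancestor n (F (j * n) ` F n ` W)"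
        by (simp only: mult_Suc F_add_image)
    qed
  qed
  moreover have "ancestor n V = ancestor n W" using Suc.prems(3)[rule_format, of 0] by simp
  ultimately show ?case using iterate_tile_determined[OF V] by blast
qed

lemma short_closed_walk:
  assumes "\<delta> > 0"
  obtains n0 where "\<And>n s. \<lbrakk>n \<ge> n0; real s > exp (1 + \<delta> * real n)\<rbrakk> \<Longrightarrow> \<not> no_closed_walk (successor n) s"
proof -
  obtain n0 where n0: "\<And>n s. \<lbrakk>n \<ge> n0; tile_count (s * n) \<le> tile_count n choose s\<rbrakk>
      \<Longrightarrow> real s \<le> exp (1 + \<delta> * real n)"
    using binomial_growth_bound[OF tile_count_pos tile_count_submultiplicative assms] by blast
  show thesis
  proof (rule that)
    fix n s assume n: "n \<ge> n0" and s: "real s > exp (1 + \<delta> * real n)"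
    show "\<not> no_closed_walk (successor n) s"
    proof
      assume nc: "no_closed_walk (successor n) s"
      have "s \<noteq> 0" using s by (metis exp_ge_zero not_le of_nat_0)
      then obtain t where t: "s = Suc t" using not0_implies_Suc by blast
      have "card (touching (s * n)) \<le> card (touching n) choose s"
      proof (rule card_walks_le[OF nc finite_touching, where w = "\<lambda>V j. ancestor n (F (j * n) ` V)"])
        show "walk (successor n) s (\<lambda>j. ancestor n (F (j * n) ` V))" if "V \<in> touching (s * n)" for V
          by (rule itinerary_walk[OF that])
        show "ancestor n (F (j * n) ` V) \<in> touching n" if "V \<in> touching (s * n)" "j < s" for V j
        proof -
          have "s * n = j * n + (n + (s - Suc j) * n)"
          proof -
            have "s = j + 1 + (s - Suc j)" using that(2) by simp
            then show ?thesis by (metis add.assoc add_mult_distrib mult_1)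
          qed
          then have "F (j * n) ` V \<in> touching (n + (s - Suc j) * n)"
            using that(1) by (intro touching_image) simp
          then show ?thesis by (rule touching_ancestor)
        qed
        show "V = W" if "V \<in> touching (s * n)" "W \<in> touching (s * n)"
          "\<forall>j<s. ancestor n (F (j * n) ` V) = ancestor n (F (j * n) ` W)" for V W
          using itinerary_determines_tile[of V t n W] that touching_tile t by blast
      qed
      then have "tile_count (s * n) \<le> tile_count n choose s" by (simp add: tile_count_def)
      then show False using n0[OF n] s by fastforce
    qed
  qed
qed

end

section \<open>Periodic orbits from closed walks\<close>

context invariant_compact
begin

text \<open>The walk is traversed backwards: a tile inside \<open>c (Suc i)\<close> has a pullback inside \<open>Z i\<close>, because
\<open>F n\<close> maps \<open>Z i\<close> onto \<open>c (Suc i)\<close>.\<close>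

lemma pullback_along_walk:
  assumes start: "T \<in> iterate_tiles n" "c l = T"
    and Z: "\<And>i. i < l \<Longrightarrow> Z i \<in> iterate_tiles (n + n) \<and> Z i \<subseteq> c i \<and> F n ` Z i = c (Suc i)"
    and "k \<le> l"
  shows "\<exists>V\<in>iterate_tiles (n + k * n). V \<subseteq> c (l - k) \<and> F (k * n) ` V = T \<and>
           (\<forall>i<k. F (i * n) ` V \<subseteq> Z (l - k + i))"
  using \<open>k \<le> l\<close>
proof (induction k)
  case 0
  then show ?case using start by simp
next
  case (Suc k)
  let ?j = "l - Suc k"
  have j: "?j < l" "Suc ?j = l - k" using Suc.prems by auto
  obtain V where V: "V \<in> iterate_tiles (n + k * n)" "V \<subseteq> c (l - k)" "F (k * n) ` V = T"
    "\<forall>i<k. F (i * n) ` V \<subseteq> Z (l - k + i)"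
    using Suc by auto
  have "V \<subseteq> F n ` Z ?j" using V(2) Z[OF j(1)] j(2) by simp
  then obtain V' where V': "V' \<in> iterate_tiles (n + n + k * n)" "V' \<subseteq> Z ?j" "F n ` V' = V"
    using pullback_iterate_tile[of "Z ?j" n n V "k * n"] Z[OF j(1)] V(1) by blast
  have im: "F (Suc i * n) ` V' = F (i * n) ` V" for i
    unfolding V'(3)[symmetric] F_add_image[symmetric] by simp
  have "F (i * n) ` V' \<subseteq> Z (?j + i)" if "i < Suc k" for i
  proof (cases i)
    case 0
    then show ?thesis using V'(2) by simp
  next
    case (Suc i')
    have idx: "?j + Suc i' = l - k + i'" using j by simp
    have "i' < k" using Suc that by simp
    then have "F (i' * n) ` V \<subseteq> Z (l - k + i')" using V(4) by blast
    then show ?thesis unfolding Suc idx im .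
  qed
  moreover have "V' \<in> iterate_tiles (n + Suc k * n)" using V'(1) by (simp add: add.assoc)
  moreover have "V' \<subseteq> c ?j" using V'(2) Z[OF j(1)] by blast
  moreover have "F (Suc k * n) ` V' = T" using im[of k] V(3) by simp
  ultimately show ?case by blast
qed

text \<open>The pair \<open>(T, V)\<close> is continued by pulling back repeatedly within the previous tile.\<close>

lemma nested_tiles:
  assumes T: "T \<in> iterate_tiles n" and V: "V \<in> iterate_tiles (n + r)" "V \<subseteq> T" "F r ` V = T"
  obtains D where "D 0 = T" "D 1 = V" "\<And>k. D k \<in> iterate_tiles (n + k * r)" "\<And>k. D (Suc k) \<subseteq> D k"
    "\<And>k. F r ` D (Suc k) = D k"
proof -
  define good where "good k p \<longleftrightarrow> fst p \<in> iterate_tiles (n + k * r) \<and> snd p \<in> iterate_tiles (n + Suc k * r) \<and>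
      snd p \<subseteq> fst p \<and> F r ` snd p = fst p \<and> (k = 0 \<longrightarrow> p = (T, V))" for k :: nat and p
  have "\<exists>a. \<forall>k. good k (a k) \<and> fst (a (Suc k)) = snd (a k)"
  proof (rule dependent_nat_choice)
    show "\<exists>p. good 0 p" using T V by (intro exI[of _ "(T, V)"]) (simp add: good_def)
    fix p k assume p: "good k p"
    have lev: "n + Suc k * r = r + (n + k * r)" "n + Suc (Suc k) * r = r + (n + k * r) + r"
      by simp_all
    have "snd p \<in> iterate_tiles (r + (n + k * r))" using p unfolding good_def lev by blast
    moreover have "snd p \<in> iterate_tiles ((n + k * r) + r)" using p by (simp add: good_def ac_simps)
    moreover have "snd p \<subseteq> F r ` snd p" using p by (simp add: good_def)
    ultimately obtain B where B: "B \<in> iterate_tiles (r + (n + k * r) + r)" "B \<subseteq> snd p" "F r ` B = snd p"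
      by (rule pullback_iterate_tile)
    have "good (Suc k) (snd p, B)"
      using p B unfolding good_def lev(2)[symmetric] by simp
    then show "\<exists>q. good (Suc k) q \<and> fst q = snd p" by (intro exI[of _ "(snd p, B)"]) simp
  qed
  then obtain a where a: "\<And>k. good k (a k)" "\<And>k. fst (a (Suc k)) = snd (a k)" by blast
  show thesis
  proof
    show "fst (a 0) = T" using a(1)[of 0] by (simp add: good_def)
    show "fst (a 1) = V" using a(1)[of 0] a(2)[of 0] by (simp add: good_def)
    fix k
    show "fst (a k) \<in> iterate_tiles (n + k * r)" using a(1)[of k] by (simp add: good_def)
    show "fst (a (Suc k)) \<subseteq> fst (a k)" using a(1)[of k] a(2)[of k] by (simp add: good_def)
    show "F r ` fst (a (Suc k)) = fst (a k)" using a(1)[of k] a(2)[of k] by (simp add: good_def)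
  qed
qed

text \<open>The tile \<open>c 0\<close> is pulled back once around the closed walk and then again and again. The closures
of the nested tiles that arise meet in one point \<open>z\<close>, which \<open>F (l * n)\<close> fixes. At time \<open>m * i * n + t\<close> with
\<open>t < m * n\<close> the orbit of \<open>z\<close> lies in the image under \<open>f ^^ t\<close> of the closure of the tile \<open>Z i\<close>, which has level
\<open>2 * m * n - t \<ge> m * n\<close> for \<open>f\<close> and touches the invariant set.\<close>

lemma periodic_point_of_closed_walk:
  assumes metric: "Metric_space (topspace X) d" and \<Lambda>: "\<Lambda> > 1" and B: "B > 0"
    and diam: "\<And>n x a b. \<lbrakk>x \<in> complement n; a \<in> X closure_of tile n x; b \<in> X closure_of tile n x\<rbrakk>
        \<Longrightarrow> d a b \<le> B / \<Lambda> ^ n"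
    and l: "l \<ge> 1" and n: "n \<ge> 1"
    and c: "\<And>i. i < l \<Longrightarrow> (c i, c (Suc i)) \<in> successor n" "c l = c 0"
  obtains z where "z \<in> topspace X" "F (l * n) z = z"
    "\<forall>q. \<exists>x\<in>Q. d ((f ^^ q) z) x \<le> B / \<Lambda> ^ (m * n)"
proof -
  interpret Metric_space "topspace X" d by (rule metric)
  have tile_diam: "d a b \<le> B / \<Lambda> ^ (m * k)"
    if "V \<in> iterate_tiles k" "a \<in> X closure_of V" "b \<in> X closure_of V" for V k a b
    using that diam unfolding iterate_tiles_def by blast
  have "\<exists>Z. \<forall>i<l. Z i \<in> touching (n + n) \<and> Z i \<subseteq> c i \<and> F n ` Z i = c (Suc i)"
  proof -
    have "\<forall>i. \<exists>Y. i < l \<longrightarrow> Y \<in> touching (n + n) \<and> Y \<subseteq> c i \<and> F n ` Y = c (Suc i)"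
    proof
      fix i
      show "\<exists>Y. i < l \<longrightarrow> Y \<in> touching (n + n) \<and> Y \<subseteq> c i \<and> F n ` Y = c (Suc i)"
      proof (cases "i < l")
        case True
        then show ?thesis using c(1)[OF True] unfolding successor_def by auto
      qed simp
    qed
    from choice[OF this] show ?thesis by (elim exE) blast
  qed
  then obtain Z where Z: "\<forall>i<l. Z i \<in> touching (n + n) \<and> Z i \<subseteq> c i \<and> F n ` Z i = c (Suc i)"
    by (rule exE)
  have c0: "c 0 \<in> iterate_tiles n" using c(1)[of 0] l touching_tile unfolding successor_def by auto
  have "\<exists>V\<in>iterate_tiles (n + l * n). V \<subseteq> c (l - l) \<and> F (l * n) ` V = c 0 \<and>
           (\<forall>i<l. F (i * n) ` V \<subseteq> Z (l - l + i))"
    by (rule pullback_along_walk[where c = c and Z = Z, OF c0 c(2) _ order_refl])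
      (use Z touching_tile in blast)
  then obtain V where V: "V \<in> iterate_tiles (n + l * n)" "V \<subseteq> c 0" "F (l * n) ` V = c 0"
    "\<forall>i<l. F (i * n) ` V \<subseteq> Z i" by auto
  obtain D where D: "D 0 = c 0" "D 1 = V" "\<And>k. D k \<in> iterate_tiles (n + k * (l * n))"
    "\<And>k. D (Suc k) \<subseteq> D k" "\<And>k. F (l * n) ` D (Suc k) = D k"
    using nested_tiles[OF c0 V(1-3)] by metis
  have DX: "D k \<subseteq> topspace X" for k
    using D(3)[of k] openin_subset[OF tile_open] unfolding iterate_tiles_def by blast
  have "(\<Inter>k. X closure_of D k) \<noteq> {}"
  proof (rule compact_space_imp_nest[OF compact_X])
    show "closedin X (X closure_of D k)" for k by simp
    show "X closure_of D k \<noteq> {}" for k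
      using iterate_tiles_nonempty[OF D(3)[of k]] closure_of_subset[OF DX[of k]] by blast
    show "decseq (\<lambda>k. X closure_of D k)"
      unfolding decseq_Suc_iff by (intro allI closure_of_mono D(4))
  qed
  then obtain z where z: "\<And>k. z \<in> X closure_of D k" by blast
  have zX: "z \<in> topspace X" using subsetD[OF closure_of_subset_topspace z] .
  let ?G = "F (l * n)"
  have Gz: "?G z \<in> X closure_of D k" for k
    using image_closure_tile[of "m * (l * n)" "D (Suc k)"] z[of "Suc k"] D(5)[of k] by auto
  have "?G z \<in> topspace X" using subsetD[OF closure_of_subset_topspace Gz] .
  moreover have "d (?G z) z \<le> 0"
  proof (rule LIMSEQ_le_const)
    have "(\<lambda>k. B * inverse (\<Lambda> ^ k)) \<longlonglongrightarrow> B * 0"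
      by (intro tendsto_mult tendsto_const LIMSEQ_inverse_realpow_zero \<Lambda>)
    then show "(\<lambda>k. B / \<Lambda> ^ k) \<longlonglongrightarrow> 0" by (simp add: divide_inverse)
    have "d (?G z) z \<le> B / \<Lambda> ^ k" for k
    proof -
      have "d (?G z) z \<le> B / \<Lambda> ^ (m * (n + k * (l * n)))"
        by (rule tile_diam[OF D(3) Gz z])
      also have "\<dots> \<le> B / \<Lambda> ^ k"
      proof (rule divide_left_mono)
        have "1 * 1 \<le> l * n" using l n by (rule mult_le_mono)
        then have "k * 1 \<le> k * (l * n)" by (intro mult_le_mono2) simp
        then have "k \<le> n + k * (l * n)" unfolding mult_1_right by (rule trans_le_add2)
        also have "\<dots> \<le> m * (n + k * (l * n))" using m by simp
        finally show "\<Lambda> ^ k \<le> \<Lambda> ^ (m * (n + k * (l * n)))" using \<Lambda> by (intro power_increasing) auto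
      qed (use B \<Lambda> in auto)
      finally show ?thesis .
    qed
    then show "\<exists>N. \<forall>k\<ge>N. d (?G z) z \<le> B / \<Lambda> ^ k" by blast
  qed
  ultimately have fixed: "?G z = z" using zX nonneg[of "?G z" z] zero[of "?G z" z] by simp
  have near: "\<exists>x\<in>Q. d ((f ^^ q) z) x \<le> B / \<Lambda> ^ (m * n)" if q: "q < m * (l * n)" for q
  proof -
    define i t where "i = q div (m * n)" and "t = q mod (m * n)"
    have mn: "m * n > 0" using m n by simp
    have qi: "q = m * (i * n) + t" unfolding i_def t_def by (metis div_mult_mod_eq mult.assoc mult.commute)
    have t: "t < m * n" unfolding t_def using mn by simp
    have i: "i < l"
    proof -
      have "q < l * (m * n)" using q by (simp add: ac_simps)
      then show ?thesis unfolding i_def by (simp add: less_mult_imp_div_less)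
    qed
    have Zi: "Z i \<in> touching (n + n)" "F (i * n) ` V \<subseteq> Z i" using Z V(4) i by auto
    have "F (i * n) z \<in> X closure_of (F (i * n) ` V)"
      using image_closure_tile[of "m * (i * n)" V] z[of 1] D(2) by auto
    then have zi: "F (i * n) z \<in> X closure_of (Z i)" using closure_of_mono[OF Zi(2)] by blast
    obtain x where x: "x \<in> X closure_of (Z i)" "x \<in> Q" using Zi(1) unfolding touching_def by blast
    obtain u where u: "u \<in> complement (m * (n + n))" "Z i = tile (m * (n + n)) u"
      using touching_tile[OF Zi(1)] unfolding iterate_tiles_def by blast
    define b where "b = m * (n + n) - t"
    have b: "m * (n + n) = t + b" "m * n \<le> b" using t by (auto simp: b_def distrib_left)
    have im: "(f ^^ t) ` Z i = tile b ((f ^^ t) u)" and uc: "(f ^^ t) u \<in> complement b"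
      using u image_tile_add[of u t b] complement_add[of t b] b(1) by auto
    have cl: "(f ^^ t) w \<in> X closure_of (tile b ((f ^^ t) u))" if "w \<in> X closure_of (Z i)" for w
      using image_closure_tile[of t "Z i"] that im by auto
    have "(f ^^ q) z = (f ^^ t) (F (i * n) z)"
      unfolding qi by (simp add: funpow_add add.commute[of _ t])
    then have "d ((f ^^ q) z) ((f ^^ t) x) \<le> B / \<Lambda> ^ b"
      using diam[OF uc cl[OF zi] cl[OF x(1)]] by simp
    also have "\<dots> \<le> B / \<Lambda> ^ (m * n)"
      using b(2) B \<Lambda> by (intro divide_left_mono power_increasing) auto
    finally show ?thesis using Q_iter[OF x(2)] by blast
  qed
  have "\<exists>x\<in>Q. d ((f ^^ q) z) x \<le> B / \<Lambda> ^ (m * n)" for q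
  proof -
    have "(f ^^ (q mod (m * (l * n)))) z = (f ^^ q) z" by (rule funpow_mod_eq[OF fixed])
    moreover have "q mod (m * (l * n)) < m * (l * n)" using m l n by simp
    ultimately show ?thesis using near by metis
  qed
  then show thesis using that[OF zX fixed] by blast
qed

end

lemma periodic_orbit_of_periodic_point:
  assumes z: "z \<in> M" "(T ^^ p0) z = z" "p0 \<ge> 1"
  obtains p where "p \<le> p0" "periodic_orbit M T {(T ^^ i) z | i. i < p} p"
proof -
  define p where "p = (LEAST q. 0 < q \<and> (T ^^ q) z = z)"
  have ex: "0 < p0 \<and> (T ^^ p0) z = z" using z by simp
  have p: "0 < p \<and> (T ^^ p) z = z" unfolding p_def by (rule LeastI[of _ p0]) (rule ex)
  have "p \<le> p0" unfolding p_def by (rule Least_le) (rule ex)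
  moreover have "(T ^^ q) z \<noteq> z" if "0 < q" "q < p" for q
    using not_less_Least[of q "\<lambda>q. 0 < q \<and> (T ^^ q) z = z"] that unfolding p_def by blast
  ultimately show thesis using that[of p] p z(1) unfolding periodic_orbit_def by blast
qed

text \<open>Compares the period that the digraph provides with the bound \<open>(1 / \<epsilon>) powr \<kappa>\<close> when \<open>\<epsilon>\<close> is of order
\<open>1 / \<Lambda> ^ (nC * n)\<close> and \<open>c = \<kappa> * ln \<Lambda> * nC\<close>.\<close>

lemma eventually_period_bound:
  fixes c a e :: real
  assumes "c > 0"
  shows "\<forall>\<^sub>F n in sequentially. a * real n * (exp (1 + c / 2 * real n) + 2) < exp (c * (real n - 1) + e)"
proof -
  have "((\<lambda>n::nat. a * real n * (exp (1 + c / 2 * real n) + 2) / exp (c * (real n - 1) + e)) \<longlongrightarrow> 0) sequentially"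
    using assms by real_asymp
  then have "\<forall>\<^sub>F n in sequentially. a * real n * (exp (1 + c / 2 * real n) + 2) / exp (c * (real n - 1) + e) < 1"
    by (rule order_tendstoD) simp
  then show ?thesis by (simp add: divide_less_eq)
qed

theorem theorem8p11:
  fixes X :: "'a topology"
    and A :: "('a set \<times> ('a \<Rightarrow> complex)) set"
    and f :: "'a \<Rightarrow> 'a"
    and C :: "'a set"
    and nC :: nat
    and d :: "'a \<Rightarrow> 'a \<Rightarrow> real"
    and \<Lambda> :: real
  assumes "oriented_sphere X A"
    and "thurston_map X A f"
    and "expanding X A f"
    and "jordan_curve X C"
    and "post X A f \<subseteq> C"
    and "nC \<ge> 1"
    and "(f ^^ nC) ` C \<subseteq> C"
    and "visual_metric X A f d \<Lambda>"
  shows "bressaud_quas_shadowing (topspace X) d f \<and>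
    (\<forall>K \<kappa>. compactin X K \<and> K \<noteq> {} \<and> f ` K \<subseteq> K \<and> \<kappa> > 0 \<longrightarrow>
       (\<exists>\<epsilon>0>0. \<forall>\<epsilon>. 0 < \<epsilon> \<and> \<epsilon> < \<epsilon>0 \<longrightarrow>
          (\<exists>Orb p. periodic_orbit (topspace X) f Orb p \<and> real p < (1 / \<epsilon>) powr \<kappa> \<and>
             Orb \<subseteq> metric_nbhd (topspace X) d \<epsilon> K)))"
proof -
  have sph: "X homeomorphic_space top_of_set (sphere (0 :: real ^ 3) 1)"
    using assms(1) by (simp add: oriented_sphere_def)
  have metric: "Metric_space (topspace X) d" and \<Lambda>: "\<Lambda> > 1"
    using assms(8) by (simp_all add: visual_metric_def)
  obtain C' B' where C': "jordan_curve X C'" "post X A f \<subseteq> C'" "B' \<ge> 1"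
    and tiles: "\<And>n \<tau>. \<tau> \<in> tiles X f C' n \<Longrightarrow> ediam d \<tau> \<le> ennreal (B' / \<Lambda> ^ n)"
    using assms(8) unfolding visual_metric_def by auto
  have curve: "thurston_curve X A f J" if "jordan_curve X J" "post X A f \<subseteq> J" for J
    by unfold_locales (fact sph assms(2) that)+
  interpret vis: visual_sphere X A f C' d \<Lambda> B'
    by (rule visual_sphere.intro[OF curve[OF C'(1,2)] visual_sphere_axioms.intro[OF metric \<Lambda> C'(3) tiles]])
  interpret inv: invariant_curve X A f C nC
    by unfold_locales (fact sph assms(2,4-7))+
  obtain B where B: "B > 0"
    and diam: "\<And>n x a b. \<lbrakk>x \<in> inv.complement n; a \<in> X closure_of inv.tile n x;
        b \<in> X closure_of inv.tile n x\<rbrakk> \<Longrightarrow> d a b \<le> B / \<Lambda> ^ n"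
    using vis.tile_diameter[OF inv.thurston_curve_axioms] by blast
  have main: "\<exists>\<epsilon>0>0. \<forall>\<epsilon>. 0 < \<epsilon> \<and> \<epsilon> < \<epsilon>0 \<longrightarrow>
          (\<exists>Orb p. periodic_orbit (topspace X) f Orb p \<and> real p < (1 / \<epsilon>) powr \<kappa> \<and>
             Orb \<subseteq> metric_nbhd (topspace X) d \<epsilon> K)"
    if K: "compactin X K" "K \<noteq> {}" "f ` K \<subseteq> K" and \<kappa>: "\<kappa> > 0" for K \<kappa>
  proof -
    interpret K: invariant_compact X A f C nC K
      by unfold_locales (use K compactin_subset_topspace in auto)
    define c where "c = \<kappa> * ln \<Lambda> * real nC"
    have c: "c > 0" unfolding c_def using \<kappa> \<Lambda> assms(6) by simp
    obtain n0 where n0: "\<And>n s. \<lbrakk>n \<ge> n0; real s > exp (1 + c / 2 * real n)\<rbrakk>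
        \<Longrightarrow> \<not> no_closed_walk (K.successor n) s"
      using K.short_closed_walk[of "c / 2"] c by auto
    obtain n1 where n1: "\<And>n. n \<ge> n1 \<Longrightarrow>
        real nC * real n * (exp (1 + c / 2 * real n) + 2) < exp (c * (real n - 1) + - \<kappa> * ln B)"
      using eventually_period_bound[OF c, of "real nC" "- \<kappa> * ln B"]
      unfolding eventually_sequentially by blast
    define N where "N = max 1 (max n0 n1)"
    \<comment> \<open>For \<open>\<epsilon>\<close> below this value the level chosen for it exceeds \<open>N\<close>.\<close>
    define \<epsilon>0 where "\<epsilon>0 = B / \<Lambda> ^ (nC * N)"
    have "\<exists>Orb p. periodic_orbit (topspace X) f Orb p \<and> real p < (1 / \<epsilon>) powr \<kappa> \<and>
             Orb \<subseteq> metric_nbhd (topspace X) d \<epsilon> K" if \<epsilon>: "0 < \<epsilon>" "\<epsilon> < \<epsilon>0" for \<epsilon>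
    proof -
      \<comment> \<open>The least admissible level: the orbit is then \<open>\<epsilon>\<close>-close, while \<open>1 / \<epsilon>\<close> is at least \<open>\<Lambda> ^ (nC * (n - 1)) / B\<close>.\<close>
      define n where "n = (LEAST n. B / \<Lambda> ^ (nC * n) < \<epsilon>)"
      obtain k where k: "\<And>n. n \<ge> k \<Longrightarrow> B / \<Lambda> ^ n < \<epsilon>"
        using vis.eventually_small[OF \<epsilon>(1), of B] by blast
      have "k \<le> nC * k" using assms(6) by simp
      then have n: "B / \<Lambda> ^ (nC * n) < \<epsilon>"
        unfolding n_def by (intro LeastI[of "\<lambda>n. B / \<Lambda> ^ (nC * n) < \<epsilon>" k] k)
      have "n > N"
      proof (rule ccontr)
        assume "\<not> n > N"
        then have "\<Lambda> ^ (nC * n) \<le> \<Lambda> ^ (nC * N)" using \<Lambda> by (intro power_increasing) auto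
        then have "\<epsilon>0 \<le> B / \<Lambda> ^ (nC * n)"
          unfolding \<epsilon>0_def using B \<Lambda> by (intro divide_left_mono) auto
        then show False using n \<epsilon>(2) by simp
      qed
      then have nn: "n \<ge> 1" "n \<ge> n0" "n \<ge> n1" unfolding N_def by auto
      have "\<not> B / \<Lambda> ^ (nC * (n - 1)) < \<epsilon>"
        using not_less_Least[of "n - 1" "\<lambda>n. B / \<Lambda> ^ (nC * n) < \<epsilon>"] nn(1) by (simp add: n_def[symmetric])
      then have "\<Lambda> ^ (nC * (n - 1)) / B \<le> 1 / \<epsilon>"
        using B \<Lambda> \<epsilon>(1) by (simp add: field_simps)
      then have "ln (\<Lambda> ^ (nC * (n - 1)) / B) \<le> ln (1 / \<epsilon>)"
        using B \<Lambda> \<epsilon>(1) by (subst ln_le_cancel_iff) auto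
      moreover have "ln (\<Lambda> ^ (nC * (n - 1)) / B) = real nC * (real n - 1) * ln \<Lambda> - ln B"
        using B \<Lambda> nn(1) by (simp add: ln_div ln_realpow of_nat_diff)
      ultimately have "\<kappa> * (real nC * (real n - 1) * ln \<Lambda> - ln B) \<le> \<kappa> * ln (1 / \<epsilon>)"
        using \<kappa> by (simp add: mult_left_mono)
      then have "c * (real n - 1) + - \<kappa> * ln B \<le> \<kappa> * ln (1 / \<epsilon>)"
        unfolding c_def by (simp add: algebra_simps)
      then have "exp (c * (real n - 1) + - \<kappa> * ln B) \<le> exp (\<kappa> * ln (1 / \<epsilon>))" by simp
      also have "\<dots> = (1 / \<epsilon>) powr \<kappa>" using \<epsilon>(1) by (simp add: powr_def)
      finally have size: "real nC * real n * (exp (1 + c / 2 * real n) + 2) < (1 / \<epsilon>) powr \<kappa>"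
        using n1[OF nn(3)] by linarith
      define s where "s = nat \<lceil>exp (1 + c / 2 * real n)\<rceil> + 1"
      have s: "real s > exp (1 + c / 2 * real n)" "real s \<le> exp (1 + c / 2 * real n) + 2"
      proof -
        have "real (nat \<lceil>exp (1 + c / 2 * real n)\<rceil>) = real_of_int \<lceil>exp (1 + c / 2 * real n)\<rceil>"
          by (simp add: order_less_imp_le)
        then show "real s > exp (1 + c / 2 * real n)" "real s \<le> exp (1 + c / 2 * real n) + 2"
          unfolding s_def by linarith+
      qed
      obtain l w where l: "1 \<le> l" "l \<le> s" and w: "\<forall>i<l. (w i, w (Suc i)) \<in> K.successor n" "w l = w 0"
        using n0[OF nn(2) s(1)] unfolding no_closed_walk_def by blast
      obtain z where z: "z \<in> topspace X" "inv.F (l * n) z = z"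
        and near: "\<forall>q. \<exists>x\<in>K. d ((f ^^ q) z) x \<le> B / \<Lambda> ^ (nC * n)"
      proof (rule K.periodic_point_of_closed_walk[where c = w, OF metric \<Lambda> B _ l(1) nn(1) _ w(2)])
        show "d a b \<le> B / \<Lambda> ^ j"
          if "x \<in> inv.complement j" "a \<in> X closure_of inv.tile j x" "b \<in> X closure_of inv.tile j x"
          for j x a b
          by (rule diam[OF that])
        show "(w i, w (Suc i)) \<in> K.successor n" if "i < l" for i using w(1) that by blast
      qed
      have "nC * (l * n) \<ge> 1" using assms(6) l(1) nn(1) by (simp add: Suc_le_eq)
      then obtain p where p: "p \<le> nC * (l * n)" "periodic_orbit (topspace X) f {(f ^^ i) z | i. i < p} p"
        by (rule periodic_orbit_of_periodic_point[OF z])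
      have "real p \<le> real (nC * (l * n))" using p(1) by (simp only: of_nat_le_iff)
      also have "\<dots> = real nC * real n * real l" by simp
      also have "\<dots> \<le> real nC * real n * (exp (1 + c / 2 * real n) + 2)"
        using l(2) s(2) by (intro mult_left_mono) auto
      finally have "real p < (1 / \<epsilon>) powr \<kappa>" using size by linarith
      moreover have "{(f ^^ i) z | i. i < p} \<subseteq> metric_nbhd (topspace X) d \<epsilon> K"
      proof
        fix y assume "y \<in> {(f ^^ i) z | i. i < p}"
        then obtain i where i: "y = (f ^^ i) z" by blast
        interpret g: finite_open_map X "f ^^ i" by (rule vis.iterate_finite_open_map)
        obtain x where x: "x \<in> K" "d y x \<le> B / \<Lambda> ^ (nC * n)" using near i by blast
        have "esetdist d {y} K \<le> ennreal (d y x)"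
          unfolding esetdist_def by (rule INF_lower2[of y], simp, rule INF_lower[OF x(1)])
        also have "\<dots> < ennreal \<epsilon>" using x(2) n \<epsilon>(1) by (intro ennreal_lessI) auto
        finally show "y \<in> metric_nbhd (topspace X) d \<epsilon> K"
          using g.g_in[OF z(1)] i by (simp add: metric_nbhd_def)
      qed
      ultimately show ?thesis using p(2) by blast
    qed
    moreover have "\<epsilon>0 > 0" unfolding \<epsilon>0_def using B \<Lambda> by simp
    ultimately show ?thesis by blast
  qed
  have "f \<in> topspace X \<rightarrow> topspace X"
    using vis.f_cont continuous_map_funspace by blast
  then have "bressaud_quas_shadowing (topspace X) d f"
    unfolding bressaud_quas_shadowing_def vis.mtopology_eq using metric main by blast
  then show ?thesis using main by blast
qed

end
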